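(* Let $\Lambda$ be an Artin algebra and $\mathcal X$ a resolving and contravariantly finite subcategory of $\mathrm{mod}\text{-}\Lambda$. The class $\mathcal E^{\rm cw}_{\mathcal X}$ is an exact structure (in the sense of Quillen) on the additive category $\mathcal S_{\mathcal X}(\Lambda)$.
   Context: $\Lambda$ is an Artin algebra over a commutative artinian ring; $\mathrm{mod}\text{-}\Lambda$ is the category of finitely generated right $\Lambda$-modules and $\mathrm{prj}\text{-}\Lambda$ its subcategory of projectives. Subcategories are full and closed under isomorphism. $\mathcal X$ is resolving if it contains $\mathrm{prj}\text{-}\Lambda$ and is closed under finite direct sums, direct summands, extensions and kernels of epimorphisms; it is contravariantly finite if every module $M$ admits a morphism $f:X\to M$ with $X\in\mathcal X$ through which every morphism from an object of $\mathcal X$ to $M$ factors. $\mathrm H(\Lambda)$ is the (abelian) morphism category of $\mathrm{mod}\text{-}\Lambda$: objects are morphisms $(A\xrightarrow{f}B)$, morphisms are commutative squares. $\mathcal S_{\mathcal X}(\Lambda)$ is the full subcategory of $\mathrm H(\Lambda)$ of all monomorphisms $(A\xrightarrow{f}B)$ with $A,B,\mathrm{Cok}\,f\in\mathcal X$. $\mathcal E^{\rm cw}_{\mathcal X}$ is the class of all short exact sequences $0\to(X_1\xrightarrow{f}X_2)\to(Z_1\xrightarrow{h}Z_2)\to(Y_1\xrightarrow{g}Y_2)\to0$ of $\mathrm H(\Lambda)$ with terms in $\mathcal S_{\mathcal X}(\Lambda)$ such that both sequences $0\to X_i\to Z_i\to Y_i\to0$, $i=1,2$, are split. *)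

theory Defs
  imports "HOL-Algebra.Module" "HOL-Algebra.Ideal"
begin

section \<open>Categories with addition on parallel arrows\<close>

text \<open>
  An arrow records its source and target, so an arrow can itself serve as an object of the
  morphism category. The record below is raw data; the locales impose the laws.
\<close>

datatype ('o, 'f) arrow = Arrow (src: 'o) (tgt: 'o) (fn: 'f)

record ('o, 'f) precat =
  objs :: "'o set"
  arrs :: "('o, 'f) arrow set"
  ident :: "'o \<Rightarrow> ('o, 'f) arrow"
  cmp :: "('o, 'f) arrow \<Rightarrow> ('o, 'f) arrow \<Rightarrow> ('o, 'f) arrow"  (infixl \<open>\<cdot>\<index>\<close> 70)
  plus_arr :: "('o, 'f) arrow \<Rightarrow> ('o, 'f) arrow \<Rightarrow> ('o, 'f) arrow"  (infixl \<open>\<uplus>\<index>\<close> 65)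
  zero_arr :: "'o \<Rightarrow> 'o \<Rightarrow> ('o, 'f) arrow"

definition homs :: "('o, 'f) precat \<Rightarrow> 'o \<Rightarrow> 'o \<Rightarrow> ('o, 'f) arrow set" where
  "homs C A B = {f \<in> arrs C. src f = A \<and> tgt f = B}"

locale category =
  fixes C :: "('o, 'f) precat" (structure)
  assumes src_obj: "f \<in> arrs C \<Longrightarrow> src f \<in> objs C"
    and tgt_obj: "f \<in> arrs C \<Longrightarrow> tgt f \<in> objs C"
    and ident_hom: "A \<in> objs C \<Longrightarrow> ident C A \<in> homs C A A"
    and cmp_hom: "\<lbrakk>f \<in> homs C A B; g \<in> homs C B D\<rbrakk> \<Longrightarrow> g \<cdot> f \<in> homs C A D"
    and cmp_ident: "f \<in> homs C A B \<Longrightarrow> f \<cdot> ident C A = f"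
    and ident_cmp: "f \<in> homs C A B \<Longrightarrow> ident C B \<cdot> f = f"
    and cmp_assoc: "\<lbrakk>f \<in> homs C A B; g \<in> homs C B D; h \<in> homs C D E\<rbrakk>
      \<Longrightarrow> (h \<cdot> g) \<cdot> f = h \<cdot> (g \<cdot> f)"

definition is_isom :: "('o, 'f) precat \<Rightarrow> ('o, 'f) arrow \<Rightarrow> bool" where
  "is_isom C f \<longleftrightarrow> f \<in> arrs C \<and>
    (\<exists>g \<in> homs C (tgt f) (src f). g \<cdot>\<^bsub>C\<^esub> f = ident C (src f) \<and> f \<cdot>\<^bsub>C\<^esub> g = ident C (tgt f))"

definition is_mono :: "('o, 'f) precat \<Rightarrow> ('o, 'f) arrow \<Rightarrow> bool" where
  "is_mono C f \<longleftrightarrow> f \<in> arrs C \<and>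
    (\<forall>T. \<forall>g \<in> homs C T (src f). \<forall>h \<in> homs C T (src f). f \<cdot>\<^bsub>C\<^esub> g = f \<cdot>\<^bsub>C\<^esub> h \<longrightarrow> g = h)"

definition is_epi :: "('o, 'f) precat \<Rightarrow> ('o, 'f) arrow \<Rightarrow> bool" where
  "is_epi C f \<longleftrightarrow> f \<in> arrs C \<and>
    (\<forall>T. \<forall>g \<in> homs C (tgt f) T. \<forall>h \<in> homs C (tgt f) T. g \<cdot>\<^bsub>C\<^esub> f = h \<cdot>\<^bsub>C\<^esub> f \<longrightarrow> g = h)"

definition is_zero_object :: "('o, 'f) precat \<Rightarrow> 'o \<Rightarrow> bool" where
  "is_zero_object C Z \<longleftrightarrow> Z \<in> objs C \<and>
    (\<forall>A \<in> objs C. (\<exists>!f. f \<in> homs C Z A) \<and> (\<exists>!f. f \<in> homs C A Z))"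

definition is_kernel :: "('o, 'f) precat \<Rightarrow> ('o, 'f) arrow \<Rightarrow> ('o, 'f) arrow \<Rightarrow> bool" where
  "is_kernel C k f \<longleftrightarrow> k \<in> arrs C \<and> f \<in> arrs C \<and> tgt k = src f \<and>
    f \<cdot>\<^bsub>C\<^esub> k = zero_arr C (src k) (tgt f) \<and>
    (\<forall>T. \<forall>g \<in> homs C T (src f). f \<cdot>\<^bsub>C\<^esub> g = zero_arr C T (tgt f) \<longrightarrow>
      (\<exists>!h. h \<in> homs C T (src k) \<and> k \<cdot>\<^bsub>C\<^esub> h = g))"

definition is_cokernel :: "('o, 'f) precat \<Rightarrow> ('o, 'f) arrow \<Rightarrow> ('o, 'f) arrow \<Rightarrow> bool" where
  "is_cokernel C q f \<longleftrightarrow> q \<in> arrs C \<and> f \<in> arrs C \<and> src q = tgt f \<and>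
    q \<cdot>\<^bsub>C\<^esub> f = zero_arr C (src f) (tgt q) \<and>
    (\<forall>T. \<forall>g \<in> homs C (tgt f) T. g \<cdot>\<^bsub>C\<^esub> f = zero_arr C (src f) T \<longrightarrow>
      (\<exists>!h. h \<in> homs C (tgt q) T \<and> h \<cdot>\<^bsub>C\<^esub> q = g))"

definition short_exact :: "('o, 'f) precat \<Rightarrow> ('o, 'f) arrow \<Rightarrow> ('o, 'f) arrow \<Rightarrow> bool" where
  "short_exact C i p \<longleftrightarrow> is_kernel C i p \<and> is_cokernel C p i"

text \<open>\<open>i, j\<close> are the inclusions and \<open>r, p\<close> the projections of \<open>B = A \<oplus> D\<close>.\<close>

definition is_biproduct :: "('o, 'f) precat \<Rightarrow> 'o \<Rightarrow> 'o \<Rightarrow> 'o \<Rightarrow>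
    ('o, 'f) arrow \<Rightarrow> ('o, 'f) arrow \<Rightarrow> ('o, 'f) arrow \<Rightarrow> ('o, 'f) arrow \<Rightarrow> bool" where
  "is_biproduct C A D B i j r p \<longleftrightarrow>
    A \<in> objs C \<and> D \<in> objs C \<and> B \<in> objs C \<and>
    i \<in> homs C A B \<and> j \<in> homs C D B \<and> r \<in> homs C B A \<and> p \<in> homs C B D \<and>
    r \<cdot>\<^bsub>C\<^esub> i = ident C A \<and> p \<cdot>\<^bsub>C\<^esub> j = ident C D \<and>
    r \<cdot>\<^bsub>C\<^esub> j = zero_arr C D A \<and> p \<cdot>\<^bsub>C\<^esub> i = zero_arr C A D \<and>
    (i \<cdot>\<^bsub>C\<^esub> r) \<uplus>\<^bsub>C\<^esub> (j \<cdot>\<^bsub>C\<^esub> p) = ident C B"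

definition split_exact :: "('o, 'f) precat \<Rightarrow> ('o, 'f) arrow \<Rightarrow> ('o, 'f) arrow \<Rightarrow> bool" where
  "split_exact C i p \<longleftrightarrow> (\<exists>j r. is_biproduct C (src i) (tgt p) (tgt i) i j r p)"

text \<open>\<open>p'\<close> is the base change of \<open>p\<close> along \<open>g\<close>.\<close>

definition is_pullback :: "('o, 'f) precat \<Rightarrow>
    ('o, 'f) arrow \<Rightarrow> ('o, 'f) arrow \<Rightarrow> ('o, 'f) arrow \<Rightarrow> ('o, 'f) arrow \<Rightarrow> bool" where
  "is_pullback C p g p' g' \<longleftrightarrow>
    p \<in> arrs C \<and> g \<in> arrs C \<and> tgt p = tgt g \<and>
    p' \<in> arrs C \<and> g' \<in> homs C (src p') (src p) \<and> tgt p' = src g \<and>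
    p \<cdot>\<^bsub>C\<^esub> g' = g \<cdot>\<^bsub>C\<^esub> p' \<and>
    (\<forall>T. \<forall>u \<in> homs C T (src p). \<forall>v \<in> homs C T (src g). p \<cdot>\<^bsub>C\<^esub> u = g \<cdot>\<^bsub>C\<^esub> v \<longrightarrow>
      (\<exists>!w. w \<in> homs C T (src p') \<and> g' \<cdot>\<^bsub>C\<^esub> w = u \<and> p' \<cdot>\<^bsub>C\<^esub> w = v))"

text \<open>\<open>i'\<close> is the cobase change of \<open>i\<close> along \<open>g\<close>.\<close>

definition is_pushout :: "('o, 'f) precat \<Rightarrow>
    ('o, 'f) arrow \<Rightarrow> ('o, 'f) arrow \<Rightarrow> ('o, 'f) arrow \<Rightarrow> ('o, 'f) arrow \<Rightarrow> bool" where
  "is_pushout C i g i' g' \<longleftrightarrow>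
    i \<in> arrs C \<and> g \<in> arrs C \<and> src i = src g \<and>
    i' \<in> arrs C \<and> g' \<in> homs C (tgt i) (tgt i') \<and> src i' = tgt g \<and>
    g' \<cdot>\<^bsub>C\<^esub> i = i' \<cdot>\<^bsub>C\<^esub> g \<and>
    (\<forall>T. \<forall>u \<in> homs C (tgt i) T. \<forall>v \<in> homs C (tgt g) T. u \<cdot>\<^bsub>C\<^esub> i = v \<cdot>\<^bsub>C\<^esub> g \<longrightarrow>
      (\<exists>!w. w \<in> homs C (tgt i') T \<and> w \<cdot>\<^bsub>C\<^esub> g' = u \<and> w \<cdot>\<^bsub>C\<^esub> i' = v))"

locale additive_category = category +
  assumes hom_group: "\<lbrakk>A \<in> objs C; B \<in> objs C\<rbrakk> \<Longrightarrow>
      comm_group \<lparr>carrier = homs C A B, mult = plus_arr C, one = zero_arr C A B\<rparr>"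
    and cmp_plus: "\<lbrakk>f \<in> homs C A B; g \<in> homs C B D; h \<in> homs C B D\<rbrakk>
      \<Longrightarrow> (g \<uplus> h) \<cdot> f = (g \<cdot> f) \<uplus> (h \<cdot> f)"
    and plus_cmp: "\<lbrakk>f \<in> homs C A B; g \<in> homs C A B; h \<in> homs C B D\<rbrakk>
      \<Longrightarrow> h \<cdot> (f \<uplus> g) = (h \<cdot> f) \<uplus> (h \<cdot> g)"
    and zero_object: "\<exists>Z. is_zero_object C Z"
    and biproduct: "\<lbrakk>A \<in> objs C; D \<in> objs C\<rbrakk> \<Longrightarrow> \<exists>B i j r p. is_biproduct C A D B i j r p"

text \<open>
  Quillen's original axioms for an additive category \<open>C\<close> with a class \<open>\<E>\<close> of composable pairs
  \<open>(i, p)\<close>, the sequences \<open>0 \<rightarrow> src i \<rightarrow> tgt i = src p \<rightarrow> tgt p \<rightarrow> 0\<close>. The last two axioms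
  follow from the others by a theorem of Keller, but belong to Quillen's definition.
\<close>

locale quillen_exact_category = additive_category +
  fixes \<E> :: "(('o, 'f) arrow \<times> ('o, 'f) arrow) set"
  assumes iso_closed: "\<lbrakk>(i, p) \<in> \<E>; i' \<in> arrs C; p' \<in> arrs C; tgt i' = src p';
      is_isom C a; is_isom C b; is_isom C c;
      a \<in> homs C (src i) (src i'); b \<in> homs C (tgt i) (tgt i'); c \<in> homs C (tgt p) (tgt p');
      b \<cdot> i = i' \<cdot> a; c \<cdot> p = p' \<cdot> b\<rbrakk> \<Longrightarrow> (i', p') \<in> \<E>"
    and split: "split_exact C i p \<Longrightarrow> (i, p) \<in> \<E>"
    and exact: "(i, p) \<in> \<E> \<Longrightarrow> short_exact C i p"
    and epi_cmp: "\<lbrakk>(i, p) \<in> \<E>; (j, q) \<in> \<E>; tgt p = src q\<rbrakk> \<Longrightarrow> \<exists>k. (k, q \<cdot> p) \<in> \<E>"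
    and mono_cmp: "\<lbrakk>(i, p) \<in> \<E>; (j, q) \<in> \<E>; tgt i = src j\<rbrakk> \<Longrightarrow> \<exists>c. (j \<cdot> i, c) \<in> \<E>"
    and base_change: "\<lbrakk>(i, p) \<in> \<E>; g \<in> arrs C; tgt g = tgt p\<rbrakk>
      \<Longrightarrow> \<exists>p' g' k. is_pullback C p g p' g' \<and> (k, p') \<in> \<E>"
    and cobase_change: "\<lbrakk>(i, p) \<in> \<E>; g \<in> arrs C; src g = src i\<rbrakk>
      \<Longrightarrow> \<exists>i' g' c. is_pushout C i g i' g' \<and> (i', c) \<in> \<E>"
    and obscure_epi: "\<lbrakk>is_kernel C k f; g \<in> arrs C; tgt g = src f; (i, f \<cdot> g) \<in> \<E>\<rbrakk>
      \<Longrightarrow> \<exists>k'. (k', f) \<in> \<E>"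
    and obscure_mono: "\<lbrakk>is_cokernel C q f; g \<in> arrs C; src g = tgt f; (g \<cdot> f, p) \<in> \<E>\<rbrakk>
      \<Longrightarrow> \<exists>q'. (f, q') \<in> \<E>"

definition full_subcat :: "('o, 'f) precat \<Rightarrow> 'o set \<Rightarrow> ('o, 'f) precat" where
  "full_subcat C X = C\<lparr>objs := X, arrs := {f \<in> arrs C. src f \<in> X \<and> tgt f \<in> X}\<rparr>"


section \<open>Subcategories of an abelian category\<close>

text \<open>A full subcategory is given by its set of objects.\<close>

definition projective :: "('o, 'f) precat \<Rightarrow> 'o \<Rightarrow> bool" where
  "projective C P \<longleftrightarrow> P \<in> objs C \<and>
    (\<forall>e g. is_epi C e \<and> g \<in> homs C P (tgt e) \<longrightarrow> (\<exists>h \<in> homs C P (src e). e \<cdot>\<^bsub>C\<^esub> h = g))"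

text \<open>
  Closure under the empty direct sum follows from \<open>projectives\<close>, since zero objects are projective.
\<close>

locale resolving =
  fixes C :: "('o, 'f) precat" (structure) and X :: "'o set"
  assumes subset: "X \<subseteq> objs C"
    and iso_closed: "\<lbrakk>is_isom C f; src f \<in> X\<rbrakk> \<Longrightarrow> tgt f \<in> X"
    and projectives: "projective C P \<Longrightarrow> P \<in> X"
    and direct_sums: "\<lbrakk>is_biproduct C A D B i j r p; A \<in> X; D \<in> X\<rbrakk> \<Longrightarrow> B \<in> X"
    and direct_summands: "\<lbrakk>is_biproduct C A D B i j r p; B \<in> X\<rbrakk> \<Longrightarrow> A \<in> X"
    and extensions: "\<lbrakk>short_exact C i p; src i \<in> X; tgt p \<in> X\<rbrakk> \<Longrightarrow> tgt i \<in> X"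
    and kernels_of_epis: "\<lbrakk>is_epi C f; src f \<in> X; tgt f \<in> X; is_kernel C k f\<rbrakk> \<Longrightarrow> src k \<in> X"

definition contravariantly_finite :: "('o, 'f) precat \<Rightarrow> 'o set \<Rightarrow> bool" where
  "contravariantly_finite C X \<longleftrightarrow>
    (\<forall>M \<in> objs C. \<exists>A \<in> X. \<exists>f \<in> homs C A M.
      \<forall>B \<in> X. \<forall>g \<in> homs C B M. \<exists>h \<in> homs C B A. f \<cdot>\<^bsub>C\<^esub> h = g)"


section \<open>The morphism category and the class of degreewise split sequences\<close>

text \<open>
  Objects are the arrows of \<open>C\<close>; an arrow \<open>f \<rightarrow> g\<close> is a pair \<open>(a, b)\<close> of arrows of \<open>C\<close> with
  \<open>g \<cdot> a = b \<cdot> f\<close>.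
\<close>

type_synonym ('o, 'f) mor_arrow =
  "(('o, 'f) arrow, ('o, 'f) arrow \<times> ('o, 'f) arrow) arrow"

abbreviation comp1 :: "('o, 'f) mor_arrow \<Rightarrow> ('o, 'f) arrow" where
  "comp1 u \<equiv> fst (fn u)"

abbreviation comp2 :: "('o, 'f) mor_arrow \<Rightarrow> ('o, 'f) arrow" where
  "comp2 u \<equiv> snd (fn u)"

definition mor_cat ::
  "('o, 'f) precat \<Rightarrow> (('o, 'f) arrow, ('o, 'f) arrow \<times> ('o, 'f) arrow) precat" where
  "mor_cat C =
    \<lparr>objs = arrs C,
     arrs = {u. src u \<in> arrs C \<and> tgt u \<in> arrs C \<and>
       comp1 u \<in> homs C (src (src u)) (src (tgt u)) \<and>
       comp2 u \<in> homs C (tgt (src u)) (tgt (tgt u)) \<and>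
       tgt u \<cdot>\<^bsub>C\<^esub> comp1 u = comp2 u \<cdot>\<^bsub>C\<^esub> src u},
     ident = (\<lambda>f. Arrow f f (ident C (src f), ident C (tgt f))),
     cmp = (\<lambda>v u. Arrow (src u) (tgt v) (comp1 v \<cdot>\<^bsub>C\<^esub> comp1 u, comp2 v \<cdot>\<^bsub>C\<^esub> comp2 u)),
     plus_arr = (\<lambda>u v. Arrow (src u) (tgt u)
       (comp1 u \<uplus>\<^bsub>C\<^esub> comp1 v, comp2 u \<uplus>\<^bsub>C\<^esub> comp2 v)),
     zero_arr = (\<lambda>f g. Arrow f g (zero_arr C (src f) (src g), zero_arr C (tgt f) (tgt g)))\<rparr>"

text \<open>
  The subcategory \<open>X\<close> is meant to be closed under isomorphism, so it does not matter which
  cokernel of \<open>f\<close> is taken.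
\<close>

definition S_objs :: "('o, 'f) precat \<Rightarrow> 'o set \<Rightarrow> ('o, 'f) arrow set" where
  "S_objs C X = {f. is_mono C f \<and> src f \<in> X \<and> tgt f \<in> X \<and> (\<exists>q. is_cokernel C q f \<and> tgt q \<in> X)}"

definition S_cat ::
  "('o, 'f) precat \<Rightarrow> 'o set \<Rightarrow> (('o, 'f) arrow, ('o, 'f) arrow \<times> ('o, 'f) arrow) precat" where
  "S_cat C X = full_subcat (mor_cat C) (S_objs C X)"

definition E_cw ::
  "('o, 'f) precat \<Rightarrow> 'o set \<Rightarrow> (('o, 'f) mor_arrow \<times> ('o, 'f) mor_arrow) set" where
  "E_cw C X = {(i, p). short_exact (mor_cat C) i p \<and>
    src i \<in> S_objs C X \<and> tgt i \<in> S_objs C X \<and> tgt p \<in> S_objs C X \<and>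
    split_exact C (comp1 i) (comp1 p) \<and> split_exact C (comp2 i) (comp2 p)}"


section \<open>Finitely generated right modules\<close>

text \<open>
  The library's record for modules is reused for right modules: \<open>a \<odot>\<^bsub>M\<^esub> x\<close> stands for \<open>x a\<close>.
  Its \<open>mult\<close> and \<open>one\<close> fields play no role.
\<close>

locale right_module = R?: ring R + M?: abelian_group M
  for R (structure) and M :: "('a, 'm) module" (structure) +
  assumes smult_closed: "\<lbrakk>a \<in> carrier R; x \<in> carrier M\<rbrakk> \<Longrightarrow> a \<odot>\<^bsub>M\<^esub> x \<in> carrier M"
    and smult_l_distr: "\<lbrakk>a \<in> carrier R; b \<in> carrier R; x \<in> carrier M\<rbrakk>
      \<Longrightarrow> (a \<oplus> b) \<odot>\<^bsub>M\<^esub> x = a \<odot>\<^bsub>M\<^esub> x \<oplus>\<^bsub>M\<^esub> b \<odot>\<^bsub>M\<^esub> x"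
    and smult_r_distr: "\<lbrakk>a \<in> carrier R; x \<in> carrier M; y \<in> carrier M\<rbrakk>
      \<Longrightarrow> a \<odot>\<^bsub>M\<^esub> (x \<oplus>\<^bsub>M\<^esub> y) = a \<odot>\<^bsub>M\<^esub> x \<oplus>\<^bsub>M\<^esub> a \<odot>\<^bsub>M\<^esub> y"
    and smult_assoc: "\<lbrakk>a \<in> carrier R; b \<in> carrier R; x \<in> carrier M\<rbrakk>
      \<Longrightarrow> (a \<otimes> b) \<odot>\<^bsub>M\<^esub> x = b \<odot>\<^bsub>M\<^esub> (a \<odot>\<^bsub>M\<^esub> x)"
    and smult_one: "x \<in> carrier M \<Longrightarrow> \<one> \<odot>\<^bsub>M\<^esub> x = x"

definition fin_gen :: "('a, 'r) ring_scheme \<Rightarrow> ('a, 'm) module \<Rightarrow> bool" where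
  "fin_gen R M \<longleftrightarrow> (\<exists>S. finite S \<and> S \<subseteq> carrier M \<and>
    (\<forall>N. submodule N R M \<and> S \<subseteq> N \<longrightarrow> N = carrier M))"

text \<open>Homomorphisms are extensional, so that equal homomorphisms are equal functions.\<close>

definition rmod_hom ::
  "('a, 'r) ring_scheme \<Rightarrow> ('a, 'm) module \<Rightarrow> ('a, 'n) module \<Rightarrow> ('m \<Rightarrow> 'n) set" where
  "rmod_hom R M N = {f \<in> carrier M \<rightarrow>\<^sub>E carrier N.
    (\<forall>x \<in> carrier M. \<forall>y \<in> carrier M. f (x \<oplus>\<^bsub>M\<^esub> y) = f x \<oplus>\<^bsub>N\<^esub> f y) \<and>
    (\<forall>a \<in> carrier R. \<forall>x \<in> carrier M. f (a \<odot>\<^bsub>M\<^esub> x) = a \<odot>\<^bsub>N\<^esub> f x)}"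

definition mod_cat :: "('a, 'r) ring_scheme \<Rightarrow> (('a, 'm) module, 'm \<Rightarrow> 'm) precat" where
  "mod_cat R =
    \<lparr>objs = {M. right_module R M \<and> fin_gen R M},
     arrs = {f. right_module R (src f) \<and> fin_gen R (src f) \<and>
       right_module R (tgt f) \<and> fin_gen R (tgt f) \<and> fn f \<in> rmod_hom R (src f) (tgt f)},
     ident = (\<lambda>M. Arrow M M (\<lambda>x \<in> carrier M. x)),
     cmp = (\<lambda>g f. Arrow (src f) (tgt g) (compose (carrier (src f)) (fn g) (fn f))),
     plus_arr = (\<lambda>f g. Arrow (src f) (tgt f)
       (\<lambda>x \<in> carrier (src f). fn f x \<oplus>\<^bsub>tgt f\<^esub> fn g x)),
     zero_arr = (\<lambda>M N. Arrow M N (\<lambda>x \<in> carrier M. \<zero>\<^bsub>N\<^esub>))\<rparr>"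

text \<open>
  The modules in \<open>mod_cat R\<close> have their elements in one type \<open>'m\<close>. The next condition ensures that
  this is no restriction: up to isomorphism every finitely generated right module over \<open>R\<close>, on
  whatever type, occurs (lemma \<open>fg_universe_copy\<close> below). For instance \<open>'a list\<close> qualifies for every
  ring on the type \<open>'a\<close>.
\<close>

definition fg_universe :: "('a, 'r) ring_scheme \<Rightarrow> 'm itself \<Rightarrow> bool" where
  "fg_universe R _ \<longleftrightarrow> infinite (UNIV :: 'm set) \<and> (\<exists>\<iota> :: 'a \<Rightarrow> 'm. inj_on \<iota> (carrier R))"

lemma fg_universe_list: "fg_universe (R :: ('a, 'r) ring_scheme) TYPE('a list)"
  unfolding fg_universe_def
  by (auto simp: infinite_UNIV_listI intro!: exI[of _ "\<lambda>x. [x]"] inj_onI)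

lemma inj_list_code:
  assumes "infinite (UNIV :: 'm set)"
  shows "\<exists>e :: 'm list \<Rightarrow> 'm. inj e"
proof -
  obtain P :: "'m \<times> 'm \<Rightarrow> 'm" where "bij_betw P (UNIV \<times> UNIV) UNIV"
    using card_of_ordIso[THEN iffD2, OF card_of_Times_same_infinite[OF assms]] by blast
  then have P: "P (x, y) = P (x', y') \<longleftrightarrow> x = x' \<and> y = y'" for x y x' y'
    using inj_on_eq_iff[OF bij_betw_imp_inj_on, of P "UNIV \<times> UNIV" UNIV "(x, y)" "(x', y')"] by simp
  obtain N :: "nat \<Rightarrow> 'm" where N: "inj N"
    using assms infinite_countable_subset by blast
  define f where "f xs = foldr (\<lambda>x y. P (x, y)) xs (N 0)" for xs
  have f: "length xs = length ys \<Longrightarrow> f xs = f ys \<Longrightarrow> xs = ys" for xs ys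
    by (induction xs ys rule: list_induct2) (auto simp: f_def P)
  have "inj (\<lambda>xs. P (N (length xs), f xs))"
    by (rule injI) (auto simp: P inj_eq[OF N] dest: f)
  then show ?thesis by blast
qed

lemma fin_gen_inj:
  fixes M :: "('a, 'b) module"
  assumes U: "fg_universe R TYPE('m)" and M: "right_module R M" and fg: "fin_gen R M"
  shows "\<exists>g :: 'b \<Rightarrow> 'm. inj_on g (carrier M)"
proof -
  interpret right_module R M by (rule M)
  obtain S where S: "finite S" "S \<subseteq> carrier M"
    and gen: "\<forall>N. submodule N R M \<and> S \<subseteq> N \<longrightarrow> N = carrier M"
    using fg unfolding fin_gen_def by (elim exE conjE)
  define ev where "ev l = foldr (\<lambda>(a, s) x. a \<odot>\<^bsub>M\<^esub> s \<oplus>\<^bsub>M\<^esub> x) l \<zero>\<^bsub>M\<^esub>" for l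
  define L where "L = lists (carrier R \<times> S)"
  have ev_simps [simp]: "ev [] = \<zero>\<^bsub>M\<^esub>" "ev ((a, s) # l) = a \<odot>\<^bsub>M\<^esub> s \<oplus>\<^bsub>M\<^esub> ev l" for a s l
    by (simp_all add: ev_def)
  have ev_closed: "ev l \<in> carrier M" if "l \<in> L" for l
    using that
  proof (induction l)
    case Nil
    then show ?case by simp
  next
    case (Cons x l)
    obtain a s where x: "x = (a, s)" by force
    then have "a \<in> carrier R" "s \<in> carrier M" "l \<in> L"
      using Cons.prems S by (auto simp: L_def)
    then show ?case
      using Cons.IH x by (simp add: smult_closed)
  qed
  have ev_append: "ev (l @ l') = ev l \<oplus>\<^bsub>M\<^esub> ev l'" if "l \<in> L" "l' \<in> L" for l l'
    using that(1)
  proof (induction l)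
    case Nil
    then show ?case using ev_closed[OF that(2)] by simp
  next
    case (Cons x l)
    obtain a s where x: "x = (a, s)" by force
    then have "a \<in> carrier R" "s \<in> carrier M" "l \<in> L"
      using Cons.prems S by (auto simp: L_def)
    then show ?case
      using Cons.IH ev_closed[OF that(2)] ev_closed[of l] x
      by (simp add: smult_closed M.a_assoc)
  qed
  have ev_smult: "r \<odot>\<^bsub>M\<^esub> ev l \<in> ev ` L" if "r \<in> carrier R" "l \<in> L" for r l
  proof -
    have zero: "r \<odot>\<^bsub>M\<^esub> \<zero>\<^bsub>M\<^esub> = \<zero>\<^bsub>M\<^esub>"
    proof -
      have "r \<odot>\<^bsub>M\<^esub> \<zero>\<^bsub>M\<^esub> \<oplus>\<^bsub>M\<^esub> r \<odot>\<^bsub>M\<^esub> \<zero>\<^bsub>M\<^esub> = r \<odot>\<^bsub>M\<^esub> \<zero>\<^bsub>M\<^esub>"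
        using smult_r_distr[of r "\<zero>\<^bsub>M\<^esub>" "\<zero>\<^bsub>M\<^esub>"] that by simp
      then show ?thesis
        using smult_closed[of r "\<zero>\<^bsub>M\<^esub>"] that M.add.l_cancel_one' by (metis M.zero_closed)
    qed
    have "map (\<lambda>(a, s). (a \<otimes>\<^bsub>R\<^esub> r, s)) l \<in> L"
      using that unfolding L_def by (induction l) auto
    moreover have "r \<odot>\<^bsub>M\<^esub> ev l = ev (map (\<lambda>(a, s). (a \<otimes>\<^bsub>R\<^esub> r, s)) l)"
      using that(2)
    proof (induction l)
      case Nil
      then show ?case by (simp add: zero)
    next
      case (Cons x l)
      obtain a s where x: "x = (a, s)" by force
      then have "a \<in> carrier R" "s \<in> carrier M" "l \<in> L"
        using Cons.prems S by (auto simp: L_def)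
      then show ?case
        using Cons.IH ev_closed[of l] x that(1)
        by (simp add: smult_closed smult_r_distr smult_assoc)
    qed
    ultimately show ?thesis by blast
  qed
  have neg: "\<ominus>\<^bsub>M\<^esub> x = (\<ominus>\<^bsub>R\<^esub> \<one>\<^bsub>R\<^esub>) \<odot>\<^bsub>M\<^esub> x" if "x \<in> carrier M" for x
  proof (rule M.minus_equality)
    have z: "\<zero>\<^bsub>R\<^esub> \<odot>\<^bsub>M\<^esub> x = \<zero>\<^bsub>M\<^esub>"
    proof -
      have "\<zero>\<^bsub>R\<^esub> \<odot>\<^bsub>M\<^esub> x \<oplus>\<^bsub>M\<^esub> \<zero>\<^bsub>R\<^esub> \<odot>\<^bsub>M\<^esub> x = \<zero>\<^bsub>R\<^esub> \<odot>\<^bsub>M\<^esub> x"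
        using smult_l_distr[of "\<zero>\<^bsub>R\<^esub>" "\<zero>\<^bsub>R\<^esub>" x] that by simp
      then show ?thesis
        using smult_closed[of "\<zero>\<^bsub>R\<^esub>" x] that M.add.l_cancel_one' by (metis R.zero_closed)
    qed
    show "(\<ominus>\<^bsub>R\<^esub> \<one>\<^bsub>R\<^esub>) \<odot>\<^bsub>M\<^esub> x \<oplus>\<^bsub>M\<^esub> x = \<zero>\<^bsub>M\<^esub>"
      using smult_l_distr[of "\<ominus>\<^bsub>R\<^esub> \<one>\<^bsub>R\<^esub>" "\<one>\<^bsub>R\<^esub>" x] that smult_one[OF that]
      by (simp add: z R.l_neg)
  qed (use that in \<open>auto intro: smult_closed\<close>)
  have "submodule (ev ` L) R M"
  proof (intro submodule.intro submodule_axioms.intro)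
    show "subgroup (ev ` L) (add_monoid M)"
    proof (rule M.add.subgroupI)
      show "ev ` L \<noteq> {}" by (auto simp: L_def)
    next
      fix x assume "x \<in> ev ` L"
      then show "\<ominus>\<^bsub>M\<^esub> x \<in> ev ` L" using neg ev_closed ev_smult by auto
    next
      fix x y assume "x \<in> ev ` L" "y \<in> ev ` L"
      then obtain l l' where "x = ev l" "y = ev l'" "l \<in> L" "l' \<in> L" by blast
      then have "x \<oplus>\<^bsub>M\<^esub> y = ev (l @ l')" "l @ l' \<in> L"
        using ev_append by (auto simp: L_def)
      then show "x \<oplus>\<^bsub>M\<^esub> y \<in> ev ` L" by blast
    qed (use ev_closed in auto)
  qed (use ev_smult in auto)
  moreover have "S \<subseteq> ev ` L"
  proof
    fix s assume s: "s \<in> S"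
    then have "ev [(\<one>\<^bsub>R\<^esub>, s)] = s" "[(\<one>\<^bsub>R\<^esub>, s)] \<in> L"
      using S smult_one by (auto simp: L_def)
    then show "s \<in> ev ` L" by (metis imageI)
  qed
  ultimately have carr: "carrier M = ev ` L" using gen by simp
  obtain \<iota> :: "'a \<Rightarrow> 'm" where \<iota>: "inj_on \<iota> (carrier R)" and inf: "infinite (UNIV :: 'm set)"
    using U by (auto simp: fg_universe_def)
  obtain e :: "'m list \<Rightarrow> 'm" where e: "inj e" using inj_list_code[OF inf] by blast
  obtain N :: "nat \<Rightarrow> 'm" where N: "inj N" using inf infinite_countable_subset by blast
  obtain t :: "'b \<Rightarrow> nat" where t: "inj_on t S" using finite_imp_inj_to_nat_seg[OF S(1)] by blast
  define c where "c = (\<lambda>(a, s). e [\<iota> a, N (t s)])"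
  have c: "inj_on c (carrier R \<times> S)"
  proof (rule inj_onI)
    fix u v assume u: "u \<in> carrier R \<times> S" and v: "v \<in> carrier R \<times> S" and eq: "c u = c v"
    have "\<iota> (fst u) = \<iota> (fst v)" "t (snd u) = t (snd v)"
      using eq by (simp_all add: c_def split_beta inj_eq[OF e] inj_eq[OF N])
    moreover have "fst u \<in> carrier R" "fst v \<in> carrier R" "snd u \<in> S" "snd v \<in> S"
      using u v by auto
    ultimately have "fst u = fst v" "snd u = snd v"
      using inj_onD[OF \<iota>] inj_onD[OF t] by blast+
    then show "u = v" by (rule prod_eqI)
  qed
  have m: "inj_on (map c) L"
    unfolding L_def using c by (rule inj_on_map_lists)
  define g where "g = (\<lambda>x. e (map c (inv_into L ev x)))"
  have "inj_on g (carrier M)"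
  proof (rule inj_onI)
    fix x y assume x: "x \<in> carrier M" and y: "y \<in> carrier M" and "g x = g y"
    then have "map c (inv_into L ev x) = map c (inv_into L ev y)"
      by (simp only: g_def inj_eq[OF e])
    moreover have "inv_into L ev x \<in> L" "inv_into L ev y \<in> L"
      using inv_into_into[of x ev L] inv_into_into[of y ev L] x y unfolding carr by blast+
    ultimately have "inv_into L ev x = inv_into L ev y" by (rule inj_onD[OF m])
    then show "x = y" using inv_into_injective[of L ev x y] x y unfolding carr by blast
  qed
  then show ?thesis by blast
qed

lemma fg_universe_copy:
  fixes M :: "('a, 'b) module"
  assumes U: "fg_universe R TYPE('m)" and M: "right_module R M" and fg: "fin_gen R M"
  shows "\<exists>(N :: ('a, 'm) module) h. right_module R N \<and> fin_gen R N \<and>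
    h \<in> rmod_hom R M N \<and> bij_betw h (carrier M) (carrier N)"
proof -
  interpret right_module R M by (rule M)
  obtain g :: "'b \<Rightarrow> 'm" where g: "inj_on g (carrier M)"
    using fin_gen_inj[OF assms] by blast
  define k where "k = inv_into (carrier M) g"
  have kg [simp]: "x \<in> carrier M \<Longrightarrow> k (g x) = x" for x
    using g by (simp add: k_def)
  define N :: "('a, 'm) module" where "N = \<lparr>carrier = g ` carrier M, mult = undefined,
    one = undefined, zero = g \<zero>\<^bsub>M\<^esub>, add = (\<lambda>x y. g (k x \<oplus>\<^bsub>M\<^esub> k y)),
    smult = (\<lambda>a x. g (a \<odot>\<^bsub>M\<^esub> k x))\<rparr>"
  have N_simps [simp]: "carrier N = g ` carrier M" "\<zero>\<^bsub>N\<^esub> = g \<zero>\<^bsub>M\<^esub>"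
    "x \<oplus>\<^bsub>N\<^esub> y = g (k x \<oplus>\<^bsub>M\<^esub> k y)" "a \<odot>\<^bsub>N\<^esub> x = g (a \<odot>\<^bsub>M\<^esub> k x)" for a x y
    by (simp_all add: N_def)
  have "abelian_group N"
  proof (rule abelian_groupI)
    fix x assume "x \<in> carrier N"
    then obtain u where u: "x = g u" "u \<in> carrier M" by auto
    then have "g (\<ominus>\<^bsub>M\<^esub> u) \<oplus>\<^bsub>N\<^esub> x = \<zero>\<^bsub>N\<^esub>" by (simp add: M.l_neg)
    then show "\<exists>y \<in> carrier N. y \<oplus>\<^bsub>N\<^esub> x = \<zero>\<^bsub>N\<^esub>"
      using u by (intro bexI[of _ "g (\<ominus>\<^bsub>M\<^esub> u)"]) auto
  qed (auto simp: M.a_ac)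
  then have N: "right_module R N"
    by (intro right_module.intro right_module_axioms.intro)
      (auto simp: smult_closed smult_l_distr smult_r_distr smult_assoc smult_one
        R.ring_axioms)
  define h where "h = restrict g (carrier M)"
  have h: "h \<in> rmod_hom R M N"
    by (auto simp: rmod_hom_def h_def smult_closed)
  have bij: "bij_betw h (carrier M) (carrier N)"
    using g by (auto simp: h_def bij_betw_def)
  interpret N: right_module R N by (rule N)
  obtain S where S: "finite S" "S \<subseteq> carrier M"
    and gen: "\<forall>T. submodule T R M \<and> S \<subseteq> T \<longrightarrow> T = carrier M"
    using fg unfolding fin_gen_def by (elim exE conjE)
  have "T = carrier N" if T: "submodule T R N" and ST: "g ` S \<subseteq> T" for T
  proof -
    interpret T: submodule T R N by (rule T)
    have TN: "T \<subseteq> g ` carrier M" using T.subset by simp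
    define V where "V = {x \<in> carrier M. g x \<in> T}"
    have "submodule V R M"
    proof (intro submodule.intro submodule_axioms.intro)
      show "subgroup V (add_monoid M)"
      proof (rule M.add.subgroupI)
        show "V \<noteq> {}" using T.one_closed by (auto simp: V_def)
      next
        fix x assume x: "x \<in> V"
        then have "\<ominus>\<^bsub>N\<^esub> g x \<in> T" using T.m_inv_closed by (simp add: V_def a_inv_def)
        moreover have "\<ominus>\<^bsub>N\<^esub> g x = g (\<ominus>\<^bsub>M\<^esub> x)"
          using x by (intro N.M.minus_equality) (auto simp: V_def M.l_neg)
        ultimately show "\<ominus>\<^bsub>M\<^esub> x \<in> V" using x by (simp add: V_def)
      next
        fix x y assume "x \<in> V" "y \<in> V"
        then show "x \<oplus>\<^bsub>M\<^esub> y \<in> V"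
          using T.m_closed[of "g x" "g y"] by (simp add: V_def)
      qed (auto simp: V_def)
      fix a x assume "a \<in> carrier R" "x \<in> V"
      then show "a \<odot>\<^bsub>M\<^esub> x \<in> V"
        using T.smult_closed[of a "g x"] by (simp add: V_def smult_closed)
    qed
    moreover have "S \<subseteq> V" using S ST by (auto simp: V_def)
    ultimately have "V = carrier M" using gen by simp
    then show ?thesis using TN by (auto simp: V_def)
  qed
  then have "fin_gen R N"
    unfolding fin_gen_def using S by (intro exI[of _ "g ` S"]) auto
  with N h bij show ?thesis by blast
qed


section \<open>Artin algebras\<close>

locale artinian_cring = cring +
  assumes descending_chain: "\<lbrakk>\<And>n::nat. ideal (I n) R; \<And>n. I (Suc n) \<subseteq> I n\<rbrakk>
    \<Longrightarrow> \<exists>n. \<forall>m \<ge> n. I m = I n"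

definition restrict_scalars ::
  "('k \<Rightarrow> 'a) \<Rightarrow> ('a, 'r) ring_scheme \<Rightarrow> ('k, 'a) module" where
  "restrict_scalars \<phi> A = \<lparr>carrier = carrier A, mult = mult A, one = one A,
    zero = zero A, add = add A, smult = (\<lambda>k x. x \<otimes>\<^bsub>A\<^esub> \<phi> k)\<rparr>"

locale artin_algebra = K: artinian_cring K + A: ring A
  for K :: "('k, 'l) ring_scheme" and A :: "('a, 'r) ring_scheme" +
  fixes \<phi> :: "'k \<Rightarrow> 'a"
  assumes structure_hom: "\<phi> \<in> ring_hom K A"
    and central: "\<lbrakk>k \<in> carrier K; x \<in> carrier A\<rbrakk> \<Longrightarrow> \<phi> k \<otimes>\<^bsub>A\<^esub> x = x \<otimes>\<^bsub>A\<^esub> \<phi> k"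
    and finitely_generated: "fin_gen K (restrict_scalars \<phi> A)"

end

theory Submission
  imports Defs
begin

text \<open>
  Kernels and cokernels of the morphism category are computed degreewise. Therefore a composable
  pair whose two components are split exact is automatically a kernel-cokernel pair, and
  \<open>E_cw C X\<close> consists of the degreewise split pairs with all three terms in \<open>\<S> = S_objs C X\<close>
  (lemma \<open>E_cw_iff\<close>). Quillen's axioms thereby become closure properties of \<open>\<S>\<close>.

  In coordinates, the middle term of a degreewise split pair with outer terms \<open>f: A1 \<rightarrow> A2\<close> and
  \<open>g: B1 \<rightarrow> B2\<close> is a triangular matrix \<open>h: A1 \<oplus> B1 \<rightarrow> A2 \<oplus> B2\<close> with diagonal entries \<open>f\<close> and \<open>g\<close>.
  If \<open>g\<close> is injective, then \<open>0 \<rightarrow> Cok f \<rightarrow> Cok h \<rightarrow> Cok g \<rightarrow> 0\<close> is exact; this is the part of the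
  snake lemma on which everything rests (\<open>mod_cokernel_sequence\<close>). Since \<open>X\<close> is closed under
  extensions, \<open>\<S>\<close> is closed under degreewise split extensions (\<open>S_objs_extension\<close>); since \<open>X\<close> is
  closed under kernels of epimorphisms, a degreewise split epimorphism between objects of \<open>\<S>\<close> has
  its kernel in \<open>\<S>\<close> (\<open>S_objs_kernel\<close>); since \<open>X\<close> is closed under direct summands, \<open>\<S>\<close> is closed
  under retracts (\<open>S_objs_retract\<close>).

  Deflations are consequently just the morphisms of \<open>\<S>\<close> with split epimorphic components, which
  gives their composition and the first of the two obscure axioms. The base change of a deflation
  \<open>Z \<rightarrow> B\<close> with kernel \<open>A\<close> along \<open>V \<rightarrow> B\<close> has the middle term \<open>An \<oplus> Vn\<close> in degree \<open>n\<close>, so it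
  is an extension of \<open>V\<close> by \<open>A\<close> and lies in \<open>\<S>\<close>; cobase change is dual. Inflations are more
  delicate, because the cokernel of a degreewise split monomorphism between objects of \<open>\<S>\<close> can fail to be a monomorphism. The
  cokernel of a composite of inflations, and the cokernel of \<open>f\<close> when \<open>g \<cdot> f\<close> is an inflation, are
  both exhibited as retracts of a pushout that is an extension of objects of \<open>\<S>\<close>
  (\<open>E_cw_mono_cmp\<close>, \<open>E_cw_mono_cancel\<close>).

  The argument is carried out over any additive category with cokernels in which the sequence of
  cokernels above is exact. Kernels are obtained from cokernels there: the complement of
  a split monomorphism is its cokernel, and the kernel of \<open>Cok h \<rightarrow> Cok g\<close> is \<open>Cok f\<close>. For finitely
  generated modules the exactness is a chase of elements, which is possible because monomorphisms
  are injective, as one sees by testing them on cyclic submodules.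
\<close>


section \<open>Additive categories and biproducts\<close>

lemma homs_iff: "f \<in> homs C A B \<longleftrightarrow> f \<in> arrs C \<and> src f = A \<and> tgt f = B"
  by (simp add: homs_def)

context category
begin

lemma ends_obj [simp]: "f \<in> arrs C \<Longrightarrow> src f \<in> objs C" "f \<in> arrs C \<Longrightarrow> tgt f \<in> objs C"
  by (rule src_obj tgt_obj, assumption)+

lemma cmp_arr [simp]:
  assumes "f \<in> arrs C" "g \<in> arrs C" "src g = tgt f"
  shows "g \<cdot> f \<in> arrs C" "src (g \<cdot> f) = src f" "tgt (g \<cdot> f) = tgt g"
  using cmp_hom[of f "src f" "tgt f" g "tgt g"] assms by (simp_all add: homs_iff)

lemma ident_arr [simp]:
  assumes "A \<in> objs C"
  shows "ident C A \<in> arrs C" "src (ident C A) = A" "tgt (ident C A) = A"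
  using ident_hom[OF assms] by (simp_all add: homs_iff)

lemma cmp_ident_arr [simp]: "\<lbrakk>f \<in> arrs C; src f = A\<rbrakk> \<Longrightarrow> f \<cdot> ident C A = f"
  using cmp_ident by (auto simp: homs_iff)

lemma ident_cmp_arr [simp]: "\<lbrakk>f \<in> arrs C; tgt f = A\<rbrakk> \<Longrightarrow> ident C A \<cdot> f = f"
  using ident_cmp by (auto simp: homs_iff)

lemma cmp_assoc_arr [simp]:
  "\<lbrakk>f \<in> arrs C; g \<in> arrs C; h \<in> arrs C; src g = tgt f; src h = tgt g\<rbrakk>
    \<Longrightarrow> (h \<cdot> g) \<cdot> f = h \<cdot> (g \<cdot> f)"
  using cmp_assoc[of f "src f" "tgt f" g "tgt g" h "tgt h"] by (simp add: homs_iff)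

text \<open>
  Composites are normalised to the right, so an equation between composites has to be available
  for the head of a longer composite as well.
\<close>

lemma cmp_prolong:
  assumes "g \<cdot> f = k" "f \<in> arrs C" "g \<in> arrs C" "src g = tgt f"
  shows "\<And>x. \<lbrakk>x \<in> arrs C; src f = tgt x\<rbrakk> \<Longrightarrow> g \<cdot> (f \<cdot> x) = k \<cdot> x"
  using assms cmp_assoc_arr[of _ f g] by auto

lemma cmp_prolong2:
  assumes "g \<cdot> f = g' \<cdot> f'" "f \<in> arrs C" "g \<in> arrs C" "src g = tgt f"
    "f' \<in> arrs C" "g' \<in> arrs C" "src g' = tgt f'"
  shows "\<And>x. \<lbrakk>x \<in> arrs C; src f = tgt x\<rbrakk> \<Longrightarrow> g \<cdot> (f \<cdot> x) = g' \<cdot> (f' \<cdot> x)"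
proof -
  fix x assume x: "x \<in> arrs C" "src f = tgt x"
  have t: "src f' = src f"
    using arg_cong[OF assms(1), of src] cmp_arr(2)[OF assms(2-4)] cmp_arr(2)[OF assms(5-7)] by simp
  have "g \<cdot> (f \<cdot> x) = (g \<cdot> f) \<cdot> x" using assms(2-) x by simp
  also have "\<dots> = g' \<cdot> (f' \<cdot> x)" unfolding assms(1) using assms(2-) x t by simp
  finally show "g \<cdot> (f \<cdot> x) = g' \<cdot> (f' \<cdot> x)" .
qed

lemma mono_cancel:
  "\<lbrakk>is_mono C f; f \<cdot> g = f \<cdot> h; g \<in> arrs C; h \<in> arrs C; tgt g = src f; tgt h = src f; src g = src h\<rbrakk>
    \<Longrightarrow> g = h"
  unfolding is_mono_def by (auto simp: homs_iff)

end

lemma is_biproductD: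
  fixes C :: "('o, 'f) precat" (structure)
  assumes "is_biproduct C A D B i j r p"
  shows "A \<in> objs C" "D \<in> objs C" "B \<in> objs C"
    "i \<in> arrs C" "src i = A" "tgt i = B"
    "j \<in> arrs C" "src j = D" "tgt j = B"
    "r \<in> arrs C" "src r = B" "tgt r = A"
    "p \<in> arrs C" "src p = B" "tgt p = D"
    "r \<cdot> i = ident C A" "p \<cdot> j = ident C D"
    "r \<cdot> j = zero_arr C D A" "p \<cdot> i = zero_arr C A D"
    "(i \<cdot> r) \<uplus> (j \<cdot> p) = ident C B"
  using assms by (simp_all add: is_biproduct_def homs_iff)

context additive_category
begin

abbreviation hom_grp where
  "hom_grp A B \<equiv> \<lparr>carrier = homs C A B, mult = plus_arr C, one = zero_arr C A B\<rparr>"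

lemma plus_arr [simp]:
  assumes "f \<in> arrs C" "g \<in> arrs C" "src g = src f" "tgt g = tgt f"
  shows "f \<uplus> g \<in> arrs C" "src (f \<uplus> g) = src f" "tgt (f \<uplus> g) = tgt f"
proof -
  interpret G: comm_group "hom_grp (src f) (tgt f)"
    using assms by (intro hom_group) simp_all
  show "f \<uplus> g \<in> arrs C" "src (f \<uplus> g) = src f" "tgt (f \<uplus> g) = tgt f"
    using G.m_closed[of f g] assms by (simp_all add: homs_iff)
qed

lemma zero_arr [simp]:
  assumes "A \<in> objs C" "B \<in> objs C"
  shows "zero_arr C A B \<in> arrs C" "src (zero_arr C A B) = A" "tgt (zero_arr C A B) = B"
proof -
  interpret G: comm_group "hom_grp A B"
    using assms by (rule hom_group)
  show "zero_arr C A B \<in> arrs C" "src (zero_arr C A B) = A" "tgt (zero_arr C A B) = B"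
    using G.one_closed by (simp_all add: homs_iff)
qed

lemma plus_assoc:
  assumes "f \<in> arrs C" "g \<in> arrs C" "h \<in> arrs C" "src g = src f" "tgt g = tgt f"
    "src h = src f" "tgt h = tgt f"
  shows "(f \<uplus> g) \<uplus> h = f \<uplus> (g \<uplus> h)"
proof -
  interpret G: comm_group "hom_grp (src f) (tgt f)"
    using assms by (intro hom_group) simp_all
  show ?thesis using G.m_assoc[of f g h] assms by (simp add: homs_iff)
qed

lemma plus_comm:
  assumes "f \<in> arrs C" "g \<in> arrs C" "src g = src f" "tgt g = tgt f"
  shows "f \<uplus> g = g \<uplus> f"
proof -
  interpret G: comm_group "hom_grp (src f) (tgt f)"
    using assms by (intro hom_group) simp_all
  show ?thesis using G.m_comm[of f g] assms by (simp add: homs_iff)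
qed

lemma plus_zero [simp]:
  assumes "f \<in> arrs C" "src f = A" "tgt f = B"
  shows "f \<uplus> zero_arr C A B = f" "zero_arr C A B \<uplus> f = f"
proof -
  interpret G: comm_group "hom_grp (src f) (tgt f)"
    using assms by (intro hom_group) auto
  show "f \<uplus> zero_arr C A B = f" "zero_arr C A B \<uplus> f = f"
    using G.r_one[of f] G.l_one[of f] assms by (simp_all add: homs_iff)
qed

lemma plus_cancel:
  assumes "f \<uplus> h = g \<uplus> h" "f \<in> arrs C" "g \<in> arrs C" "h \<in> arrs C" "src f = src h" "tgt f = tgt h"
    "src g = src h" "tgt g = tgt h"
  shows "f = g"
proof -
  interpret G: comm_group "hom_grp (src h) (tgt h)"
    using assms by (intro hom_group) simp_all
  show ?thesis using G.right_cancel[of h f g] assms by (simp add: homs_iff)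
qed

lemma neg_exists:
  assumes "f \<in> arrs C"
  obtains n where "n \<in> arrs C" "src n = src f" "tgt n = tgt f"
    "f \<uplus> n = zero_arr C (src f) (tgt f)"
proof -
  interpret G: comm_group "hom_grp (src f) (tgt f)"
    using assms by (intro hom_group) simp_all
  have "f \<in> homs C (src f) (tgt f)" using assms by (simp add: homs_iff)
  then have "\<exists>n \<in> homs C (src f) (tgt f). f \<uplus> n = zero_arr C (src f) (tgt f)"
    using G.r_inv_ex[of f] by simp
  then obtain n where n: "n \<in> homs C (src f) (tgt f)" "f \<uplus> n = zero_arr C (src f) (tgt f)"
    by (elim bexE)
  show ?thesis by (rule that[of n]) (use n in \<open>simp_all add: homs_iff\<close>)
qed

lemma cmp_plus_arr [simp]:
  "\<lbrakk>f \<in> arrs C; g \<in> arrs C; h \<in> arrs C; src g = tgt f; src h = tgt f; tgt h = tgt g\<rbrakk>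
    \<Longrightarrow> (g \<uplus> h) \<cdot> f = (g \<cdot> f) \<uplus> (h \<cdot> f)"
  using cmp_plus[of f "src f" "tgt f" g "tgt g" h] by (simp add: homs_iff)

lemma plus_cmp_arr [simp]:
  "\<lbrakk>f \<in> arrs C; g \<in> arrs C; h \<in> arrs C; src h = tgt f; src g = src f; tgt g = tgt f\<rbrakk>
    \<Longrightarrow> h \<cdot> (f \<uplus> g) = (h \<cdot> f) \<uplus> (h \<cdot> g)"
  using plus_cmp[of f "src f" "tgt f" g h "tgt h"] by (simp add: homs_iff)

lemma plus_idem_zero:
  assumes "f \<uplus> f = f" "f \<in> arrs C"
  shows "f = zero_arr C (src f) (tgt f)"
  by (rule plus_cancel[of _ f]) (use assms in simp_all)

lemma zero_cmp [simp]:
  assumes "f \<in> arrs C" "tgt f = A" "B \<in> objs C"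
  shows "zero_arr C A B \<cdot> f = zero_arr C (src f) B"
proof -
  have A: "A \<in> objs C" using assms by auto
  have "zero_arr C A B \<cdot> f \<uplus> zero_arr C A B \<cdot> f = (zero_arr C A B \<uplus> zero_arr C A B) \<cdot> f"
    using assms A by (simp del: plus_zero)
  also have "\<dots> = zero_arr C A B \<cdot> f" using assms A by simp
  finally show ?thesis using plus_idem_zero[of "zero_arr C A B \<cdot> f"] assms A by simp
qed

lemma cmp_zero [simp]:
  assumes "f \<in> arrs C" "src f = B" "A \<in> objs C"
  shows "f \<cdot> zero_arr C A B = zero_arr C A (tgt f)"
proof -
  have B: "B \<in> objs C" using assms by auto
  have "f \<cdot> zero_arr C A B \<uplus> f \<cdot> zero_arr C A B = f \<cdot> (zero_arr C A B \<uplus> zero_arr C A B)"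
    using assms B by (simp del: plus_zero)
  also have "\<dots> = f \<cdot> zero_arr C A B" using assms B by simp
  finally show ?thesis using plus_idem_zero[of "f \<cdot> zero_arr C A B"] assms B by simp
qed

lemma kernel_mono:
  assumes K: "is_kernel C k f"
  shows "is_mono C k"
  unfolding is_mono_def
proof (intro conjI allI ballI impI)
  show k: "k \<in> arrs C" using K by (simp add: is_kernel_def)
  fix T g h
  assume g: "g \<in> homs C T (src k)" and h: "h \<in> homs C T (src k)" and eq: "k \<cdot> g = k \<cdot> h"
  have f: "f \<in> arrs C" "src f = tgt k" and z: "f \<cdot> k = zero_arr C (src k) (tgt f)"
    using K by (simp_all add: is_kernel_def)
  have gh: "g \<in> arrs C" "src g = T" "tgt g = src k" "h \<in> arrs C" "src h = T" "tgt h = src k"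
    using g h by (simp_all add: homs_iff)
  have "f \<cdot> (k \<cdot> g) = zero_arr C T (tgt f)"
    using cmp_prolong[OF z, of g] f k gh by simp
  moreover have "k \<cdot> g \<in> homs C T (src f)" using f k gh by (simp add: homs_iff)
  ultimately have "\<exists>!h. h \<in> homs C T (src k) \<and> k \<cdot> h = k \<cdot> g"
    using K unfolding is_kernel_def by blast
  then have "\<And>x y. \<lbrakk>x \<in> homs C T (src k); k \<cdot> x = k \<cdot> g; y \<in> homs C T (src k); k \<cdot> y = k \<cdot> g\<rbrakk>
      \<Longrightarrow> x = y"
    by (metis (no_types))
  from this[OF g refl h eq[symmetric]] show "g = h" .
qed

text \<open>Subtracting two arrows with the same image reduces cancellation to the zero arrow.\<close>

lemma mono_if_zero_cancel:
  assumes f: "f \<in> arrs C"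
    and z: "\<And>g. \<lbrakk>g \<in> arrs C; tgt g = src f; f \<cdot> g = zero_arr C (src g) (tgt f)\<rbrakk>
      \<Longrightarrow> g = zero_arr C (src g) (src f)"
  shows "is_mono C f"
  unfolding is_mono_def
proof (intro conjI allI ballI impI f)
  fix T g h
  assume g: "g \<in> homs C T (src f)" and h: "h \<in> homs C T (src f)" and eq: "f \<cdot> g = f \<cdot> h"
  have gh: "g \<in> arrs C" "src g = T" "tgt g = src f" "h \<in> arrs C" "src h = T" "tgt h = src f"
    using g h by (simp_all add: homs_iff)
  obtain n where n: "n \<in> arrs C" "src n = T" "tgt n = src f" "h \<uplus> n = zero_arr C T (src f)"
    using gh by (auto intro: neg_exists[of h])
  have T: "T \<in> objs C" using gh(1,2) by auto
  have "f \<cdot> (g \<uplus> n) = f \<cdot> (h \<uplus> n)" using f gh n(1-3) eq by simp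
  also have "\<dots> = zero_arr C T (tgt f)" using n(4) f T by simp
  finally have "g \<uplus> n = zero_arr C T (src f)"
    using z[of "g \<uplus> n"] gh n f by simp
  then show "g = h" using plus_cancel[of g n h] gh n by simp
qed

lemma biproduct_swap:
  assumes b: "is_biproduct C A D B i j r p"
  shows "is_biproduct C D A B j i p r"
proof -
  note D = is_biproductD[OF b]
  have "j \<cdot> p \<uplus> i \<cdot> r = ident C B"
    by (subst plus_comm) (use D in simp_all)
  then show ?thesis using D by (simp add: is_biproduct_def homs_iff)
qed

lemma biproduct_expand:
  assumes b: "is_biproduct C A D B i j r p" and x: "x \<in> arrs C"
  shows "tgt x = B \<Longrightarrow> i \<cdot> (r \<cdot> x) \<uplus> j \<cdot> (p \<cdot> x) = x"
    and "src x = B \<Longrightarrow> (x \<cdot> i) \<cdot> r \<uplus> (x \<cdot> j) \<cdot> p = x"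
proof -
  note D = is_biproductD[OF b]
  show "tgt x = B \<Longrightarrow> i \<cdot> (r \<cdot> x) \<uplus> j \<cdot> (p \<cdot> x) = x"
  proof -
    assume t: "tgt x = B"
    have "x = (i \<cdot> r \<uplus> j \<cdot> p) \<cdot> x" using D(20) t x by simp
    also have "\<dots> = i \<cdot> (r \<cdot> x) \<uplus> j \<cdot> (p \<cdot> x)" using D(1-15) t x by simp
    finally show ?thesis by (rule sym)
  qed
  show "src x = B \<Longrightarrow> (x \<cdot> i) \<cdot> r \<uplus> (x \<cdot> j) \<cdot> p = x"
  proof -
    assume t: "src x = B"
    have "x = x \<cdot> (i \<cdot> r \<uplus> j \<cdot> p)" using D(20) t x by simp
    also have "\<dots> = (x \<cdot> i) \<cdot> r \<uplus> (x \<cdot> j) \<cdot> p" using D(1-15) t x by simp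
    finally show ?thesis by (rule sym)
  qed
qed

text \<open>
  An arrow \<open>g\<close> killed by \<open>p\<close> factors through \<open>i\<close> as \<open>r \<cdot> g\<close>, and an arrow \<open>g\<close> killing \<open>i\<close> factors
  through \<open>p\<close> as \<open>g \<cdot> j\<close>, both because \<open>i \<cdot> r \<uplus> j \<cdot> p = 1\<close>.
\<close>

lemma split_short_exact:
  assumes "split_exact C i p"
  shows "short_exact C i p"
proof -
  obtain j r where b: "is_biproduct C (src i) (tgt p) (tgt i) i j r p"
    using assms by (auto simp: split_exact_def)
  note D = is_biproductD[OF b]
  note D' = D(16-19)[THEN cmp_prolong]
  have "is_kernel C i p"
    unfolding is_kernel_def
  proof (intro conjI allI ballI impI)
    fix T g assume "g \<in> homs C T (src p)" and z: "p \<cdot> g = zero_arr C T (tgt p)"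
    then have g: "g \<in> arrs C" "src g = T" "tgt g = tgt i" using D by (simp_all add: homs_iff)
    have T: "T \<in> objs C" using g by auto
    have "i \<cdot> (r \<cdot> g) = g"
      using biproduct_expand(1)[OF b g(1,3)] D g z T by simp
    show "\<exists>!h. h \<in> homs C T (src i) \<and> i \<cdot> h = g"
    proof (rule ex1I[of _ "r \<cdot> g"])
      fix h assume "h \<in> homs C T (src i) \<and> i \<cdot> h = g"
      then have h: "h \<in> arrs C" "tgt h = src i" "i \<cdot> h = g" by (simp_all add: homs_iff)
      show "h = r \<cdot> g"
        unfolding h(3)[symmetric] using D'(1)[of h] h(1,2) D(4-15) by simp
    qed (use \<open>i \<cdot> (r \<cdot> g) = g\<close> g D in \<open>simp add: homs_iff\<close>)
  qed (use D in simp_all)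
  moreover have "is_cokernel C p i"
    unfolding is_cokernel_def
  proof (intro conjI allI ballI impI)
    fix T g assume "g \<in> homs C (tgt i) T" and z: "g \<cdot> i = zero_arr C (src i) T"
    then have g: "g \<in> arrs C" "src g = tgt i" "tgt g = T" using D by (simp_all add: homs_iff)
    have T: "T \<in> objs C" using g by auto
    have e: "(g \<cdot> j) \<cdot> p = g"
      using biproduct_expand(2)[OF b g(1,2)] D g z T by simp
    show "\<exists>!h. h \<in> homs C (tgt p) T \<and> h \<cdot> p = g"
    proof (rule ex1I[of _ "g \<cdot> j"])
      fix h assume "h \<in> homs C (tgt p) T \<and> h \<cdot> p = g"
      then have h: "h \<in> arrs C" "src h = tgt p" "h \<cdot> p = g" by (simp_all add: homs_iff)
      show "h = g \<cdot> j"
        unfolding h(3)[symmetric] using h(1,2) D(4-15,17) by simp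
    qed (use g D e in \<open>simp add: homs_iff\<close>)
  qed (use D in simp_all)
  ultimately show ?thesis by (simp add: short_exact_def)
qed

end


section \<open>Universal properties and split sequences\<close>

context
  fixes C :: "('o, 'f) precat" (structure)
begin

lemma is_cokernelD:
  assumes "is_cokernel C q f"
  shows "q \<in> arrs C" "f \<in> arrs C" "src q = tgt f" "q \<cdot> f = zero_arr C (src f) (tgt q)"
  using assms by (simp_all add: is_cokernel_def)

lemma is_kernelD:
  assumes "is_kernel C k f"
  shows "k \<in> arrs C" "f \<in> arrs C" "tgt k = src f" "f \<cdot> k = zero_arr C (src k) (tgt f)"
  using assms by (simp_all add: is_kernel_def)

lemma cokernel_factor:
  assumes "is_cokernel C q f" "g \<in> arrs C" "src g = tgt f" "g \<cdot> f = zero_arr C (src f) (tgt g)"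
  obtains h where "h \<in> arrs C" "src h = tgt q" "tgt h = tgt g" "h \<cdot> q = g"
proof -
  have "g \<in> homs C (tgt f) (tgt g)" using assms(2,3) by (simp add: homs_iff)
  then have "\<exists>!h. h \<in> homs C (tgt q) (tgt g) \<and> h \<cdot> q = g"
    using assms(1,4) unfolding is_cokernel_def by blast
  then obtain h where "h \<in> homs C (tgt q) (tgt g)" "h \<cdot> q = g" by (elim ex1E conjE)
  then show ?thesis by (intro that[of h]) (simp_all add: homs_iff)
qed

lemma kernel_factor:
  assumes "is_kernel C k f" "g \<in> arrs C" "tgt g = src f" "f \<cdot> g = zero_arr C (src g) (tgt f)"
  obtains h where "h \<in> arrs C" "src h = src g" "tgt h = src k" "k \<cdot> h = g"
proof -
  have "g \<in> homs C (src g) (src f)" using assms(2,3) by (simp add: homs_iff)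
  then have "\<exists>!h. h \<in> homs C (src g) (src k) \<and> k \<cdot> h = g"
    using assms(1,4) unfolding is_kernel_def by blast
  then obtain h where "h \<in> homs C (src g) (src k)" "k \<cdot> h = g" by (elim ex1E conjE)
  then show ?thesis by (intro that[of h]) (simp_all add: homs_iff)
qed

lemma is_kernelI:
  assumes "k \<in> arrs C" "f \<in> arrs C" "tgt k = src f" "f \<cdot> k = zero_arr C (src k) (tgt f)"
    and ex: "\<And>g. \<lbrakk>g \<in> arrs C; tgt g = src f; f \<cdot> g = zero_arr C (src g) (tgt f)\<rbrakk>
      \<Longrightarrow> \<exists>h. h \<in> arrs C \<and> src h = src g \<and> tgt h = src k \<and> k \<cdot> h = g"
    and mono: "\<And>g h. \<lbrakk>g \<in> arrs C; h \<in> arrs C; tgt g = src k; tgt h = src k; src g = src h;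
        k \<cdot> g = k \<cdot> h\<rbrakk> \<Longrightarrow> g = h"
  shows "is_kernel C k f"
  unfolding is_kernel_def
proof (intro conjI allI ballI impI assms(1-4))
  fix T g assume "g \<in> homs C T (src f)" "f \<cdot> g = zero_arr C T (tgt f)"
  then have g: "g \<in> arrs C" "src g = T" "tgt g = src f" "f \<cdot> g = zero_arr C (src g) (tgt f)"
    by (auto simp: homs_iff)
  obtain h where h: "h \<in> arrs C" "src h = T" "tgt h = src k" "k \<cdot> h = g"
    using ex[OF g(1,3,4)] g(2) by (elim exE conjE) simp
  show "\<exists>!h. h \<in> homs C T (src k) \<and> k \<cdot> h = g"
  proof (rule ex1I[of _ h])
    fix x assume "x \<in> homs C T (src k) \<and> k \<cdot> x = g"
    then have x: "x \<in> arrs C" "src x = T" "tgt x = src k" "k \<cdot> x = g"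
      by (simp_all add: homs_iff)
    show "x = h" by (rule mono) (use x h in simp_all)
  qed (use h in \<open>simp add: homs_iff\<close>)
qed

lemma is_cokernelI:
  assumes "q \<in> arrs C" "f \<in> arrs C" "src q = tgt f" "q \<cdot> f = zero_arr C (src f) (tgt q)"
    and ex: "\<And>g. \<lbrakk>g \<in> arrs C; src g = tgt f; g \<cdot> f = zero_arr C (src f) (tgt g)\<rbrakk>
      \<Longrightarrow> \<exists>h. h \<in> arrs C \<and> src h = tgt q \<and> tgt h = tgt g \<and> h \<cdot> q = g"
    and epi: "\<And>g h. \<lbrakk>g \<in> arrs C; h \<in> arrs C; src g = tgt q; src h = tgt q; tgt g = tgt h;
        g \<cdot> q = h \<cdot> q\<rbrakk> \<Longrightarrow> g = h"
  shows "is_cokernel C q f"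
  unfolding is_cokernel_def
proof (intro conjI allI ballI impI assms(1-4))
  fix T g assume "g \<in> homs C (tgt f) T" "g \<cdot> f = zero_arr C (src f) T"
  then have g: "g \<in> arrs C" "tgt g = T" "src g = tgt f" "g \<cdot> f = zero_arr C (src f) (tgt g)"
    by (auto simp: homs_iff)
  obtain h where h: "h \<in> arrs C" "tgt h = T" "src h = tgt q" "h \<cdot> q = g"
    using ex[OF g(1,3,4)] g(2) by (elim exE conjE) simp
  show "\<exists>!h. h \<in> homs C (tgt q) T \<and> h \<cdot> q = g"
  proof (rule ex1I[of _ h])
    fix x assume "x \<in> homs C (tgt q) T \<and> x \<cdot> q = g"
    then have x: "x \<in> arrs C" "tgt x = T" "src x = tgt q" "x \<cdot> q = g"
      by (simp_all add: homs_iff)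
    show "x = h" by (rule epi) (use x h in simp_all)
  qed (use h in \<open>simp add: homs_iff\<close>)
qed

lemma is_pullbackI:
  assumes "p \<in> arrs C" "g \<in> arrs C" "tgt p = tgt g"
    and "p' \<in> arrs C" "g' \<in> arrs C" "src g' = src p'" "tgt g' = src p" "tgt p' = src g"
    and "p \<cdot> g' = g \<cdot> p'"
    and ex: "\<And>u v. \<lbrakk>u \<in> arrs C; v \<in> arrs C; tgt u = src p; tgt v = src g; src v = src u;
        p \<cdot> u = g \<cdot> v\<rbrakk>
      \<Longrightarrow> \<exists>w. w \<in> arrs C \<and> src w = src u \<and> tgt w = src p' \<and> g' \<cdot> w = u \<and> p' \<cdot> w = v"
    and ext: "\<And>x y. \<lbrakk>x \<in> arrs C; y \<in> arrs C; tgt x = src p'; tgt y = src p'; src x = src y;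
        g' \<cdot> x = g' \<cdot> y; p' \<cdot> x = p' \<cdot> y\<rbrakk> \<Longrightarrow> x = y"
  shows "is_pullback C p g p' g'"
  unfolding is_pullback_def
proof (intro conjI allI ballI impI)
  fix T u v assume "u \<in> homs C T (src p)" "v \<in> homs C T (src g)" and eq: "p \<cdot> u = g \<cdot> v"
  then have uv: "u \<in> arrs C" "src u = T" "tgt u = src p" "v \<in> arrs C" "src v = T" "tgt v = src g"
    by (simp_all add: homs_iff)
  obtain w where w: "w \<in> arrs C" "src w = T" "tgt w = src p'" "g' \<cdot> w = u" "p' \<cdot> w = v"
    using ex[OF uv(1,4,3,6) trans[OF uv(5) sym[OF uv(2)]] eq] uv(2) by (elim exE conjE) simp
  show "\<exists>!w. w \<in> homs C T (src p') \<and> g' \<cdot> w = u \<and> p' \<cdot> w = v"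
  proof (rule ex1I[of _ w])
    fix x assume "x \<in> homs C T (src p') \<and> g' \<cdot> x = u \<and> p' \<cdot> x = v"
    then have x: "x \<in> arrs C" "src x = T" "tgt x = src p'" "g' \<cdot> x = u" "p' \<cdot> x = v"
      by (simp_all add: homs_iff)
    show "x = w" by (rule ext) (use x w in simp_all)
  qed (use w in \<open>simp add: homs_iff\<close>)
qed (use assms(1-9) in \<open>simp_all add: homs_iff\<close>)

lemma is_pullbackD:
  assumes "is_pullback C p g p' g'"
  shows "p \<in> arrs C" "g \<in> arrs C" "tgt p = tgt g"
    "p' \<in> arrs C" "g' \<in> arrs C" "src g' = src p'" "tgt g' = src p" "tgt p' = src g"
    "p \<cdot> g' = g \<cdot> p'"
  using assms by (simp_all add: is_pullback_def homs_iff)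

lemma pullback_factor:
  assumes P: "is_pullback C p g p' g'"
    and u: "u \<in> arrs C" "v \<in> arrs C" "tgt u = src p" "tgt v = src g" "src v = src u"
    and eq: "p \<cdot> u = g \<cdot> v"
  obtains w where "w \<in> arrs C" "src w = src u" "tgt w = src p'" "g' \<cdot> w = u" "p' \<cdot> w = v"
proof -
  have "u \<in> homs C (src u) (src p)" "v \<in> homs C (src u) (src g)"
    using u by (simp_all add: homs_iff)
  then have "\<exists>!w. w \<in> homs C (src u) (src p') \<and> g' \<cdot> w = u \<and> p' \<cdot> w = v"
    using P eq unfolding is_pullback_def by blast
  then obtain w where "w \<in> homs C (src u) (src p')" "g' \<cdot> w = u" "p' \<cdot> w = v"
    by (elim ex1E conjE)
  then show ?thesis by (intro that[of w]) (simp_all add: homs_iff)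
qed

lemma is_pushoutI:
  assumes "i \<in> arrs C" "g \<in> arrs C" "src i = src g"
    and "i' \<in> arrs C" "g' \<in> arrs C" "src g' = tgt i" "tgt g' = tgt i'" "src i' = tgt g"
    and "g' \<cdot> i = i' \<cdot> g"
    and ex: "\<And>u v. \<lbrakk>u \<in> arrs C; v \<in> arrs C; src u = tgt i; src v = tgt g; tgt v = tgt u;
        u \<cdot> i = v \<cdot> g\<rbrakk>
      \<Longrightarrow> \<exists>w. w \<in> arrs C \<and> tgt w = tgt u \<and> src w = tgt i' \<and> w \<cdot> g' = u \<and> w \<cdot> i' = v"
    and ext: "\<And>x y. \<lbrakk>x \<in> arrs C; y \<in> arrs C; src x = tgt i'; src y = tgt i'; tgt x = tgt y;
        x \<cdot> g' = y \<cdot> g'; x \<cdot> i' = y \<cdot> i'\<rbrakk> \<Longrightarrow> x = y"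
  shows "is_pushout C i g i' g'"
  unfolding is_pushout_def
proof (intro conjI allI ballI impI)
  fix T u v assume "u \<in> homs C (tgt i) T" "v \<in> homs C (tgt g) T" and eq: "u \<cdot> i = v \<cdot> g"
  then have uv: "u \<in> arrs C" "tgt u = T" "src u = tgt i" "v \<in> arrs C" "tgt v = T" "src v = tgt g"
    by (simp_all add: homs_iff)
  obtain w where w: "w \<in> arrs C" "tgt w = T" "src w = tgt i'" "w \<cdot> g' = u" "w \<cdot> i' = v"
    using ex[OF uv(1,4,3,6) trans[OF uv(5) sym[OF uv(2)]] eq] uv(2) by (elim exE conjE) simp
  show "\<exists>!w. w \<in> homs C (tgt i') T \<and> w \<cdot> g' = u \<and> w \<cdot> i' = v"
  proof (rule ex1I[of _ w])
    fix x assume "x \<in> homs C (tgt i') T \<and> x \<cdot> g' = u \<and> x \<cdot> i' = v"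
    then have x: "x \<in> arrs C" "tgt x = T" "src x = tgt i'" "x \<cdot> g' = u" "x \<cdot> i' = v"
      by (simp_all add: homs_iff)
    show "x = w" by (rule ext) (use x w in simp_all)
  qed (use w in \<open>simp add: homs_iff\<close>)
qed (use assms(1-9) in \<open>simp_all add: homs_iff\<close>)

lemma is_pushoutD:
  assumes "is_pushout C i g i' g'"
  shows "i \<in> arrs C" "g \<in> arrs C" "src i = src g"
    "i' \<in> arrs C" "g' \<in> arrs C" "src g' = tgt i" "tgt g' = tgt i'" "src i' = tgt g"
    "g' \<cdot> i = i' \<cdot> g"
  using assms by (simp_all add: is_pushout_def homs_iff)

lemma pushout_factor:
  assumes P: "is_pushout C i g i' g'"
    and u: "u \<in> arrs C" "v \<in> arrs C" "src u = tgt i" "src v = tgt g" "tgt v = tgt u"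
    and eq: "u \<cdot> i = v \<cdot> g"
  obtains w where "w \<in> arrs C" "tgt w = tgt u" "src w = tgt i'" "w \<cdot> g' = u" "w \<cdot> i' = v"
proof -
  have "u \<in> homs C (tgt i) (tgt u)" "v \<in> homs C (tgt g) (tgt u)"
    using u by (simp_all add: homs_iff)
  then have "\<exists>!w. w \<in> homs C (tgt i') (tgt u) \<and> w \<cdot> g' = u \<and> w \<cdot> i' = v"
    using P eq unfolding is_pushout_def by blast
  then obtain w where "w \<in> homs C (tgt i') (tgt u)" "w \<cdot> g' = u" "w \<cdot> i' = v"
    by (elim ex1E conjE)
  then show ?thesis by (intro that[of w]) (simp_all add: homs_iff)
qed

end

context category
begin

lemma pullback_ext:
  assumes P: "is_pullback C p g p' g'"
    and x: "x \<in> arrs C" "y \<in> arrs C" "tgt x = src p'" "tgt y = src p'" "src x = src y"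
    and eq: "g' \<cdot> x = g' \<cdot> y" "p' \<cdot> x = p' \<cdot> y"
  shows "x = y"
proof -
  note D = is_pullbackD[OF P]
  have "g' \<cdot> y \<in> homs C (src y) (src p)" "p' \<cdot> y \<in> homs C (src y) (src g)"
    using D x by (simp_all add: homs_iff)
  moreover have "p \<cdot> (g' \<cdot> y) = g \<cdot> (p' \<cdot> y)"
    by (rule cmp_prolong2[OF D(9)]) (use D x in simp_all)
  ultimately have "\<exists>!w. w \<in> homs C (src y) (src p') \<and> g' \<cdot> w = g' \<cdot> y \<and> p' \<cdot> w = p' \<cdot> y"
    using P unfolding is_pullback_def by blast
  moreover have "x \<in> homs C (src y) (src p')" "y \<in> homs C (src y) (src p')"
    using x by (simp_all add: homs_iff)
  ultimately show ?thesis using eq by (elim ex1E) (metis (no_types))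
qed

lemma pushout_ext:
  assumes P: "is_pushout C i g i' g'"
    and x: "x \<in> arrs C" "y \<in> arrs C" "src x = tgt i'" "src y = tgt i'" "tgt x = tgt y"
    and eq: "x \<cdot> g' = y \<cdot> g'" "x \<cdot> i' = y \<cdot> i'"
  shows "x = y"
proof -
  note D = is_pushoutD[OF P]
  have "y \<cdot> g' \<in> homs C (tgt i) (tgt y)" "y \<cdot> i' \<in> homs C (tgt g) (tgt y)"
    using D x by (simp_all add: homs_iff)
  moreover have "(y \<cdot> g') \<cdot> i = (y \<cdot> i') \<cdot> g"
    using D x by simp
  ultimately have "\<exists>!w. w \<in> homs C (tgt i') (tgt y) \<and> w \<cdot> g' = y \<cdot> g' \<and> w \<cdot> i' = y \<cdot> i'"
    using P unfolding is_pushout_def by blast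
  moreover have "x \<in> homs C (tgt i') (tgt y)" "y \<in> homs C (tgt i') (tgt y)"
    using x by (simp_all add: homs_iff)
  ultimately show ?thesis using eq by (elim ex1E) (metis (no_types))
qed

lemma epi_cancel:
  "\<lbrakk>is_epi C f; g \<cdot> f = h \<cdot> f; g \<in> arrs C; h \<in> arrs C; src g = tgt f; src h = tgt f; tgt g = tgt h\<rbrakk>
    \<Longrightarrow> g = h"
  unfolding is_epi_def by (auto simp: homs_iff)

end

context additive_category
begin

lemma cokernel_epi:
  assumes K: "is_cokernel C q f"
  shows "is_epi C q"
  unfolding is_epi_def
proof (intro conjI allI ballI impI)
  show q: "q \<in> arrs C" using K by (simp add: is_cokernel_def)
  fix T g h
  assume g: "g \<in> homs C (tgt q) T" and h: "h \<in> homs C (tgt q) T" and eq: "g \<cdot> q = h \<cdot> q"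
  note D = is_cokernelD[OF K]
  have gh: "g \<in> arrs C" "tgt g = T" "src g = tgt q" "h \<in> arrs C" "tgt h = T" "src h = tgt q"
    using g h by (simp_all add: homs_iff)
  have "(g \<cdot> q) \<cdot> f = zero_arr C (src f) T" using D gh by simp
  moreover have "g \<cdot> q \<in> homs C (tgt f) T" using D gh by (simp add: homs_iff)
  ultimately have "\<exists>!h. h \<in> homs C (tgt q) T \<and> h \<cdot> q = g \<cdot> q"
    using K unfolding is_cokernel_def by blast
  then have "\<And>x y. \<lbrakk>x \<in> homs C (tgt q) T; x \<cdot> q = g \<cdot> q; y \<in> homs C (tgt q) T; y \<cdot> q = g \<cdot> q\<rbrakk>
      \<Longrightarrow> x = y"
    by (metis (no_types))
  from this[OF g refl h eq[symmetric]] show "g = h" .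
qed

lemma biproduct_ext_into:
  assumes b: "is_biproduct C A D B i j r p" and x: "x \<in> arrs C" "tgt x = B"
    and y: "y \<in> arrs C" "tgt y = B" and eq: "r \<cdot> x = r \<cdot> y" "p \<cdot> x = p \<cdot> y"
  shows "x = y"
  using biproduct_expand(1)[OF b x] biproduct_expand(1)[OF b y] unfolding eq by (rule trans[OF sym])

lemma biproduct_ext_from:
  assumes b: "is_biproduct C A D B i j r p" and x: "x \<in> arrs C" "src x = B"
    and y: "y \<in> arrs C" "src y = B" and eq: "x \<cdot> i = y \<cdot> i" "x \<cdot> j = y \<cdot> j"
  shows "x = y"
  using biproduct_expand(2)[OF b x] biproduct_expand(2)[OF b y] unfolding eq by (rule trans[OF sym])

lemma biproduct_pair:
  assumes b: "is_biproduct C A D B i j r p"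
    and uv: "u \<in> arrs C" "tgt u = A" "v \<in> arrs C" "tgt v = D" "src v = src u"
  obtains w where "w \<in> arrs C" "src w = src u" "tgt w = B" "r \<cdot> w = u" "p \<cdot> w = v"
proof -
  note D = is_biproductD[OF b]
  note D' = D(16-19)[THEN cmp_prolong]
  show ?thesis
    by (rule that[of "i \<cdot> u \<uplus> j \<cdot> v"]) (use D(1-15) uv in \<open>simp_all add: D'\<close>)
qed

lemma biproduct_copair:
  assumes b: "is_biproduct C A D B i j r p"
    and uv: "u \<in> arrs C" "src u = A" "v \<in> arrs C" "src v = D" "tgt v = tgt u"
  obtains w where "w \<in> arrs C" "tgt w = tgt u" "src w = B" "w \<cdot> i = u" "w \<cdot> j = v"
proof -
  note D = is_biproductD[OF b]
  show ?thesis
    by (rule that[of "u \<cdot> r \<uplus> v \<cdot> p"]) (use D(1-19) uv in simp_all)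
qed

text \<open>
  The pullback of \<open>p: X \<oplus> Y \<rightarrow> Y\<close> along \<open>g: V \<rightarrow> Y\<close> is \<open>X \<oplus> V\<close>, with \<open>g'\<close> the matrix \<open>diag(1, g)\<close>.
  It therefore exists in every additive category and is again split with the same kernel.
\<close>

lemma split_pullback:
  assumes s: "split_exact C i p" and g: "g \<in> arrs C" "tgt g = tgt p"
  obtains p' g' k where "is_pullback C p g p' g'" "split_exact C k p'" "src k = src i" "g' \<cdot> k = i"
proof -
  obtain j r where b: "is_biproduct C (src i) (tgt p) (tgt i) i j r p"
    using s by (auto simp: split_exact_def)
  note D = is_biproductD[OF b]
  obtain P k l s p' where b': "is_biproduct C (src i) (src g) P k l s p'"
    using biproduct[of "src i" "src g"] D(1) g by auto
  note D' = is_biproductD[OF b']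
  obtain g' where g': "g' \<in> arrs C" "src g' = P" "tgt g' = tgt i" "r \<cdot> g' = s" "p \<cdot> g' = g \<cdot> p'"
    by (rule biproduct_pair[OF b, of s "g \<cdot> p'"]) (use D' g in simp_all)
  note rg = cmp_prolong[OF g'(4)] and pg = cmp_prolong2[OF g'(5)]
  have P: "is_pullback C p g p' g'"
  proof (rule is_pullbackI)
    fix u v
    assume uv: "u \<in> arrs C" "v \<in> arrs C" "tgt u = src p" "tgt v = src g" "src v = src u"
      and eq: "p \<cdot> u = g \<cdot> v"
    obtain w where w: "w \<in> arrs C" "src w = src u" "tgt w = P" "s \<cdot> w = r \<cdot> u" "p' \<cdot> w = v"
      by (rule biproduct_pair[OF b', of "r \<cdot> u" v]) (use D(1-15) uv in simp_all)
    have "g' \<cdot> w = u"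
      by (rule biproduct_ext_into[OF b])
        (use D(1-15) D'(1-15) g' g w uv eq in \<open>simp_all add: rg pg\<close>)
    then show "\<exists>w. w \<in> arrs C \<and> src w = src u \<and> tgt w = src p' \<and> g' \<cdot> w = u \<and> p' \<cdot> w = v"
      using w D'(14) by auto
  next
    fix x y
    assume xy: "x \<in> arrs C" "y \<in> arrs C" "tgt x = src p'" "tgt y = src p'" "src x = src y"
      and eq: "g' \<cdot> x = g' \<cdot> y" "p' \<cdot> x = p' \<cdot> y"
    have "s \<cdot> x = s \<cdot> y"
      using rg[of x] rg[of y] eq(1) D(1-15) D'(1-15) g' xy by simp
    then show "x = y"
      by (rule biproduct_ext_into[OF b', rotated 4]) (use xy eq D'(14) in simp_all)
  qed (use D(1-15) D'(1-15) g' g in simp_all)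
  have "g' \<cdot> k = i"
    by (rule biproduct_ext_into[OF b])
      (use D D' g' g rg[of k] pg[of k] in simp_all)
  moreover have "split_exact C k p'"
    unfolding split_exact_def using b' D'(5,6,15) by auto
  ultimately show ?thesis using that P D'(5) by blast
qed

text \<open>
  Dually, the pushout of \<open>i: X \<rightarrow> X \<oplus> Y\<close> along \<open>g: X \<rightarrow> V\<close> is \<open>V \<oplus> Y\<close>.
\<close>

lemma split_pushout:
  assumes s: "split_exact C i p" and g: "g \<in> arrs C" "src g = src i"
  obtains i' g' c where "is_pushout C i g i' g'" "split_exact C i' c" "tgt c = tgt p" "c \<cdot> g' = p"
proof -
  obtain j r where b: "is_biproduct C (src i) (tgt p) (tgt i) i j r p"
    using s by (auto simp: split_exact_def)
  note D = is_biproductD[OF b]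
  obtain P i' l s c where b': "is_biproduct C (tgt g) (tgt p) P i' l s c"
    using biproduct[of "tgt g" "tgt p"] D(2) g by auto
  note D' = is_biproductD[OF b']
  obtain g' where g': "g' \<in> arrs C" "tgt g' = P" "src g' = tgt i" "g' \<cdot> i = i' \<cdot> g" "g' \<cdot> j = l"
    by (rule biproduct_copair[OF b, of "i' \<cdot> g" l]) (use D' g in simp_all)
  have P: "is_pushout C i g i' g'"
  proof (rule is_pushoutI)
    fix u v
    assume uv: "u \<in> arrs C" "v \<in> arrs C" "src u = tgt i" "src v = tgt g" "tgt v = tgt u"
      and eq: "u \<cdot> i = v \<cdot> g"
    obtain w where w: "w \<in> arrs C" "tgt w = tgt u" "src w = P" "w \<cdot> i' = v" "w \<cdot> l = u \<cdot> j"
      by (rule biproduct_copair[OF b', of v "u \<cdot> j"]) (use D(1-15) uv in simp_all)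
    have wg: "w \<cdot> (i' \<cdot> g) = v \<cdot> g"
      using cmp_prolong[OF w(4), of g] w(1-3) D'(1-15) g by simp
    have "w \<cdot> g' = u"
      by (rule biproduct_ext_from[OF b])
        (use D(1-15) D'(1-15) g' g w uv eq wg in simp_all)
    then show "\<exists>w. w \<in> arrs C \<and> tgt w = tgt u \<and> src w = tgt i' \<and> w \<cdot> g' = u \<and> w \<cdot> i' = v"
      using w D'(6) by auto
  next
    fix x y
    assume xy: "x \<in> arrs C" "y \<in> arrs C" "src x = tgt i'" "src y = tgt i'" "tgt x = tgt y"
      and eq: "x \<cdot> g' = y \<cdot> g'" "x \<cdot> i' = y \<cdot> i'"
    have "x \<cdot> l = (x \<cdot> g') \<cdot> j" "y \<cdot> l = (y \<cdot> g') \<cdot> j"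
      using D(1-15) D'(1-15) g' xy by simp_all
    then have "x \<cdot> l = y \<cdot> l" by (simp only: eq)
    then show "x = y"
      by (rule biproduct_ext_from[OF b', rotated 5]) (use xy eq D'(6) in simp_all)
  qed (use D(1-15) D'(1-15) g' g in simp_all)
  have "c \<cdot> g' = p"
    by (rule biproduct_ext_from[OF b])
      (use D D' g' g cmp_prolong[OF D'(19), of g] in simp_all)
  moreover have "split_exact C i' c"
    unfolding split_exact_def using b' D'(5,6,15) by auto
  ultimately show ?thesis using that P D'(15) by blast
qed

text \<open>
  The complement of a retract is the cokernel of its inclusion, so retracts split off as direct
  summands wherever cokernels exist.
\<close>

lemma retract_biproduct:
  assumes s: "s \<in> arrs C" "p \<in> arrs C" "src p = tgt s" "tgt p = src s"
    and ps: "p \<cdot> s = ident C (src s)" and q: "is_cokernel C q s"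
  obtains i where "is_biproduct C (tgt q) (src s) (tgt s) i s q p"
proof -
  note Q = is_cokernelD[OF q]
  let ?Z = "tgt s"
  obtain n where n: "n \<in> arrs C" "src n = ?Z" "tgt n = ?Z" "s \<cdot> p \<uplus> n = zero_arr C ?Z ?Z"
    by (rule neg_exists[of "s \<cdot> p"]) (use s in simp_all)
  \<comment> \<open>The idempotent \<open>e = 1 - s p\<close> vanishes on \<open>s\<close>, so it factors through \<open>q\<close>.\<close>
  define e where "e = ident C ?Z \<uplus> n"
  have e: "e \<in> arrs C" "src e = ?Z" "tgt e = ?Z" using n s by (simp_all add: e_def)
  have ns: "s \<uplus> n \<cdot> s = zero_arr C (src s) ?Z"
    using arg_cong[OF n(4), of "\<lambda>x. x \<cdot> s"] n(1-3) s ps by simp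
  have pn: "p \<uplus> p \<cdot> n = zero_arr C ?Z (src s)"
    using arg_cong[OF n(4), of "\<lambda>x. p \<cdot> x"] n(1-3) s cmp_prolong[OF ps, of p] by simp
  have qn: "q \<cdot> n = zero_arr C ?Z (tgt q)"
    using arg_cong[OF n(4), of "\<lambda>x. q \<cdot> x"] n(1-3) s Q cmp_prolong[OF Q(4), of p] by simp
  have "e \<cdot> s = zero_arr C (src s) (tgt e)" using ns n(1-3) s e by (simp add: e_def)
  then obtain i where i: "i \<in> arrs C" "src i = tgt q" "tgt i = ?Z" "i \<cdot> q = e"
    using cokernel_factor[OF q e(1,2)] e(3) by metis
  have pe: "p \<cdot> e = zero_arr C ?Z (src s)" using pn n(1-3) s by (simp add: e_def)
  have qe: "q \<cdot> e = q" using qn n(1-3) s Q by (simp add: e_def)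
  have pi: "p \<cdot> i = zero_arr C (tgt q) (src s)"
    by (rule epi_cancel[OF cokernel_epi[OF q]]) (use i s Q pe in simp_all)
  have qi: "q \<cdot> i = ident C (tgt q)"
    by (rule epi_cancel[OF cokernel_epi[OF q]]) (use i s Q qe in simp_all)
  have "n \<uplus> s \<cdot> p = s \<cdot> p \<uplus> n" by (rule plus_comm) (use n s in simp_all)
  then have "e \<uplus> s \<cdot> p = ident C ?Z"
    unfolding e_def using n s by (subst plus_assoc) simp_all
  then have "is_biproduct C (tgt q) (src s) ?Z i s q p"
    using i s Q ps pi qi by (simp add: is_biproduct_def homs_iff)
  then show ?thesis by (rule that)
qed

lemma isomE:
  assumes "is_isom C a"
  obtains a' where "a \<in> arrs C" "a' \<in> arrs C" "src a' = tgt a" "tgt a' = src a"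
    "a' \<cdot> a = ident C (src a)" "a \<cdot> a' = ident C (tgt a)"
  using assms unfolding is_isom_def by (auto simp: homs_iff)

text \<open>
  Inclusions and projections are transported by conjugation with \<open>a\<close>, \<open>b\<close> and \<open>c\<close>.
\<close>

lemma split_exact_iso:
  assumes s: "split_exact C i p" and iso: "is_isom C a" "is_isom C b" "is_isom C c"
    and ip: "i' \<in> arrs C" "p' \<in> arrs C" "src p' = tgt i'"
    and a: "src a = src i" "tgt a = src i'" and b: "src b = tgt i" "tgt b = tgt i'"
    and c: "src c = tgt p" "tgt c = tgt p'"
    and eq: "b \<cdot> i = i' \<cdot> a" "c \<cdot> p = p' \<cdot> b"
  shows "split_exact C i' p'"
proof -
  obtain j r where bp: "is_biproduct C (src i) (tgt p) (tgt i) i j r p"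
    using s by (auto simp: split_exact_def)
  note D = is_biproductD[OF bp]
  note D' = D(16-19)[THEN cmp_prolong]
  obtain a' where a': "a \<in> arrs C" "a' \<in> arrs C" "src a' = tgt a" "tgt a' = src a"
    "a' \<cdot> a = ident C (src a)" "a \<cdot> a' = ident C (tgt a)" using isomE[OF iso(1)] .
  obtain b' where b': "b \<in> arrs C" "b' \<in> arrs C" "src b' = tgt b" "tgt b' = src b"
    "b' \<cdot> b = ident C (src b)" "b \<cdot> b' = ident C (tgt b)" using isomE[OF iso(2)] .
  obtain c' where c': "c \<in> arrs C" "c' \<in> arrs C" "src c' = tgt c" "tgt c' = src c"
    "c' \<cdot> c = ident C (src c)" "c \<cdot> c' = ident C (tgt c)" using isomE[OF iso(3)] .
  have i': "i' = b \<cdot> (i \<cdot> a')"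
  proof -
    have "b \<cdot> (i \<cdot> a') = i' \<cdot> (a \<cdot> a')"
      by (rule cmp_prolong2[OF eq(1)]) (use D a' b' ip a b in simp_all)
    then show ?thesis using a' a ip by simp
  qed
  have p': "p' = c \<cdot> (p \<cdot> b')"
  proof -
    have "c \<cdot> (p \<cdot> b') = p' \<cdot> (b \<cdot> b')"
      by (rule cmp_prolong2[OF eq(2)]) (use D c' b' ip c b in simp_all)
    then show ?thesis using b' b ip by simp
  qed
  note E = D(1-15) a(1) a'(1-4) b(1) b'(1-4) c(1) c'(1-4)
  note K = cmp_prolong[OF a'(5)] cmp_prolong[OF b'(5)] cmp_prolong[OF c'(5)] D' D(16-19)
    a'(6) b'(6) c'(6)
  have "b \<cdot> (i \<cdot> (r \<cdot> b') \<uplus> j \<cdot> (p \<cdot> b')) = ident C (tgt b)"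
    using biproduct_expand(1)[OF bp b'(2)] b' b by simp
  then have sum: "b \<cdot> (i \<cdot> (r \<cdot> b')) \<uplus> b \<cdot> (j \<cdot> (p \<cdot> b')) = ident C (tgt b)"
    using E by simp
  have F: "is_biproduct C (tgt a) (tgt c) (tgt b) (b \<cdot> (i \<cdot> a')) (b \<cdot> (j \<cdot> c'))
      (a \<cdot> (r \<cdot> b')) (c \<cdot> (p \<cdot> b'))"
    unfolding is_biproduct_def homs_iff
    by (intro conjI) (use sum E in \<open>simp_all add: K\<close>)
  have "is_biproduct C (src i') (tgt p') (tgt i') i' (b \<cdot> (j \<cdot> c')) (a \<cdot> (r \<cdot> b')) p'"
    using F unfolding i'[symmetric] p'[symmetric] a(2) b(2) c(2) .
  then show ?thesis unfolding split_exact_def by (intro exI)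
qed

end


section \<open>The morphism category is additive\<close>

lemma mor_cat_simps [simp]:
  "objs (mor_cat C) = arrs C"
  "ident (mor_cat C) f = Arrow f f (ident C (src f), ident C (tgt f))"
  "v \<cdot>\<^bsub>mor_cat C\<^esub> u = Arrow (src u) (tgt v) (comp1 v \<cdot>\<^bsub>C\<^esub> comp1 u, comp2 v \<cdot>\<^bsub>C\<^esub> comp2 u)"
  "u \<uplus>\<^bsub>mor_cat C\<^esub> v = Arrow (src u) (tgt u) (comp1 u \<uplus>\<^bsub>C\<^esub> comp1 v, comp2 u \<uplus>\<^bsub>C\<^esub> comp2 v)"
  "zero_arr (mor_cat C) f g = Arrow f g (zero_arr C (src f) (src g), zero_arr C (tgt f) (tgt g))"
  by (simp_all add: mor_cat_def)

lemma mor_arr_iff: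
  "u \<in> arrs (mor_cat C) \<longleftrightarrow> src u \<in> arrs C \<and> tgt u \<in> arrs C \<and>
    comp1 u \<in> arrs C \<and> src (comp1 u) = src (src u) \<and> tgt (comp1 u) = src (tgt u) \<and>
    comp2 u \<in> arrs C \<and> src (comp2 u) = tgt (src u) \<and> tgt (comp2 u) = tgt (tgt u) \<and>
    tgt u \<cdot>\<^bsub>C\<^esub> comp1 u = comp2 u \<cdot>\<^bsub>C\<^esub> src u"
  by (auto simp: mor_cat_def homs_iff)

lemma mor_arrD:
  assumes "u \<in> arrs (mor_cat C)"
  shows "src u \<in> arrs C" "tgt u \<in> arrs C"
    "comp1 u \<in> arrs C" "src (comp1 u) = src (src u)" "tgt (comp1 u) = src (tgt u)"
    "comp2 u \<in> arrs C" "src (comp2 u) = tgt (src u)" "tgt (comp2 u) = tgt (tgt u)"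
    "tgt u \<cdot>\<^bsub>C\<^esub> comp1 u = comp2 u \<cdot>\<^bsub>C\<^esub> src u"
  using assms unfolding mor_arr_iff by simp_all

lemma mor_eqI:
  "\<lbrakk>src u = src v; tgt u = tgt v; comp1 u = comp1 v; comp2 u = comp2 v\<rbrakk> \<Longrightarrow> u = v"
  by (cases u; cases v) (simp add: prod_eq_iff)

context category
begin

abbreviation Mor where
  "Mor \<equiv> mor_cat C"

abbreviation mor_cmp (infixl \<open>\<bullet>\<close> 70) where
  "v \<bullet> u \<equiv> v \<cdot>\<^bsub>mor_cat C\<^esub> u"

abbreviation mor_plus (infixl \<open>\<dotplus>\<close> 65) where
  "u \<dotplus> v \<equiv> u \<uplus>\<^bsub>mor_cat C\<^esub> v"

lemma mor_category: "category Mor"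
proof
  fix f g A B D
  assume "f \<in> homs Mor A B" "g \<in> homs Mor B D"
  then have f: "f \<in> arrs Mor" "src f = A" "tgt f = B"
    and g: "g \<in> arrs Mor" "src g = B" "tgt g = D" by (simp_all add: homs_iff)
  note F = mor_arrD[OF f(1), unfolded f(2,3)] and G = mor_arrD[OF g(1), unfolded g(2,3)]
  have "D \<cdot> (comp1 g \<cdot> comp1 f) = comp2 g \<cdot> (comp2 f \<cdot> A)"
    using cmp_prolong2[OF G(9), of "comp1 f"] F G by simp
  then show "g \<bullet> f \<in> homs Mor A D"
    using F G f g by (simp add: homs_iff mor_arr_iff)
qed (auto simp: mor_arr_iff homs_iff intro!: mor_eqI)

end

context additive_category
begin

lemma mor_hom_group:
  assumes A: "A \<in> arrs C" and B: "B \<in> arrs C"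
  shows "comm_group \<lparr>carrier = homs Mor A B, mult = plus_arr Mor,
    one = zero_arr Mor A B\<rparr>"
proof (rule comm_groupI, unfold partial_object.simps monoid.simps)
  fix f assume "f \<in> homs Mor A B"
  then have f: "f \<in> arrs Mor" "src f = A" "tgt f = B" by (simp_all add: homs_iff)
  note F = mor_arrD[OF f(1), unfolded f(2,3)]
  obtain n1 where n1: "n1 \<in> arrs C" "src n1 = src A" "tgt n1 = src B"
      "comp1 f \<uplus> n1 = zero_arr C (src A) (src B)"
    by (rule neg_exists[OF F(3)]) (use F in simp)
  obtain n2 where n2: "n2 \<in> arrs C" "src n2 = tgt A" "tgt n2 = tgt B"
      "comp2 f \<uplus> n2 = zero_arr C (tgt A) (tgt B)"
    by (rule neg_exists[OF F(6)]) (use F in simp)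
  have c1: "n1 \<uplus> comp1 f = zero_arr C (src A) (src B)"
    using n1 F plus_comm[of "comp1 f" n1] by simp
  have c2: "n2 \<uplus> comp2 f = zero_arr C (tgt A) (tgt B)"
    using n2 F plus_comm[of "comp2 f" n2] by simp
  \<comment> \<open>The negatives of the components form a commutative square since the components do.\<close>
  have "B \<cdot> n1 = n2 \<cdot> A"
  proof (rule plus_cancel[of _ "B \<cdot> comp1 f"])
    have "B \<cdot> n1 \<uplus> B \<cdot> comp1 f = B \<cdot> (n1 \<uplus> comp1 f)" using n1(1-3) F(1-8) by simp
    also have "\<dots> = (n2 \<uplus> comp2 f) \<cdot> A" using c1 c2 F(1-8) by simp
    also have "\<dots> = n2 \<cdot> A \<uplus> B \<cdot> comp1 f" using n2(1-3) F by simp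
    finally show "B \<cdot> n1 \<uplus> B \<cdot> comp1 f = n2 \<cdot> A \<uplus> B \<cdot> comp1 f" .
  qed (use n1 n2 F(1-8) in simp_all)
  then show "\<exists>n \<in> homs Mor A B. n \<dotplus> f = zero_arr Mor A B"
    using n1 n2 c1 c2 f F(1,2)
    by (intro bexI[of _ "Arrow A B (n1, n2)"]) (simp_all add: homs_iff mor_arr_iff)
next
  fix f g assume "f \<in> homs Mor A B" "g \<in> homs Mor A B"
  then have f: "f \<in> arrs Mor" "src f = A" "tgt f = B"
    and g: "g \<in> arrs Mor" "src g = A" "tgt g = B" by (simp_all add: homs_iff)
  note F = mor_arrD[OF f(1), unfolded f(2,3)] and G = mor_arrD[OF g(1), unfolded g(2,3)]
  show "f \<dotplus> g \<in> homs Mor A B"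
    using F G f by (simp add: homs_iff mor_arr_iff)
  show "f \<dotplus> g = g \<dotplus> f"
    using plus_comm[of "comp1 f" "comp1 g"] plus_comm[of "comp2 f" "comp2 g"] F(1-8) G(1-8) f g
    by (intro mor_eqI) simp_all
  fix h assume "h \<in> homs Mor A B"
  then have h: "h \<in> arrs Mor" "src h = A" "tgt h = B" by (simp_all add: homs_iff)
  note H = mor_arrD[OF h(1), unfolded h(2,3)]
  show "f \<dotplus> g \<dotplus> h = f \<dotplus> (g \<dotplus> h)"
    using F(1-8) G(1-8) H(1-8) f g by (intro mor_eqI) (simp_all add: plus_assoc)
next
  show "zero_arr Mor A B \<in> homs Mor A B"
    using A B by (simp add: homs_iff mor_arr_iff)
next
  fix f assume "f \<in> homs Mor A B"
  then have f: "f \<in> arrs Mor" "src f = A" "tgt f = B" by (simp_all add: homs_iff)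
  note F = mor_arrD[OF f(1), unfolded f(2,3)]
  show "zero_arr Mor A B \<dotplus> f = f"
    using F f by (intro mor_eqI) simp_all
qed

lemma zero_objectD:
  assumes "is_zero_object C Z"
  shows "Z \<in> objs C"
    "\<And>f g. \<lbrakk>f \<in> arrs C; g \<in> arrs C; src f = Z; src g = Z; tgt f = tgt g\<rbrakk> \<Longrightarrow> f = g"
    "\<And>f g. \<lbrakk>f \<in> arrs C; g \<in> arrs C; tgt f = Z; tgt g = Z; src f = src g\<rbrakk> \<Longrightarrow> f = g"
proof -
  show Z: "Z \<in> objs C" using assms by (simp add: is_zero_object_def)
  fix f g assume fg: "f \<in> arrs C" "g \<in> arrs C"
  have *: "\<And>A. A \<in> objs C \<Longrightarrow> \<exists>!f. f \<in> homs C Z A" "\<And>A. A \<in> objs C \<Longrightarrow> \<exists>!f. f \<in> homs C A Z"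
    using assms unfolding is_zero_object_def by blast+
  have uniq: "a = b" if "\<exists>!x. P x" "P a" "P b" for P and a b :: "('a, 'b) arrow"
    using that by blast
  {
    assume "src f = Z" "src g = Z" "tgt f = tgt g"
    then have "f \<in> homs C Z (tgt f)" "g \<in> homs C Z (tgt f)" using fg by (simp_all add: homs_iff)
    then show "f = g" by (rule uniq[OF *(1)[OF ends_obj(2)[OF fg(1)]]])
  }
  {
    assume "tgt f = Z" "tgt g = Z" "src f = src g"
    then have "f \<in> homs C (src f) Z" "g \<in> homs C (src f) Z" using fg by (simp_all add: homs_iff)
    then show "f = g" by (rule uniq[OF *(2)[OF ends_obj(1)[OF fg(1)]]])
  }
qed

text \<open>
  The middle arrow \<open>h\<close> is the diagonal sum of \<open>f\<close> and \<open>g\<close>. It is determined by its two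
  projections, from which the naturality of the inclusions follows.
\<close>

lemma mor_biproduct:
  assumes f: "f \<in> arrs C" and g: "g \<in> arrs C"
    and b1: "is_biproduct C (src f) (src g) B1 i1 j1 r1 p1"
    and b2: "is_biproduct C (tgt f) (tgt g) B2 i2 j2 r2 p2"
  obtains h where "is_biproduct Mor f g h
    (Arrow f h (i1, i2)) (Arrow g h (j1, j2)) (Arrow h f (r1, r2)) (Arrow h g (p1, p2))"
proof -
  note D = is_biproductD[OF b1] and E = is_biproductD[OF b2]
  obtain w where w: "w \<in> arrs C" "src w = B1" "tgt w = B2" "r2 \<cdot> w = f \<cdot> r1" "p2 \<cdot> w = g \<cdot> p1"
    by (rule biproduct_pair[OF b2, of "f \<cdot> r1" "g \<cdot> p1"]) (use f g D E in simp_all)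
  have i: "w \<cdot> i1 = i2 \<cdot> f"
    by (rule biproduct_ext_into[OF b2])
      (use D E w f g cmp_prolong2[OF w(4), of i1] cmp_prolong2[OF w(5), of i1]
        cmp_prolong[OF E(16), of f] cmp_prolong[OF E(19), of f] in simp_all)
  have j: "w \<cdot> j1 = j2 \<cdot> g"
    by (rule biproduct_ext_into[OF b2])
      (use D E w f g cmp_prolong2[OF w(4), of j1] cmp_prolong2[OF w(5), of j1]
        cmp_prolong[OF E(17), of g] cmp_prolong[OF E(18), of g] in simp_all)
  show ?thesis
    by (rule that[of w]) (use w i j f g D E in \<open>simp add: is_biproduct_def homs_iff mor_arr_iff\<close>)
qed

lemma mor_zero_object:
  assumes Z: "is_zero_object C Z"
  shows "is_zero_object Mor (ident C Z)"
proof -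
  note D = zero_objectD[OF Z]
  have z: "zero_arr C Z Z \<in> arrs C" using D(1) by simp
  have id: "ident C Z = zero_arr C Z Z" by (rule D(2)) (use D(1) in simp_all)
  show ?thesis
  proof (unfold is_zero_object_def, intro conjI ballI)
    fix A assume "A \<in> objs Mor"
    then have A: "A \<in> arrs C" by simp
    show "\<exists>!f. f \<in> homs Mor (ident C Z) A"
    proof (rule ex1I[of _ "zero_arr Mor (ident C Z) A"])
      fix f assume "f \<in> homs Mor (ident C Z) A"
      then have f: "f \<in> arrs Mor" "src f = ident C Z" "tgt f = A"
        by (simp_all add: homs_iff)
      note F = mor_arrD[OF f(1), unfolded f(2,3)]
      show "f = zero_arr Mor (ident C Z) A"
        by (rule mor_eqI[OF _ _ D(2) D(2)]) (use F f D(1) A in simp_all)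
    qed (use A D(1) in \<open>simp add: homs_iff mor_arr_iff\<close>)
    show "\<exists>!f. f \<in> homs Mor A (ident C Z)"
    proof (rule ex1I[of _ "zero_arr Mor A (ident C Z)"])
      fix f assume "f \<in> homs Mor A (ident C Z)"
      then have f: "f \<in> arrs Mor" "src f = A" "tgt f = ident C Z"
        by (simp_all add: homs_iff)
      note F = mor_arrD[OF f(1), unfolded f(2,3)]
      show "f = zero_arr Mor A (ident C Z)"
        by (rule mor_eqI[OF _ _ D(3) D(3)]) (use F f D(1) A in simp_all)
    qed (use A D(1) in \<open>simp add: homs_iff mor_arr_iff\<close>)
  qed (use D(1) in simp)
qed

lemma mor_additive: "additive_category Mor"
proof -
  show ?thesis
  proof (intro additive_category.intro additive_category_axioms.intro mor_category)
    fix A B assume "A \<in> objs Mor" "B \<in> objs Mor"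
    then have AB: "A \<in> arrs C" "B \<in> arrs C" by simp_all
    show "comm_group \<lparr>carrier = homs Mor A B, mult = plus_arr Mor,
        one = zero_arr Mor A B\<rparr>"
      by (rule mor_hom_group[OF AB])
  next
    fix A B assume "A \<in> objs Mor" "B \<in> objs Mor"
    then have AB: "A \<in> arrs C" "B \<in> arrs C" by simp_all
    obtain B1 i1 j1 r1 p1 where b1: "is_biproduct C (src A) (src B) B1 i1 j1 r1 p1"
      using biproduct[of "src A" "src B"] AB by auto
    obtain B2 i2 j2 r2 p2 where b2: "is_biproduct C (tgt A) (tgt B) B2 i2 j2 r2 p2"
      using biproduct[of "tgt A" "tgt B"] AB by auto
    obtain h where "is_biproduct Mor A B h (Arrow A h (i1, i2)) (Arrow B h (j1, j2))
        (Arrow h A (r1, r2)) (Arrow h B (p1, p2))"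
      by (rule mor_biproduct[OF AB b1 b2])
    then show "\<exists>D i j r p. is_biproduct Mor A B D i j r p"
      by (intro exI)
  next
    fix f g h A B D
    assume "f \<in> homs Mor A B" "g \<in> homs Mor B D" "h \<in> homs Mor B D"
    then show "(g \<dotplus> h) \<bullet> f
        = (g \<bullet> f) \<dotplus> (h \<bullet> f)"
      by (auto simp: homs_iff mor_arr_iff)
  next
    fix f g h A B D
    assume "f \<in> homs Mor A B" "g \<in> homs Mor A B" "h \<in> homs Mor B D"
    then show "h \<bullet> (f \<dotplus> g)
        = (h \<bullet> f) \<dotplus> (h \<bullet> g)"
      by (auto simp: homs_iff mor_arr_iff)
  next
    show "\<exists>Z. is_zero_object Mor Z"
      using zero_object mor_zero_object by blast
  qed
qed

end


section \<open>Degreewise limits and degreewise split sequences\<close>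

text \<open>
  Exactness of a degreewise split pair is automatic, because limits and colimits in the morphism
  category are computed degreewise.
\<close>

definition degreewise_split ::
  "('o, 'f) precat \<Rightarrow> ('o, 'f) mor_arrow \<Rightarrow> ('o, 'f) mor_arrow \<Rightarrow> bool" where
  "degreewise_split C i p \<longleftrightarrow> i \<in> arrs (mor_cat C) \<and> p \<in> arrs (mor_cat C) \<and> src p = tgt i \<and>
    split_exact C (comp1 i) (comp1 p) \<and> split_exact C (comp2 i) (comp2 p)"

lemma degreewise_splitD:
  assumes "degreewise_split C i p"
  shows "i \<in> arrs (mor_cat C)" "p \<in> arrs (mor_cat C)" "src p = tgt i"
    "split_exact C (comp1 i) (comp1 p)" "split_exact C (comp2 i) (comp2 p)"
  using assms by (simp_all add: degreewise_split_def)

context additive_category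
begin

text \<open>
  The factorisations in the two degrees form a commutative square because they do so after
  composition with the monomorphism \<open>comp2 k\<close>.
\<close>

lemma mor_kernel:
  assumes k: "k \<in> arrs Mor" and f: "f \<in> arrs Mor" and kf: "tgt k = src f"
    and k1: "is_kernel C (comp1 k) (comp1 f)" and k2: "is_kernel C (comp2 k) (comp2 f)"
  shows "is_kernel Mor k f"
proof (rule is_kernelI[OF k f kf])
  note K = mor_arrD[OF k] and F = mor_arrD[OF f]
  show "f \<bullet> k = zero_arr Mor (src k) (tgt f)"
    using is_kernelD(4)[OF k1] is_kernelD(4)[OF k2] K F by (intro mor_eqI) simp_all
next
  note K = mor_arrD[OF k] and F = mor_arrD[OF f]
  fix g assume g: "g \<in> arrs Mor" "tgt g = src f"
    and z: "f \<bullet> g = zero_arr Mor (src g) (tgt f)"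
  note G = mor_arrD[OF g(1)]
  obtain h1 where h1: "h1 \<in> arrs C" "src h1 = src (comp1 g)" "tgt h1 = src (comp1 k)"
    "comp1 k \<cdot> h1 = comp1 g"
    by (rule kernel_factor[OF k1, of "comp1 g"]) (use z G F g(2) in simp_all)
  obtain h2 where h2: "h2 \<in> arrs C" "src h2 = src (comp2 g)" "tgt h2 = src (comp2 k)"
    "comp2 k \<cdot> h2 = comp2 g"
    by (rule kernel_factor[OF k2, of "comp2 g"]) (use z G F g(2) in simp_all)
  have "src k \<cdot> h1 = h2 \<cdot> src g"
  proof (rule mono_cancel[OF kernel_mono[OF k2]])
    have "comp2 k \<cdot> (src k \<cdot> h1) = tgt k \<cdot> (comp1 k \<cdot> h1)"
      by (rule cmp_prolong2[OF K(9)[symmetric]]) (use K h1 G in simp_all)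
    also have "\<dots> = comp2 g \<cdot> src g" using h1(4) G(9) kf g(2) by simp
    also have "\<dots> = comp2 k \<cdot> (h2 \<cdot> src g)"
      using cmp_prolong[OF h2(4), of "src g"] K h2 G by simp
    finally show "comp2 k \<cdot> (src k \<cdot> h1) = comp2 k \<cdot> (h2 \<cdot> src g)" .
  qed (use K h1 h2 G in simp_all)
  then have "Arrow (src g) (src k) (h1, h2) \<in> arrs Mor"
    using K h1 h2 G by (simp add: mor_arr_iff)
  moreover have "k \<bullet> Arrow (src g) (src k) (h1, h2) = g"
    using h1 h2 kf g(2) by (intro mor_eqI) simp_all
  ultimately show "\<exists>h. h \<in> arrs Mor \<and> src h = src g \<and> tgt h = src k \<and>
      k \<bullet> h = g"
    by (intro exI[of _ "Arrow (src g) (src k) (h1, h2)"]) simp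
next
  note K = mor_arrD[OF k]
  fix g h assume g: "g \<in> arrs Mor" and h: "h \<in> arrs Mor"
    and e: "tgt g = src k" "tgt h = src k" "src g = src h" "k \<bullet> g = k \<bullet> h"
  note G = mor_arrD[OF g] and H = mor_arrD[OF h]
  show "g = h"
  proof (rule mor_eqI)
    show "comp1 g = comp1 h"
      by (rule mono_cancel[OF kernel_mono[OF k1]]) (use e K G H in simp_all)
    show "comp2 g = comp2 h"
      by (rule mono_cancel[OF kernel_mono[OF k2]]) (use e K G H in simp_all)
  qed (use e in simp_all)
qed

text \<open>
  Dually, commutativity of the square is tested after precomposition with the epimorphism \<open>comp1 q\<close>.
\<close>

lemma mor_cokernel:
  assumes q: "q \<in> arrs Mor" and f: "f \<in> arrs Mor" and qf: "src q = tgt f"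
    and q1: "is_cokernel C (comp1 q) (comp1 f)" and q2: "is_cokernel C (comp2 q) (comp2 f)"
  shows "is_cokernel Mor q f"
proof (rule is_cokernelI[OF q f qf])
  note Q = mor_arrD[OF q] and F = mor_arrD[OF f]
  show "q \<bullet> f = zero_arr Mor (src f) (tgt q)"
    using is_cokernelD(4)[OF q1] is_cokernelD(4)[OF q2] Q F by (intro mor_eqI) simp_all
next
  note Q = mor_arrD[OF q] and F = mor_arrD[OF f]
  fix g assume g: "g \<in> arrs Mor" "src g = tgt f"
    and z: "g \<bullet> f = zero_arr Mor (src f) (tgt g)"
  note G = mor_arrD[OF g(1)]
  obtain h1 where h1: "h1 \<in> arrs C" "src h1 = tgt (comp1 q)" "tgt h1 = tgt (comp1 g)"
    "h1 \<cdot> comp1 q = comp1 g"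
    by (rule cokernel_factor[OF q1, of "comp1 g"]) (use z G F g(2) in simp_all)
  obtain h2 where h2: "h2 \<in> arrs C" "src h2 = tgt (comp2 q)" "tgt h2 = tgt (comp2 g)"
    "h2 \<cdot> comp2 q = comp2 g"
    by (rule cokernel_factor[OF q2, of "comp2 g"]) (use z G F g(2) in simp_all)
  have "tgt g \<cdot> h1 = h2 \<cdot> tgt q"
  proof (rule epi_cancel[OF cokernel_epi[OF q1]])
    have "(tgt g \<cdot> h1) \<cdot> comp1 q = comp2 g \<cdot> src g" using h1 G Q by simp
    also have "\<dots> = h2 \<cdot> (comp2 q \<cdot> src q)"
      using cmp_prolong[OF h2(4), of "src q"] Q h2 G qf g(2) by simp
    also have "\<dots> = (h2 \<cdot> tgt q) \<cdot> comp1 q" using Q h2 by simp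
    finally show "(tgt g \<cdot> h1) \<cdot> comp1 q = (h2 \<cdot> tgt q) \<cdot> comp1 q" .
  qed (use Q h1 h2 G in simp_all)
  then have "Arrow (tgt q) (tgt g) (h1, h2) \<in> arrs Mor"
    using Q h1 h2 G by (simp add: mor_arr_iff)
  moreover have "Arrow (tgt q) (tgt g) (h1, h2) \<bullet> q = g"
    using h1 h2 qf g(2) by (intro mor_eqI) simp_all
  ultimately show "\<exists>h. h \<in> arrs Mor \<and> src h = tgt q \<and> tgt h = tgt g \<and>
      h \<bullet> q = g"
    by (intro exI[of _ "Arrow (tgt q) (tgt g) (h1, h2)"]) simp
next
  note Q = mor_arrD[OF q]
  fix g h assume g: "g \<in> arrs Mor" and h: "h \<in> arrs Mor"
    and e: "src g = tgt q" "src h = tgt q" "tgt g = tgt h" "g \<bullet> q = h \<bullet> q"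
  note G = mor_arrD[OF g] and H = mor_arrD[OF h]
  show "g = h"
  proof (rule mor_eqI)
    show "comp1 g = comp1 h"
      by (rule epi_cancel[OF cokernel_epi[OF q1]]) (use e Q G H in simp_all)
    show "comp2 g = comp2 h"
      by (rule epi_cancel[OF cokernel_epi[OF q2]]) (use e Q G H in simp_all)
  qed (use e in simp_all)
qed

lemma degreewise_split_short_exact:
  assumes "degreewise_split C i p"
  shows "short_exact Mor i p"
  using degreewise_splitD[OF assms] mor_kernel[of i p] mor_cokernel[of p i]
    split_short_exact[of "comp1 i" "comp1 p"] split_short_exact[of "comp2 i" "comp2 p"]
  by (simp add: short_exact_def)

text \<open>
  The pullback object is the arrow \<open>w\<close> that the universal property in degree 2 induces between the
  degreewise pullbacks; all squares are checked by the uniqueness part of the same property.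
\<close>

lemma mor_pullback:
  assumes p: "p \<in> arrs Mor" and g: "g \<in> arrs Mor" and pg: "tgt p = tgt g"
    and P1: "is_pullback C (comp1 p) (comp1 g) p1 g1" and P2: "is_pullback C (comp2 p) (comp2 g) p2 g2"
  obtains w where "w \<in> arrs C" "src w = src p1" "tgt w = src p2"
    "is_pullback Mor p g (Arrow w (src g) (p1, p2)) (Arrow w (src p) (g1, g2))"
proof -
  note P = mor_arrD[OF p] and G = mor_arrD[OF g]
  note D = is_pullbackD[OF P1] and E = is_pullbackD[OF P2]
  have "comp2 p \<cdot> (src p \<cdot> g1) = tgt p \<cdot> (comp1 p \<cdot> g1)"
    by (rule cmp_prolong2[OF P(9)[symmetric]]) (use P D in simp_all)
  also have "\<dots> = tgt g \<cdot> (comp1 g \<cdot> p1)" using D(9) pg by simp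
  also have "\<dots> = comp2 g \<cdot> (src g \<cdot> p1)"
    by (rule cmp_prolong2[OF G(9)]) (use G D in simp_all)
  finally have eq: "comp2 p \<cdot> (src p \<cdot> g1) = comp2 g \<cdot> (src g \<cdot> p1)" .
  obtain w where w: "w \<in> arrs C" "src w = src (src p \<cdot> g1)" "tgt w = src p2"
    "g2 \<cdot> w = src p \<cdot> g1" "p2 \<cdot> w = src g \<cdot> p1"
    by (rule pullback_factor[OF P2 _ _ _ _ _ eq]) (use P G D in simp_all)
  have sw: "src w = src p1" using w(2) P D by simp
  let ?p' = "Arrow w (src g) (p1, p2)" and ?g' = "Arrow w (src p) (g1, g2)"
  have p': "?p' \<in> arrs Mor" and g': "?g' \<in> arrs Mor"
    using w sw P G D E by (simp_all add: mor_arr_iff)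
  have "is_pullback Mor p g ?p' ?g'"
  proof (rule is_pullbackI[OF p g pg p' g'])
    fix u v assume u: "u \<in> arrs Mor" and v: "v \<in> arrs Mor"
      and e: "tgt u = src p" "tgt v = src g" "src v = src u"
        "p \<bullet> u = g \<bullet> v"
    note U = mor_arrD[OF u] and V = mor_arrD[OF v]
    obtain x where x: "x \<in> arrs C" "src x = src (comp1 u)" "tgt x = src p1"
        "g1 \<cdot> x = comp1 u" "p1 \<cdot> x = comp1 v"
      by (rule pullback_factor[OF P1, of "comp1 u" "comp1 v"]) (use U V P G e in simp_all)
    obtain y where y: "y \<in> arrs C" "src y = src (comp2 u)" "tgt y = src p2"
        "g2 \<cdot> y = comp2 u" "p2 \<cdot> y = comp2 v"
      by (rule pullback_factor[OF P2, of "comp2 u" "comp2 v"]) (use U V P G e in simp_all)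
    have "w \<cdot> x = y \<cdot> src u"
    proof (rule pullback_ext[OF P2])
      show "g2 \<cdot> (w \<cdot> x) = g2 \<cdot> (y \<cdot> src u)"
        using cmp_prolong2[OF w(4), of x] cmp_prolong[OF y(4), of "src u"] U x y w sw P D E e by simp
      show "p2 \<cdot> (w \<cdot> x) = p2 \<cdot> (y \<cdot> src u)"
        using cmp_prolong2[OF w(5), of x] cmp_prolong[OF y(5), of "src u"] U V x y w sw G D E e by simp
    qed (use w sw x y U D E in simp_all)
    then have "Arrow (src u) w (x, y) \<in> arrs Mor"
      using w sw x y U by (simp add: mor_arr_iff)
    then show "\<exists>z. z \<in> arrs Mor \<and> src z = src u \<and> tgt z = src ?p' \<and>
        ?g' \<bullet> z = u \<and> ?p' \<bullet> z = v"
      using x y e by (intro exI[of _ "Arrow (src u) w (x, y)"]) (auto intro!: mor_eqI)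
  next
    fix x y assume x: "x \<in> arrs Mor" and y: "y \<in> arrs Mor"
      and e: "tgt x = src ?p'" "tgt y = src ?p'" "src x = src y"
        "?g' \<bullet> x = ?g' \<bullet> y" "?p' \<bullet> x = ?p' \<bullet> y"
    note X = mor_arrD[OF x] and Y = mor_arrD[OF y]
    show "x = y"
    proof (rule mor_eqI)
      show "comp1 x = comp1 y"
        by (rule pullback_ext[OF P1]) (use e X Y w sw in simp_all)
      show "comp2 x = comp2 y"
        by (rule pullback_ext[OF P2]) (use e X Y w sw in simp_all)
    qed (use e in simp_all)
  qed (use D E pg in simp_all)
  then show ?thesis using that w(1,3) sw by blast
qed

lemma mor_pushout:
  assumes i: "i \<in> arrs Mor" and g: "g \<in> arrs Mor" and ig: "src i = src g"
    and P1: "is_pushout C (comp1 i) (comp1 g) i1 g1" and P2: "is_pushout C (comp2 i) (comp2 g) i2 g2"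
  obtains w where "w \<in> arrs C" "src w = tgt i1" "tgt w = tgt i2"
    "is_pushout Mor i g (Arrow (tgt g) w (i1, i2)) (Arrow (tgt i) w (g1, g2))"
proof -
  note I = mor_arrD[OF i] and G = mor_arrD[OF g]
  note D = is_pushoutD[OF P1] and E = is_pushoutD[OF P2]
  have "(g2 \<cdot> tgt i) \<cdot> comp1 i = g2 \<cdot> (comp2 i \<cdot> src i)"
    using I E D by simp
  also have "\<dots> = i2 \<cdot> (comp2 g \<cdot> src g)"
    unfolding ig by (rule cmp_prolong2[OF E(9)]) (use I G E ig in simp_all)
  also have "\<dots> = (i2 \<cdot> tgt g) \<cdot> comp1 g"
    using G E D by simp
  finally have eq: "(g2 \<cdot> tgt i) \<cdot> comp1 i = (i2 \<cdot> tgt g) \<cdot> comp1 g" .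
  obtain w where w: "w \<in> arrs C" "tgt w = tgt (g2 \<cdot> tgt i)" "src w = tgt i1"
    "w \<cdot> g1 = g2 \<cdot> tgt i" "w \<cdot> i1 = i2 \<cdot> tgt g"
    by (rule pushout_factor[OF P1 _ _ _ _ _ eq]) (use I G D E in simp_all)
  have tw: "tgt w = tgt i2" using w(2) I E by simp
  let ?i' = "Arrow (tgt g) w (i1, i2)" and ?g' = "Arrow (tgt i) w (g1, g2)"
  have i': "?i' \<in> arrs Mor" and g': "?g' \<in> arrs Mor"
    using w tw I G D E by (simp_all add: mor_arr_iff)
  have "is_pushout Mor i g ?i' ?g'"
  proof (rule is_pushoutI[OF i g ig i' g'])
    fix u v assume u: "u \<in> arrs Mor" and v: "v \<in> arrs Mor"
      and e: "src u = tgt i" "src v = tgt g" "tgt v = tgt u"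
        "u \<bullet> i = v \<bullet> g"
    note U = mor_arrD[OF u] and V = mor_arrD[OF v]
    obtain x where x: "x \<in> arrs C" "tgt x = tgt (comp1 u)" "src x = tgt i1"
        "x \<cdot> g1 = comp1 u" "x \<cdot> i1 = comp1 v"
      by (rule pushout_factor[OF P1, of "comp1 u" "comp1 v"]) (use U V I G e in simp_all)
    obtain y where y: "y \<in> arrs C" "tgt y = tgt (comp2 u)" "src y = tgt i2"
        "y \<cdot> g2 = comp2 u" "y \<cdot> i2 = comp2 v"
      by (rule pushout_factor[OF P2, of "comp2 u" "comp2 v"]) (use U V I G e in simp_all)
    have "tgt u \<cdot> x = y \<cdot> w"
    proof (rule pushout_ext[OF P1])
      show "(tgt u \<cdot> x) \<cdot> g1 = (y \<cdot> w) \<cdot> g1"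
        using cmp_prolong[OF y(4), of "tgt i"] U x y w tw I D E e by simp
      show "(tgt u \<cdot> x) \<cdot> i1 = (y \<cdot> w) \<cdot> i1"
        using cmp_prolong[OF y(5), of "tgt g"] U V x y w tw G D E e by simp
    qed (use w tw x y U D E in simp_all)
    then have "Arrow w (tgt u) (x, y) \<in> arrs Mor"
      using w tw x y U by (simp add: mor_arr_iff)
    then show "\<exists>z. z \<in> arrs Mor \<and> tgt z = tgt u \<and> src z = tgt ?i' \<and>
        z \<bullet> ?g' = u \<and> z \<bullet> ?i' = v"
      using x y e by (intro exI[of _ "Arrow w (tgt u) (x, y)"]) (auto intro!: mor_eqI)
  next
    fix x y assume x: "x \<in> arrs Mor" and y: "y \<in> arrs Mor"
      and e: "src x = tgt ?i'" "src y = tgt ?i'" "tgt x = tgt y"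
        "x \<bullet> ?g' = y \<bullet> ?g'" "x \<bullet> ?i' = y \<bullet> ?i'"
    note X = mor_arrD[OF x] and Y = mor_arrD[OF y]
    show "x = y"
    proof (rule mor_eqI)
      show "comp1 x = comp1 y"
        by (rule pushout_ext[OF P1]) (use e X Y w tw in simp_all)
      show "comp2 x = comp2 y"
        by (rule pushout_ext[OF P2]) (use e X Y w tw in simp_all)
    qed (use e in simp_all)
  qed (use D E ig in simp_all)
  then show ?thesis using that w(1,3) tw by blast
qed

text \<open>
  The kernel stays the same object \<open>src i\<close>, because the degreewise pullbacks do not change it. So
  the pullback is again an extension, of \<open>src g\<close> by \<open>src i\<close>.
\<close>

lemma degreewise_split_pullback:
  assumes s: "degreewise_split C i p" and g: "g \<in> arrs Mor" and gp: "tgt g = tgt p"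
  obtains p' g' k where "is_pullback Mor p g p' g'" "degreewise_split C k p'" "src k = src i"
proof -
  note S = degreewise_splitD[OF s]
  note I = mor_arrD[OF S(1)] and P = mor_arrD[OF S(2)] and G = mor_arrD[OF g]
  obtain p1 g1 k1 where 1: "is_pullback C (comp1 p) (comp1 g) p1 g1" "split_exact C k1 p1"
    "src k1 = src (comp1 i)" "g1 \<cdot> k1 = comp1 i"
    by (rule split_pullback[OF S(4), of "comp1 g"]) (use G P gp in simp_all)
  obtain p2 g2 k2 where 2: "is_pullback C (comp2 p) (comp2 g) p2 g2" "split_exact C k2 p2"
    "src k2 = src (comp2 i)" "g2 \<cdot> k2 = comp2 i"
    by (rule split_pullback[OF S(5), of "comp2 g"]) (use G P gp in simp_all)
  obtain w where w: "w \<in> arrs C" "src w = src p1" "tgt w = src p2"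
    and pb: "is_pullback Mor p g (Arrow w (src g) (p1, p2)) (Arrow w (src p) (g1, g2))"
    by (rule mor_pullback[OF S(2) g gp[symmetric] 1(1) 2(1)])
  let ?p' = "Arrow w (src g) (p1, p2)"
  have K1: "is_kernel C k1 p1" and K2: "is_kernel C k2 p2"
    using split_short_exact[OF 1(2)] split_short_exact[OF 2(2)] by (simp_all add: short_exact_def)
  note K1' = is_kernelD[OF K1] and K2' = is_kernelD[OF K2]
  note D = is_pullbackD[OF 1(1)] and E = is_pullbackD[OF 2(1)]
  have p': "?p' \<in> arrs Mor" and g': "Arrow w (src p) (g1, g2) \<in> arrs Mor"
    using is_pullbackD[OF pb] by simp_all
  note P' = mor_arrD[OF p', simplified] and G' = mor_arrD[OF g', simplified]
  have "w \<cdot> k1 = k2 \<cdot> src i"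
  proof (rule pullback_ext[OF 2(1)])
    have "g2 \<cdot> (w \<cdot> k1) = src p \<cdot> (g1 \<cdot> k1)"
      by (rule cmp_prolong2[OF G'(9)[symmetric]]) (use G' K1' w D in simp_all)
    also have "\<dots> = comp2 i \<cdot> src i" using 1(4) S(3) I(9) by simp
    also have "\<dots> = g2 \<cdot> (k2 \<cdot> src i)"
      using cmp_prolong[OF 2(4), of "src i"] K2' E I 2(3) by simp
    finally show "g2 \<cdot> (w \<cdot> k1) = g2 \<cdot> (k2 \<cdot> src i)" .
    have "p2 \<cdot> (w \<cdot> k1) = src g \<cdot> (p1 \<cdot> k1)"
      by (rule cmp_prolong2[OF P'(9)[symmetric]]) (use P' K1' w D in simp_all)
    also have "\<dots> = zero_arr C (src (comp1 i)) (tgt (src g))" using K1' D G 1(3) I by simp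
    also have "\<dots> = p2 \<cdot> (k2 \<cdot> src i)"
      using cmp_prolong[OF K2'(4), of "src i"] K2' E G I 2(3) by simp
    finally show "p2 \<cdot> (w \<cdot> k1) = p2 \<cdot> (k2 \<cdot> src i)" .
  qed (use w K1' K2' I 1(3) 2(3) in simp_all)
  then have "Arrow (src i) w (k1, k2) \<in> arrs Mor"
    using w K1' K2' I 1(3) 2(3) by (simp add: mor_arr_iff)
  then have "degreewise_split C (Arrow (src i) w (k1, k2)) ?p'"
    using p' 1(2) 2(2) by (simp add: degreewise_split_def)
  from that[OF pb this] show ?thesis by simp
qed

text \<open>
  Dually, the pushout is an extension of the unchanged cokernel \<open>tgt p\<close> by \<open>tgt g\<close>.
\<close>

lemma degreewise_split_pushout:
  assumes s: "degreewise_split C i p" and g: "g \<in> arrs Mor" and gi: "src g = src i"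
  obtains i' g' c where "is_pushout Mor i g i' g'" "degreewise_split C i' c" "tgt c = tgt p"
proof -
  note S = degreewise_splitD[OF s]
  note I = mor_arrD[OF S(1)] and P = mor_arrD[OF S(2)] and G = mor_arrD[OF g]
  obtain i1 g1 c1 where 1: "is_pushout C (comp1 i) (comp1 g) i1 g1" "split_exact C i1 c1"
    "tgt c1 = tgt (comp1 p)" "c1 \<cdot> g1 = comp1 p"
    by (rule split_pushout[OF S(4), of "comp1 g"]) (use G I gi in simp_all)
  obtain i2 g2 c2 where 2: "is_pushout C (comp2 i) (comp2 g) i2 g2" "split_exact C i2 c2"
    "tgt c2 = tgt (comp2 p)" "c2 \<cdot> g2 = comp2 p"
    by (rule split_pushout[OF S(5), of "comp2 g"]) (use G I gi in simp_all)
  obtain w where w: "w \<in> arrs C" "src w = tgt i1" "tgt w = tgt i2"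
    and po: "is_pushout Mor i g (Arrow (tgt g) w (i1, i2)) (Arrow (tgt i) w (g1, g2))"
    by (rule mor_pushout[OF S(1) g gi[symmetric] 1(1) 2(1)])
  let ?i' = "Arrow (tgt g) w (i1, i2)"
  have C1: "is_cokernel C c1 i1" and C2: "is_cokernel C c2 i2"
    using split_short_exact[OF 1(2)] split_short_exact[OF 2(2)] by (simp_all add: short_exact_def)
  note C1' = is_cokernelD[OF C1] and C2' = is_cokernelD[OF C2]
  note D = is_pushoutD[OF 1(1)] and E = is_pushoutD[OF 2(1)]
  have i': "?i' \<in> arrs Mor" and g': "Arrow (tgt i) w (g1, g2) \<in> arrs Mor"
    using is_pushoutD[OF po] by simp_all
  note I' = mor_arrD[OF i', simplified] and G' = mor_arrD[OF g', simplified]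
  have "tgt p \<cdot> c1 = c2 \<cdot> w"
  proof (rule pushout_ext[OF 1(1)])
    have "(c2 \<cdot> w) \<cdot> g1 = c2 \<cdot> (g2 \<cdot> tgt i)" using G' C2' w D E by simp
    also have "\<dots> = comp2 p \<cdot> src p"
      using cmp_prolong[OF 2(4), of "tgt i"] C2' E I S(3) by simp
    also have "\<dots> = (tgt p \<cdot> c1) \<cdot> g1" using 1(3,4) P C1' D I by simp
    finally show "(tgt p \<cdot> c1) \<cdot> g1 = (c2 \<cdot> w) \<cdot> g1" by (rule sym)
    have "(c2 \<cdot> w) \<cdot> i1 = c2 \<cdot> (i2 \<cdot> tgt g)" using I' C2' w D E by simp
    also have "\<dots> = zero_arr C (tgt (comp1 g)) (tgt (comp2 p))"
      using cmp_prolong[OF C2'(4), of "tgt g"] C2' E G P 2(3) by simp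
    also have "\<dots> = (tgt p \<cdot> c1) \<cdot> i1" using 1(3) P C1' D G by simp
    finally show "(tgt p \<cdot> c1) \<cdot> i1 = (c2 \<cdot> w) \<cdot> i1" by (rule sym)
  qed (use w C1' C2' P 1(3) 2(3) in simp_all)
  then have "Arrow w (tgt p) (c1, c2) \<in> arrs Mor"
    using w C1' C2' P 1(3) 2(3) by (simp add: mor_arr_iff)
  then have "degreewise_split C ?i' (Arrow w (tgt p) (c1, c2))"
    using i' 1(2) 2(2) by (simp add: degreewise_split_def)
  from that[OF po this] show ?thesis by simp
qed

lemma mor_isom_components:
  assumes "is_isom Mor a"
  shows "is_isom C (comp1 a)" "is_isom C (comp2 a)"
proof -
  obtain b where a: "a \<in> arrs Mor" and b: "b \<in> arrs Mor" "src b = tgt a" "tgt b = src a"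
    and e: "b \<bullet> a = ident Mor (src a)" "a \<bullet> b = ident Mor (tgt a)"
    using assms unfolding is_isom_def homs_iff by (auto simp: homs_iff simp del: mor_cat_simps)
  note A = mor_arrD[OF a] and B = mor_arrD[OF b(1)]
  show "is_isom C (comp1 a)"
    unfolding is_isom_def using A B b e by (intro conjI bexI[of _ "comp1 b"]) (simp_all add: homs_iff)
  show "is_isom C (comp2 a)"
    unfolding is_isom_def using A B b e by (intro conjI bexI[of _ "comp2 b"]) (simp_all add: homs_iff)
qed

lemma mor_split_degreewise:
  assumes "split_exact Mor i p"
  shows "degreewise_split C i p"
proof -
  obtain j r where b: "is_biproduct Mor (src i) (tgt p) (tgt i) i j r p"
    using assms by (auto simp: split_exact_def)
  note D = is_biproductD[OF b]
  note I = mor_arrD[OF D(4)] and J = mor_arrD[OF D(7)] and R = mor_arrD[OF D(10)] and P = mor_arrD[OF D(13)]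
  have "is_biproduct C (src (comp1 i)) (tgt (comp1 p)) (tgt (comp1 i)) (comp1 i) (comp1 j) (comp1 r) (comp1 p)"
    unfolding is_biproduct_def homs_iff using D I J R P by simp
  moreover have "is_biproduct C (src (comp2 i)) (tgt (comp2 p)) (tgt (comp2 i)) (comp2 i) (comp2 j) (comp2 r) (comp2 p)"
    unfolding is_biproduct_def homs_iff using D I J R P by simp
  ultimately show ?thesis
    using D by (auto simp: degreewise_split_def split_exact_def)
qed

end


section \<open>Full subcategories and degreewise split arrows\<close>

text \<open>
  From here on the morphism category is mostly used through the laws of an additive category, so its
  operations stay folded.
\<close>

declare mor_cat_simps [simp del]

lemma full_subcat_simps [simp]:
  "objs (full_subcat C X) = X"
  "f \<in> arrs (full_subcat C X) \<longleftrightarrow> f \<in> arrs C \<and> src f \<in> X \<and> tgt f \<in> X"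
  "ident (full_subcat C X) = ident C"
  "cmp (full_subcat C X) = cmp C"
  "plus_arr (full_subcat C X) = plus_arr C"
  "zero_arr (full_subcat C X) = zero_arr C"
  by (simp_all add: full_subcat_def)

lemma full_subcat_homs: "\<lbrakk>A \<in> X; B \<in> X\<rbrakk> \<Longrightarrow> homs (full_subcat C X) A B = homs C A B"
  by (auto simp: homs_iff)

lemma full_subcat_homs_if:
  "homs (full_subcat C X) A B = (if A \<in> X \<and> B \<in> X then homs C A B else {})"
  by (auto simp: homs_iff)

lemma full_subcat_biproduct:
  "X \<subseteq> objs C \<Longrightarrow> is_biproduct (full_subcat C X) A D B i j r p \<longleftrightarrow>
    A \<in> X \<and> D \<in> X \<and> B \<in> X \<and> is_biproduct C A D B i j r p"
  by (auto simp: is_biproduct_def full_subcat_homs)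

lemma full_subcat_isom:
  "is_isom (full_subcat C X) f \<Longrightarrow> is_isom C f"
  by (auto simp: is_isom_def homs_iff)

lemma full_subcat_kernel:
  "\<lbrakk>is_kernel C k f; src k \<in> X; src f \<in> X; tgt f \<in> X\<rbrakk> \<Longrightarrow> is_kernel (full_subcat C X) k f"
  unfolding is_kernel_def by (simp add: full_subcat_homs_if split: if_splits)

lemma full_subcat_cokernel:
  "\<lbrakk>is_cokernel C q f; tgt q \<in> X; src f \<in> X; tgt f \<in> X\<rbrakk> \<Longrightarrow> is_cokernel (full_subcat C X) q f"
  unfolding is_cokernel_def by (simp add: full_subcat_homs_if split: if_splits)

lemma full_subcat_pullback:
  "\<lbrakk>is_pullback C p g p' g'; src p \<in> X; tgt p \<in> X; src g \<in> X; src p' \<in> X\<rbrakk>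
    \<Longrightarrow> is_pullback (full_subcat C X) p g p' g'"
  unfolding is_pullback_def by (simp add: full_subcat_homs_if split: if_splits)

lemma full_subcat_pushout:
  "\<lbrakk>is_pushout C i g i' g'; src i \<in> X; tgt i \<in> X; tgt g \<in> X; tgt i' \<in> X\<rbrakk>
    \<Longrightarrow> is_pushout (full_subcat C X) i g i' g'"
  unfolding is_pushout_def by (simp add: full_subcat_homs_if split: if_splits)

lemma (in additive_category) full_subcat_additive:
  assumes X: "X \<subseteq> objs C" and Z: "is_zero_object C Z" "Z \<in> X"
    and sums: "\<And>A D. \<lbrakk>A \<in> X; D \<in> X\<rbrakk> \<Longrightarrow> \<exists>B i j r p. B \<in> X \<and> is_biproduct C A D B i j r p"
  shows "additive_category (full_subcat C X)"
proof (intro additive_category.intro category.intro additive_category_axioms.intro)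
  fix A B assume AB: "A \<in> objs (full_subcat C X)" "B \<in> objs (full_subcat C X)"
  then have "A \<in> objs C" "B \<in> objs C" using X by auto
  then show "comm_group \<lparr>carrier = homs (full_subcat C X) A B, mult = plus_arr (full_subcat C X),
      one = zero_arr (full_subcat C X) A B\<rparr>"
    using hom_group AB by (simp add: full_subcat_homs)
next
  fix A B assume AB: "A \<in> objs (full_subcat C X)" "B \<in> objs (full_subcat C X)"
  then show "\<exists>D i j r p. is_biproduct (full_subcat C X) A B D i j r p"
    using sums[of A B] by (auto simp: full_subcat_biproduct[OF X])
next
  have "is_zero_object (full_subcat C X) Z"
    using Z X unfolding is_zero_object_def by (simp add: full_subcat_homs subset_iff)
  then show "\<exists>Z. is_zero_object (full_subcat C X) Z" by blast
next
  fix f g A B D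
  assume "f \<in> homs (full_subcat C X) A B" "g \<in> homs (full_subcat C X) B D"
  then show "g \<cdot>\<^bsub>full_subcat C X\<^esub> f \<in> homs (full_subcat C X) A D"
    by (auto simp: homs_iff)
next
  fix f g h A B D E
  assume "f \<in> homs (full_subcat C X) A B" "g \<in> homs (full_subcat C X) B D"
    "h \<in> homs (full_subcat C X) D E"
  then show "h \<cdot>\<^bsub>full_subcat C X\<^esub> g \<cdot>\<^bsub>full_subcat C X\<^esub> f
      = h \<cdot>\<^bsub>full_subcat C X\<^esub> (g \<cdot>\<^bsub>full_subcat C X\<^esub> f)"
    by (auto simp: homs_iff)
qed (use X in \<open>auto simp: homs_iff\<close>)

definition split_epi :: "('o, 'f) precat \<Rightarrow> ('o, 'f) arrow \<Rightarrow> bool" where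
  "split_epi C p \<longleftrightarrow> p \<in> arrs C \<and>
    (\<exists>s \<in> arrs C. src s = tgt p \<and> tgt s = src p \<and> p \<cdot>\<^bsub>C\<^esub> s = ident C (tgt p))"

definition split_mono :: "('o, 'f) precat \<Rightarrow> ('o, 'f) arrow \<Rightarrow> bool" where
  "split_mono C i \<longleftrightarrow> i \<in> arrs C \<and>
    (\<exists>r \<in> arrs C. src r = tgt i \<and> tgt r = src i \<and> r \<cdot>\<^bsub>C\<^esub> i = ident C (src i))"

lemma split_exactD:
  assumes "split_exact C i p"
  shows "split_mono C i" "split_epi C p"
proof -
  obtain j r where b: "is_biproduct C (src i) (tgt p) (tgt i) i j r p"
    using assms by (auto simp: split_exact_def)
  note D = is_biproductD[OF b]
  show "split_mono C i" unfolding split_mono_def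
    by (intro conjI bexI[of _ r]) (use D in simp_all)
  show "split_epi C p" unfolding split_epi_def
    by (intro conjI bexI[of _ j]) (use D in simp_all)
qed

lemma (in category) split_epi_cmp:
  assumes "split_epi C p" "split_epi C q" "src q = tgt p"
  shows "split_epi C (q \<cdot> p)"
proof -
  obtain s where s: "p \<in> arrs C" "s \<in> arrs C" "src s = tgt p" "tgt s = src p" "p \<cdot> s = ident C (tgt p)"
    using assms(1) by (auto simp: split_epi_def)
  obtain t where t: "q \<in> arrs C" "t \<in> arrs C" "src t = tgt q" "tgt t = src q" "q \<cdot> t = ident C (tgt q)"
    using assms(2) by (auto simp: split_epi_def)
  show ?thesis unfolding split_epi_def
    by (intro conjI bexI[of _ "s \<cdot> t"]) (use s t assms(3) cmp_prolong[OF s(5), of t] in simp_all)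
qed

lemma (in category) split_epi_cancel:
  assumes "split_epi C (f \<cdot> g)" "f \<in> arrs C" "g \<in> arrs C" "src f = tgt g"
  shows "split_epi C f"
proof -
  obtain s where s: "s \<in> arrs C" "src s = tgt (f \<cdot> g)" "tgt s = src (f \<cdot> g)"
    "f \<cdot> g \<cdot> s = ident C (tgt (f \<cdot> g))"
    using assms(1) by (auto simp: split_epi_def)
  show ?thesis unfolding split_epi_def
    by (intro conjI bexI[of _ "g \<cdot> s"]) (use s assms(2-) in simp_all)
qed

lemma (in category) split_mono_cmp:
  assumes "split_mono C i" "split_mono C j" "src j = tgt i"
  shows "split_mono C (j \<cdot> i)"
proof -
  obtain s where s: "i \<in> arrs C" "s \<in> arrs C" "src s = tgt i" "tgt s = src i" "s \<cdot> i = ident C (src i)"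
    using assms(1) by (auto simp: split_mono_def)
  obtain t where t: "j \<in> arrs C" "t \<in> arrs C" "src t = tgt j" "tgt t = src j" "t \<cdot> j = ident C (src j)"
    using assms(2) by (auto simp: split_mono_def)
  show ?thesis unfolding split_mono_def
    by (intro conjI bexI[of _ "s \<cdot> t"]) (use s t assms(3) cmp_prolong[OF t(5), of i] in simp_all)
qed

lemma (in category) split_mono_cancel:
  assumes "split_mono C (g \<cdot> f)" "f \<in> arrs C" "g \<in> arrs C" "src g = tgt f"
  shows "split_mono C f"
proof -
  obtain r where r: "r \<in> arrs C" "src r = tgt (g \<cdot> f)" "tgt r = src (g \<cdot> f)"
    "r \<cdot> (g \<cdot> f) = ident C (src (g \<cdot> f))"
    using assms(1) by (auto simp: split_mono_def)
  show ?thesis unfolding split_mono_def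
    by (intro conjI bexI[of _ "r \<cdot> g"]) (use r assms(2-) in simp_all)
qed

text \<open>
  Cokernels alone make the category weakly idempotent complete: retractions and coretractions have
  complements.
\<close>

locale cokernel_category = additive_category +
  assumes cokernel_exists: "f \<in> arrs C \<Longrightarrow> \<exists>q. is_cokernel C q f"
begin

lemma split_mono_split_exact:
  assumes "split_mono C i"
  obtains p where "split_exact C i p"
proof -
  obtain r where r: "i \<in> arrs C" "r \<in> arrs C" "src r = tgt i" "tgt r = src i" "r \<cdot> i = ident C (src i)"
    using assms by (auto simp: split_mono_def)
  obtain q where q: "is_cokernel C q i" using cokernel_exists r(1) by blast
  obtain j where b: "is_biproduct C (tgt q) (src i) (tgt i) j i q r"
    by (rule retract_biproduct[OF r q])
  show ?thesis
    by (rule that[of q]) (use biproduct_swap[OF b] in \<open>auto simp: split_exact_def\<close>)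
qed

lemma split_epi_split_exact:
  assumes "split_epi C p"
  obtains i where "split_exact C i p"
proof -
  obtain s where s: "p \<in> arrs C" "s \<in> arrs C" "src s = tgt p" "tgt s = src p" "p \<cdot> s = ident C (tgt p)"
    using assms by (auto simp: split_epi_def)
  obtain q where q: "is_cokernel C q s" using cokernel_exists s(2) by blast
  have ps: "p \<cdot> s = ident C (src s)" using s by simp
  obtain i where b: "is_biproduct C (tgt q) (src s) (tgt s) i s q p"
    by (rule retract_biproduct[OF s(2,1) s(4)[symmetric] s(3)[symmetric] ps q])
  note D = is_biproductD[OF b]
  show ?thesis
    by (rule that[of i]) (use b D(5,6) s(3) in \<open>auto simp: split_exact_def\<close>)
qed

text \<open>
  Degreewise complements carry an induced arrow, so a degreewise split monomorphism always has
  a cokernel in the morphism category. Whether that cokernel is itself a monomorphism is another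
  matter.
\<close>

lemma mor_split_mono_split:
  assumes u: "u \<in> arrs Mor" and "split_mono C (comp1 u)" "split_mono C (comp2 u)"
  obtains c where "degreewise_split C u c"
proof -
  note U = mor_arrD[OF u]
  obtain c1 where c1: "split_exact C (comp1 u) c1" using split_mono_split_exact assms(2) .
  obtain c2 where c2: "split_exact C (comp2 u) c2" using split_mono_split_exact assms(3) .
  have K1: "is_cokernel C c1 (comp1 u)" and K2: "is_cokernel C c2 (comp2 u)"
    using split_short_exact[OF c1] split_short_exact[OF c2] by (simp_all add: short_exact_def)
  note D = is_cokernelD[OF K1] and E = is_cokernelD[OF K2]
  have "(c2 \<cdot> tgt u) \<cdot> comp1 u = zero_arr C (src (comp1 u)) (tgt (c2 \<cdot> tgt u))"
    using cmp_prolong[OF E(4), of "src u"] U E D by simp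
  then obtain w where w: "w \<in> arrs C" "src w = tgt c1" "tgt w = tgt (c2 \<cdot> tgt u)" "w \<cdot> c1 = c2 \<cdot> tgt u"
    using cokernel_factor[OF K1, of "c2 \<cdot> tgt u"] U E D by auto
  have "Arrow (tgt u) w (c1, c2) \<in> arrs Mor"
    using w U D E by (simp add: mor_arr_iff)
  then show ?thesis
    using u c1 c2 by (intro that[of "Arrow (tgt u) w (c1, c2)"]) (simp add: degreewise_split_def)
qed

lemma mor_split_epi_split:
  assumes p: "p \<in> arrs Mor" and "split_epi C (comp1 p)" "split_epi C (comp2 p)"
  obtains i where "degreewise_split C i p"
proof -
  note P = mor_arrD[OF p]
  obtain k1 where k1: "split_exact C k1 (comp1 p)" using split_epi_split_exact assms(2) .
  obtain k2 where k2: "split_exact C k2 (comp2 p)" using split_epi_split_exact assms(3) .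
  have K1: "is_kernel C k1 (comp1 p)" and K2: "is_kernel C k2 (comp2 p)"
    using split_short_exact[OF k1] split_short_exact[OF k2] by (simp_all add: short_exact_def)
  note D = is_kernelD[OF K1] and E = is_kernelD[OF K2]
  have "comp2 p \<cdot> (src p \<cdot> k1) = tgt p \<cdot> (comp1 p \<cdot> k1)"
    by (rule cmp_prolong2[OF P(9)[symmetric]]) (use P D in simp_all)
  then have "comp2 p \<cdot> (src p \<cdot> k1) = zero_arr C (src (src p \<cdot> k1)) (tgt (comp2 p))"
    using P D by simp
  then obtain w where w: "w \<in> arrs C" "src w = src (src p \<cdot> k1)" "tgt w = src k2" "k2 \<cdot> w = src p \<cdot> k1"
    using kernel_factor[OF K2, of "src p \<cdot> k1"] P E D by auto
  have "Arrow w (src p) (k1, k2) \<in> arrs Mor"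
    using w P D E by (simp add: mor_arr_iff)
  then show ?thesis
    using p k1 k2 by (intro that[of "Arrow w (src p) (k1, k2)"]) (simp add: degreewise_split_def)
qed

end


section \<open>Monomorphisms with cokernel in a resolving subcategory\<close>

text \<open>
  The assumption \<open>cokernel_sequence\<close> is the exactness of \<open>0 \<rightarrow> Cok f \<rightarrow> Cok h \<rightarrow> Cok g \<rightarrow> 0\<close> for a
  degreewise exact sequence \<open>0 \<rightarrow> f \<rightarrow> h \<rightarrow> g \<rightarrow> 0\<close> with \<open>g\<close> a monomorphism, as the snake lemma provides
  it in an abelian category.
\<close>

locale cokernel_exact_category = cokernel_category +
  assumes cokernel_sequence:
    "\<lbrakk>i \<in> arrs Mor; p \<in> arrs Mor; src p = tgt i;
      short_exact C (comp1 i) (comp1 p); short_exact C (comp2 i) (comp2 p); is_mono C (tgt p);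
      is_cokernel C q (src i); is_cokernel C q' (tgt i); is_cokernel C q'' (tgt p)\<rbrakk>
      \<Longrightarrow> \<exists>a b. short_exact C a b \<and> src a = tgt q \<and> tgt a = tgt q' \<and> tgt b = tgt q''"

locale resolving_subcategory = cokernel_exact_category + resolving
begin

text \<open>
  A retract is a direct summand, its complement being the cokernel of the inclusion.
\<close>

lemma retracts:
  assumes s: "s \<in> arrs C" "t \<in> arrs C" "src t = tgt s" "tgt t = src s"
    and ts: "t \<cdot> s = ident C (src s)" and X: "tgt s \<in> X"
  shows "src s \<in> X"
proof -
  obtain q where q: "is_cokernel C q s" using cokernel_exists s(1) by blast
  obtain i where b: "is_biproduct C (tgt q) (src s) (tgt s) i s q t"
    by (rule retract_biproduct[OF s ts q])
  show ?thesis by (rule direct_summands[OF biproduct_swap[OF b] X])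
qed

lemma split_middle: "\<lbrakk>split_exact C i p; src i \<in> X; tgt p \<in> X\<rbrakk> \<Longrightarrow> tgt i \<in> X"
  unfolding split_exact_def using direct_sums by blast

lemma split_sub: "\<lbrakk>split_exact C i p; tgt i \<in> X\<rbrakk> \<Longrightarrow> src i \<in> X"
  unfolding split_exact_def using direct_summands by blast

lemma S_objsI:
  "\<lbrakk>is_mono C f; src f \<in> X; tgt f \<in> X; is_cokernel C q f; tgt q \<in> X\<rbrakk> \<Longrightarrow> f \<in> S_objs C X"
  by (auto simp: S_objs_def)

lemma S_objsD:
  assumes "f \<in> S_objs C X"
  shows "is_mono C f" "f \<in> arrs C" "src f \<in> X" "tgt f \<in> X"
  using assms by (auto simp: S_objs_def is_mono_def)

text \<open>
  Two cokernels of one arrow are retracts of each other, so the choice made in \<open>S_objs\<close> is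
  immaterial.
\<close>

lemma S_objs_cokernel:
  assumes f: "f \<in> S_objs C X" and q: "is_cokernel C q f"
  shows "tgt q \<in> X"
proof -
  obtain q' where q': "is_cokernel C q' f" "tgt q' \<in> X" using f by (auto simp: S_objs_def)
  note Q = is_cokernelD[OF q] and Q' = is_cokernelD[OF q'(1)]
  obtain u where u: "u \<in> arrs C" "src u = tgt q" "tgt u = tgt q'" "u \<cdot> q = q'"
    by (rule cokernel_factor[OF q Q'(1,3,4)])
  obtain v where v: "v \<in> arrs C" "src v = tgt q'" "tgt v = tgt q" "v \<cdot> q' = q"
    by (rule cokernel_factor[OF q'(1) Q(1,3,4)])
  have "v \<cdot> u = ident C (src u)"
    by (rule epi_cancel[OF cokernel_epi[OF q]]) (use u v Q in simp_all)
  then show ?thesis using retracts[of u v] u v q'(2) by simp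
qed

text \<open>
  If \<open>tgt i\<close> kills \<open>x\<close>, then \<open>tgt p\<close> kills the image of \<open>x\<close> in the quotient, so \<open>x\<close> comes from the
  subobject, where \<open>src i\<close> kills it. The cokernel of \<open>tgt i\<close> is an extension of the two outer
  cokernels.
\<close>

lemma S_objs_extension:
  assumes s: "degreewise_split C i p" and X: "src i \<in> S_objs C X" "tgt p \<in> S_objs C X"
  shows "tgt i \<in> S_objs C X"
proof -
  note S = degreewise_splitD[OF s]
  note I = mor_arrD[OF S(1)] and P = mor_arrD[OF S(2)]
  note E1 = split_short_exact[OF S(4)] and E2 = split_short_exact[OF S(5)]
  have K1: "is_kernel C (comp1 i) (comp1 p)" and K2: "is_kernel C (comp2 i) (comp2 p)"
    using E1 E2 by (simp_all add: short_exact_def)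
  have mono: "is_mono C (tgt i)"
  proof (rule mono_if_zero_cancel[OF I(2)])
    fix g assume g: "g \<in> arrs C" "tgt g = src (tgt i)" and z: "tgt i \<cdot> g = zero_arr C (src g) (tgt (tgt i))"
    have "tgt p \<cdot> (comp1 p \<cdot> g) = comp2 p \<cdot> (tgt i \<cdot> g)"
      using cmp_prolong2[OF P(9), of g] P g S(3) by simp
    also have "\<dots> = tgt p \<cdot> zero_arr C (src g) (src (tgt p))"
      using z P I g S(3) by simp
    finally have "comp1 p \<cdot> g = zero_arr C (src g) (src (tgt p))"
      by (rule mono_cancel[OF S_objsD(1)[OF X(2)]]) (use P I g S(3) in simp_all)
    then obtain k where k: "k \<in> arrs C" "src k = src g" "tgt k = src (comp1 i)" "comp1 i \<cdot> k = g"
      using kernel_factor[OF K1 g(1)] P I g(2) S(3) by metis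
    have "comp2 i \<cdot> (src i \<cdot> k) = tgt i \<cdot> (comp1 i \<cdot> k)"
      by (rule cmp_prolong2[OF I(9)[symmetric]]) (use I k in simp_all)
    also have "\<dots> = comp2 i \<cdot> zero_arr C (src g) (tgt (src i))" using k z I g by simp
    finally have "src i \<cdot> k = zero_arr C (src g) (tgt (src i))"
      by (rule mono_cancel[OF kernel_mono[OF K2]]) (use I g k in simp_all)
    then have "src i \<cdot> k = src i \<cdot> zero_arr C (src g) (src (src i))" using I g by simp
    then have "k = zero_arr C (src g) (src (src i))"
      by (rule mono_cancel[OF S_objsD(1)[OF X(1)]]) (use I g k in simp_all)
    then show "g = zero_arr C (src g) (src (tgt i))" using k(4) I g by simp
  qed
  have X1: "src (tgt i) \<in> X" and X2: "tgt (tgt i) \<in> X"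
    using split_middle[OF S(4)] split_middle[OF S(5)] I P S_objsD[OF X(1)] S_objsD[OF X(2)] by simp_all
  obtain q where q: "is_cokernel C q (src i)" using cokernel_exists I(1) by blast
  obtain q' where q': "is_cokernel C q' (tgt i)" using cokernel_exists I(2) by blast
  obtain q'' where q'': "is_cokernel C q'' (tgt p)" using cokernel_exists P(2) by blast
  obtain a b where ab: "short_exact C a b" "src a = tgt q" "tgt a = tgt q'" "tgt b = tgt q''"
    using cokernel_sequence[OF S(1-3) E1 E2 S_objsD(1)[OF X(2)] q q' q''] by blast
  have "tgt q' \<in> X"
    using extensions[OF ab(1)] ab(2-) S_objs_cokernel[OF X(1) q] S_objs_cokernel[OF X(2) q''] by simp
  then show ?thesis by (rule S_objsI[OF mono X1 X2 q'])
qed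

text \<open>
  The restriction of a monomorphism to a subobject is a monomorphism, and its cokernel is the kernel
  of the epimorphism \<open>Cok (tgt i) \<rightarrow> Cok (tgt p)\<close> between objects of \<open>X\<close>.
\<close>

lemma S_objs_kernel:
  assumes s: "degreewise_split C i p" and X: "tgt i \<in> S_objs C X" "tgt p \<in> S_objs C X"
  shows "src i \<in> S_objs C X"
proof -
  note S = degreewise_splitD[OF s]
  note I = mor_arrD[OF S(1)] and P = mor_arrD[OF S(2)]
  note E1 = split_short_exact[OF S(4)] and E2 = split_short_exact[OF S(5)]
  have K1: "is_kernel C (comp1 i) (comp1 p)"
    using E1 by (simp add: short_exact_def)
  have mono: "is_mono C (src i)"
  proof (rule mono_if_zero_cancel[OF I(1)])
    fix g assume g: "g \<in> arrs C" "tgt g = src (src i)" and z: "src i \<cdot> g = zero_arr C (src g) (tgt (src i))"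
    have "tgt i \<cdot> (comp1 i \<cdot> g) = comp2 i \<cdot> (src i \<cdot> g)"
      by (rule cmp_prolong2[OF I(9)]) (use I g in simp_all)
    also have "\<dots> = tgt i \<cdot> zero_arr C (src g) (src (tgt i))" using z I g by simp
    finally have "comp1 i \<cdot> g = zero_arr C (src g) (src (tgt i))"
      by (rule mono_cancel[OF S_objsD(1)[OF X(1)]]) (use I g in simp_all)
    then have "comp1 i \<cdot> g = comp1 i \<cdot> zero_arr C (src g) (src (src i))" using I g by simp
    then show "g = zero_arr C (src g) (src (src i))"
      by (rule mono_cancel[OF kernel_mono[OF K1]]) (use I g in simp_all)
  qed
  have X1: "src (src i) \<in> X" and X2: "tgt (src i) \<in> X"
    using split_sub[OF S(4)] split_sub[OF S(5)] I S_objsD[OF X(1)] by simp_all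
  obtain q where q: "is_cokernel C q (src i)" using cokernel_exists I(1) by blast
  obtain q' where q': "is_cokernel C q' (tgt i)" using cokernel_exists I(2) by blast
  obtain q'' where q'': "is_cokernel C q'' (tgt p)" using cokernel_exists P(2) by blast
  obtain a b where ab: "short_exact C a b" "src a = tgt q" "tgt a = tgt q'" "tgt b = tgt q''"
    using cokernel_sequence[OF S(1-3) E1 E2 S_objsD(1)[OF X(2)] q q' q''] by blast
  have k: "is_kernel C a b" and e: "is_epi C b"
    using ab(1) cokernel_epi by (auto simp: short_exact_def)
  have "src a \<in> X"
    using kernels_of_epis[OF e _ _ k] is_kernelD(3)[OF k] ab(2-)
      S_objs_cokernel[OF X(1) q'] S_objs_cokernel[OF X(2) q''] by simp
  then show ?thesis unfolding ab(2) by (rule S_objsI[OF mono X1 X2 q])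
qed

text \<open>
  Source, target and cokernel are functors on the morphism category, so they turn a retract of
  \<open>tgt s\<close> into retracts of objects of \<open>X\<close>.
\<close>

lemma S_objs_retract:
  assumes s: "s \<in> arrs Mor" and t: "t \<in> arrs Mor" and st: "src t = tgt s" "tgt t = src s"
    and ts: "t \<bullet> s = ident Mor (src s)" and X: "tgt s \<in> S_objs C X"
  shows "src s \<in> S_objs C X"
proof -
  note S = mor_arrD[OF s] and T = mor_arrD[OF t]
  have ts1: "comp1 t \<cdot> comp1 s = ident C (src (src s))" and ts2: "comp2 t \<cdot> comp2 s = ident C (tgt (src s))"
    using ts by (simp_all add: mor_cat_simps)
  note ts1' = cmp_prolong[OF ts1] and ts2' = cmp_prolong[OF ts2]
  have mono: "is_mono C (src s)"
  proof (rule mono_if_zero_cancel[OF S(1)])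
    fix g assume g: "g \<in> arrs C" "tgt g = src (src s)" and z: "src s \<cdot> g = zero_arr C (src g) (tgt (src s))"
    have "tgt s \<cdot> (comp1 s \<cdot> g) = comp2 s \<cdot> (src s \<cdot> g)"
      by (rule cmp_prolong2[OF S(9)]) (use S g in simp_all)
    also have "\<dots> = tgt s \<cdot> zero_arr C (src g) (src (tgt s))" using z S g by simp
    finally have "comp1 s \<cdot> g = zero_arr C (src g) (src (tgt s))"
      by (rule mono_cancel[OF S_objsD(1)[OF X(1)]]) (use S g in simp_all)
    then show "g = zero_arr C (src g) (src (src s))"
      using ts1'[of g] S T st g by simp
  qed
  have X1: "src (src s) \<in> X"
    using retracts[of "comp1 s" "comp1 t"] S T st ts1 S_objsD[OF X] by simp
  have X2: "tgt (src s) \<in> X"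
    using retracts[of "comp2 s" "comp2 t"] S T st ts2 S_objsD[OF X] by simp
  obtain q where q: "is_cokernel C q (src s)" using cokernel_exists S(1) by blast
  obtain q' where q': "is_cokernel C q' (tgt s)" using cokernel_exists S(2) by blast
  note Q = is_cokernelD[OF q] and Q' = is_cokernelD[OF q']
  have "q' \<cdot> comp2 s \<cdot> src s = zero_arr C (src (src s)) (tgt (q' \<cdot> comp2 s))"
    using cmp_prolong[OF Q'(4), of "comp1 s"] Q' S(1-8) by (simp add: S(9)[symmetric])
  then obtain u where u: "u \<in> arrs C" "src u = tgt q" "tgt u = tgt q'" "u \<cdot> q = q' \<cdot> comp2 s"
    using cokernel_factor[OF q, of "q' \<cdot> comp2 s"] Q' S by auto
  have "q \<cdot> comp2 t \<cdot> tgt s = zero_arr C (src (tgt s)) (tgt (q \<cdot> comp2 t))"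
    using cmp_prolong[OF Q(4), of "comp1 t"] Q T(1-8) st by (simp add: T(9)[symmetric, unfolded st])
  then obtain v where v: "v \<in> arrs C" "src v = tgt q'" "tgt v = tgt q" "v \<cdot> q' = q \<cdot> comp2 t"
    using cokernel_factor[OF q', of "q \<cdot> comp2 t"] Q T st by auto
  have "v \<cdot> u = ident C (src u)"
  proof (rule epi_cancel[OF cokernel_epi[OF q]])
    have "v \<cdot> u \<cdot> q = (q \<cdot> comp2 t) \<cdot> comp2 s"
      using cmp_prolong[OF v(4), of "comp2 s"] u v(1-3) Q Q' S by simp
    also have "\<dots> = q" using Q S T st ts2 by simp
    finally show "v \<cdot> u \<cdot> q = ident C (src u) \<cdot> q" using u Q by simp
  qed (use u v Q in simp_all)
  then have "tgt q \<in> X" using retracts[of u v] u v S_objs_cokernel[OF X q'] by simp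
  then show ?thesis by (rule S_objsI[OF mono X1 X2 q])
qed

lemma E_cw_iff:
  "(i, p) \<in> E_cw C X \<longleftrightarrow> degreewise_split C i p \<and>
    src i \<in> S_objs C X \<and> tgt i \<in> S_objs C X \<and> tgt p \<in> S_objs C X"
  (is "?L \<longleftrightarrow> ?R")
proof
  assume L: ?L
  then have "is_kernel Mor i p" by (simp add: E_cw_def short_exact_def)
  from is_kernelD(1-3)[OF this] L show ?R by (simp add: E_cw_def degreewise_split_def)
next
  assume R: ?R
  then have "short_exact Mor i p" using degreewise_split_short_exact by blast
  with R show ?L by (simp add: E_cw_def degreewise_split_def)
qed

lemma E_cwI_deflation:
  assumes "p \<in> arrs Mor" "split_epi C (comp1 p)" "split_epi C (comp2 p)"
    and X: "src p \<in> S_objs C X" "tgt p \<in> S_objs C X"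
  obtains i where "(i, p) \<in> E_cw C X"
proof -
  obtain i where i: "degreewise_split C i p" by (rule mor_split_epi_split[OF assms(1-3)])
  have "tgt i \<in> S_objs C X" using X(1) degreewise_splitD(3)[OF i] by simp
  then show ?thesis using that[of i] S_objs_kernel[OF i] i X by (auto simp: E_cw_iff)
qed

text \<open>
  Every arrow out of a zero object is zero, so it lifts along anything; zero objects are projective.
\<close>

lemma zero_object_in_X:
  assumes Z: "is_zero_object C Z"
  shows "Z \<in> X"
proof (rule projectives)
  note D = zero_objectD[OF Z]
  show "projective C Z"
    unfolding projective_def
  proof (intro conjI D(1) allI impI)
    fix e g assume "is_epi C e \<and> g \<in> homs C Z (tgt e)"
    then have e: "e \<in> arrs C" and g: "g \<in> arrs C" "src g = Z" "tgt g = tgt e"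
      by (simp_all add: is_epi_def homs_iff)
    have "e \<cdot> zero_arr C Z (src e) = g" by (rule D(2)) (use e g D(1) in simp_all)
    then show "\<exists>h \<in> homs C Z (src e). e \<cdot> h = g"
      using e D(1) by (intro bexI[of _ "zero_arr C Z (src e)"]) (simp_all add: homs_iff)
  qed
qed

lemma zero_object_in_S:
  assumes Z: "is_zero_object C Z"
  shows "ident C Z \<in> S_objs C X"
proof (rule S_objsI)
  note D = zero_objectD[OF Z]
  have ZX: "Z \<in> X" by (rule zero_object_in_X[OF Z])
  show "src (ident C Z) \<in> X" "tgt (ident C Z) \<in> X" "tgt (ident C Z) \<in> X" using ZX D(1) by simp_all
  show "is_mono C (ident C Z)"
    by (rule mono_if_zero_cancel; (rule D(3))?) (use D(1) in simp_all)
  show "is_cokernel C (ident C Z) (ident C Z)"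
  proof (rule is_cokernelI)
    show "ident C Z \<cdot> ident C Z = zero_arr C (src (ident C Z)) (tgt (ident C Z))"
      by (rule D(2)) (use D(1) in simp_all)
  next
    fix g assume "g \<in> arrs C" "src g = tgt (ident C Z)"
    then show "\<exists>h. h \<in> arrs C \<and> src h = tgt (ident C Z) \<and> tgt h = tgt g \<and> h \<cdot> ident C Z = g"
      using D(1) by (intro exI[of _ g]) simp
  qed (use D(1) in simp_all)
qed

lemma S_cat_additive: "additive_category (S_cat C X)"
proof -
  interpret H: additive_category Mor by (rule mor_additive)
  obtain Z where Z: "is_zero_object C Z" using zero_object by blast
  show ?thesis
    unfolding S_cat_def
  proof (rule H.full_subcat_additive)
    show "S_objs C X \<subseteq> objs Mor" using S_objsD(2) by (auto simp: mor_cat_simps)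
    show "is_zero_object Mor (ident C Z)" by (rule mor_zero_object[OF Z])
    show "ident C Z \<in> S_objs C X" by (rule zero_object_in_S[OF Z])
    fix A D assume A: "A \<in> S_objs C X" and D: "D \<in> S_objs C X"
    have "A \<in> objs Mor" "D \<in> objs Mor"
      using S_objsD(2) A D by (auto simp: mor_cat_simps)
    then obtain B i j r p where b: "is_biproduct Mor A D B i j r p"
      using H.biproduct by blast
    note bD = is_biproductD[OF b]
    have "degreewise_split C i p"
      by (rule mor_split_degreewise) (use b bD in \<open>auto simp: split_exact_def\<close>)
    then have "B \<in> S_objs C X" using S_objs_extension[of i p] bD A D by simp
    then show "\<exists>B i j r p. B \<in> S_objs C X \<and> is_biproduct Mor A D B i j r p"
      using b by blast
  qed
qed

end


section \<open>The exact structure\<close>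

context resolving_subcategory
begin

text \<open>
  For inflations \<open>i: A \<rightarrow> Z\<close> and \<open>j: Z \<rightarrow> W\<close> with cokernels \<open>Y\<close> and \<open>Y'\<close>, the pushout of \<open>j\<close> along
  \<open>p: Z \<rightarrow> Y\<close> is an extension of \<open>Y'\<close> by \<open>Y\<close>, hence in \<open>\<S>\<close>. It is \<open>W/A\<close>; it is enough to see that
  the cokernel of \<open>j \<cdot> i\<close> is a retract of it, and the maps in both directions come from the two
  universal properties.
\<close>

lemma E_cw_mono_cmp:
  assumes ip: "(i, p) \<in> E_cw C X" and jq: "(j, q) \<in> E_cw C X" and ij: "src j = tgt i"
  obtains c where "(j \<bullet> i, c) \<in> E_cw C X"
proof -
  interpret H: additive_category Mor by (rule mor_additive)
  note 1 = ip[unfolded E_cw_iff, THEN conjunct1] and 2 = jq[unfolded E_cw_iff, THEN conjunct1]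
  note S = degreewise_splitD[OF 1] and T = degreewise_splitD[OF 2]
  note I = mor_arrD[OF S(1)] and J = mor_arrD[OF T(1)]
  let ?ji = "j \<bullet> i"
  have ji: "?ji \<in> arrs Mor" using S T ij by simp
  have "split_mono C (comp1 ?ji)" "split_mono C (comp2 ?ji)"
    using split_mono_cmp[OF split_exactD(1)[OF S(4)] split_exactD(1)[OF T(4)]]
      split_mono_cmp[OF split_exactD(1)[OF S(5)] split_exactD(1)[OF T(5)]] I J ij
    by (simp_all add: mor_cat_simps)
  then obtain c where c: "degreewise_split C ?ji c" by (rule mor_split_mono_split[OF ji])
  obtain i' g' d where po: "is_pushout Mor j p i' g'" and i': "degreewise_split C i' d" "tgt d = tgt q"
    by (rule degreewise_split_pushout[OF 2, of p]) (use S T ij in simp_all)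
  note D = is_pushoutD[OF po]
  have PO: "tgt i' \<in> S_objs C X"
    using S_objs_extension[OF i'(1)] D i'(2) ip jq by (simp add: E_cw_iff)
  have C: "is_cokernel Mor c ?ji" and P: "is_cokernel Mor p i"
    using degreewise_split_short_exact[OF c] degreewise_split_short_exact[OF 1]
    by (simp_all add: short_exact_def)
  note C' = is_cokernelD[OF C] and P' = is_cokernelD[OF P]
  have "g' \<bullet> ?ji = zero_arr Mor (src i) (tgt g')"
  proof -
    have "g' \<bullet> ?ji = i' \<bullet> (p \<bullet> i)"
      by (rule H.cmp_prolong2[OF D(9)]) (use D S ij in simp_all)
    then show ?thesis using P' D S by simp
  qed
  then obtain a where a: "a \<in> arrs Mor" "src a = tgt c" "tgt a = tgt g'" "a \<bullet> c = g'"
    using cokernel_factor[OF C, of g'] C' D S T ij by auto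
  have "(c \<bullet> j) \<bullet> i = zero_arr Mor (src i) (tgt c)"
    using C' S T ij by simp
  then obtain v where v: "v \<in> arrs Mor" "src v = tgt p" "tgt v = tgt c"
    "v \<bullet> p = c \<bullet> j"
    using cokernel_factor[OF P, of "c \<bullet> j"] C' S T ij by auto
  obtain b where b: "b \<in> arrs Mor" "tgt b = tgt c" "src b = tgt i'"
    "b \<bullet> g' = c" "b \<bullet> i' = v"
    by (rule pushout_factor[OF po, of c v]) (use C' v S T ij in simp_all)
  have "b \<bullet> a = ident Mor (src a)"
  proof (rule H.epi_cancel[OF H.cokernel_epi[OF C]])
    show "(b \<bullet> a) \<bullet> c = ident Mor (src a) \<bullet> c"
      using a b C' D by simp
  qed (use a b C' D in simp_all)
  then have "src a \<in> S_objs C X"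
    by (rule S_objs_retract[rotated 4]) (use a b D PO in simp_all)
  then have "(?ji, c) \<in> E_cw C X"
    using c a(2) C' ip jq S T ij by (simp add: E_cw_iff)
  then show ?thesis by (rule that)
qed

text \<open>
  Let \<open>u: Z \<rightarrow> Q\<close> be the degreewise cokernel of \<open>f: A \<rightarrow> Z\<close>. The pushout of the inflation \<open>g \<cdot> f\<close>
  along \<open>f\<close>, with structure maps \<open>i': Z \<rightarrow> PO\<close> and \<open>g': W \<rightarrow> PO\<close>, is an extension of objects of \<open>\<S>\<close>.
  Now \<open>Q\<close> is a retract of \<open>PO\<close>: the projection \<open>t\<close> is \<open>u\<close> on \<open>Z\<close> and zero on \<open>W\<close>, and the inclusion
  \<open>s\<close> is induced by \<open>i' - g' \<cdot> g\<close>, which vanishes on \<open>f\<close>.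
\<close>

lemma E_cw_mono_cancel:
  assumes fg: "f \<in> arrs Mor" "g \<in> arrs Mor" "src g = tgt f"
    and f: "src f \<in> S_objs C X" "tgt f \<in> S_objs C X"
    and E: "(g \<bullet> f, p) \<in> E_cw C X"
  obtains u where "(f, u) \<in> E_cw C X"
proof -
  interpret H: additive_category Mor by (rule mor_additive)
  note F = mor_arrD[OF fg(1)] and G = mor_arrD[OF fg(2)]
  note gf = E[unfolded E_cw_iff, THEN conjunct1]
  note S = degreewise_splitD[OF gf]
  have "split_mono C (comp1 g \<cdot> comp1 f)" "split_mono C (comp2 g \<cdot> comp2 f)"
    using split_exactD(1)[OF S(4)] split_exactD(1)[OF S(5)] by (simp_all add: mor_cat_simps)
  then have "split_mono C (comp1 f)" "split_mono C (comp2 f)"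
    using split_mono_cancel[of "comp1 g" "comp1 f"] split_mono_cancel[of "comp2 g" "comp2 f"] F G fg(3) by simp_all
  then obtain u where u: "degreewise_split C f u" by (rule mor_split_mono_split[OF fg(1)])
  obtain i' g' d where po: "is_pushout Mor (g \<bullet> f) f i' g'"
    and i': "degreewise_split C i' d" "tgt d = tgt p"
    by (rule degreewise_split_pushout[OF gf fg(1)]) (use fg in simp)
  note D = is_pushoutD[OF po]
  have PO: "tgt i' \<in> S_objs C X"
    using S_objs_extension[OF i'(1)] D i'(2) E f by (simp add: E_cw_iff)
  have U: "is_cokernel Mor u f"
    using degreewise_split_short_exact[OF u] by (simp add: short_exact_def)
  note U' = is_cokernelD[OF U]
  have tg': "src g' = tgt g" using D fg by simp
  obtain t where t: "t \<in> arrs Mor" "tgt t = tgt u" "src t = tgt i'"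
    "t \<bullet> g' = zero_arr Mor (tgt g) (tgt u)" "t \<bullet> i' = u"
    by (rule pushout_factor[OF po, of "zero_arr Mor (tgt g) (tgt u)" u]) (use U' fg in simp_all)
  obtain n where n: "n \<in> arrs Mor" "src n = src g" "tgt n = tgt i'"
    "g' \<bullet> g \<dotplus> n = zero_arr Mor (src g) (tgt i')"
    by (rule H.neg_exists[of "g' \<bullet> g"]) (use D fg tg' in simp_all)
  have tn: "t \<bullet> n = zero_arr Mor (src g) (tgt u)"
    using arg_cong[OF n(4), of "\<lambda>x. t \<bullet> x"] H.cmp_prolong[OF t(4), of g] n(1-3) t(1-3) D fg tg' U'
    by simp
  have nf: "i' \<bullet> f \<dotplus> n \<bullet> f
      = zero_arr Mor (src f) (tgt i')"
    using arg_cong[OF n(4), of "\<lambda>x. x \<bullet> f"] n(1-3) D fg tg' by simp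
  let ?d = "i' \<dotplus> n"
  obtain s where s: "s \<in> arrs Mor" "src s = tgt u" "tgt s = tgt ?d" "s \<bullet> u = ?d"
    by (rule cokernel_factor[OF U, of ?d]) (use nf n(1-3) D fg in simp_all)
  have "t \<bullet> s = ident Mor (src s)"
  proof (rule H.epi_cancel[OF H.cokernel_epi[OF U]])
    show "(t \<bullet> s) \<bullet> u = ident Mor (src s) \<bullet> u"
      using t s n(1-3) tn U' D fg by simp
  qed (use t s n(1-3) D fg U' in simp_all)
  then have "src s \<in> S_objs C X"
    by (rule S_objs_retract[rotated 4]) (use t s n(1-3) D fg PO in simp_all)
  then have "(f, u) \<in> E_cw C X"
    using u s(2) f by (simp add: E_cw_iff)
  then show ?thesis by (rule that)
qed

theorem E_cw_exact: "quillen_exact_category (S_cat C X) (E_cw C X)"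
proof (intro quillen_exact_category.intro quillen_exact_category_axioms.intro S_cat_additive)
  interpret H: additive_category Mor by (rule mor_additive)
  have SX: "S_objs C X \<subseteq> objs Mor" using S_objsD(2) by (auto simp: mor_cat_simps)
  note [simp] = S_cat_def
  {
    fix i p i' p' a b c
    assume E: "(i, p) \<in> E_cw C X" and i': "i' \<in> arrs (S_cat C X)" and p': "p' \<in> arrs (S_cat C X)"
      and ip': "tgt i' = src p'"
      and iso: "is_isom (S_cat C X) a" "is_isom (S_cat C X) b" "is_isom (S_cat C X) c"
      and a: "a \<in> homs (S_cat C X) (src i) (src i')" and b: "b \<in> homs (S_cat C X) (tgt i) (tgt i')"
      and c: "c \<in> homs (S_cat C X) (tgt p) (tgt p')"
      and eq: "b \<cdot>\<^bsub>S_cat C X\<^esub> i = i' \<cdot>\<^bsub>S_cat C X\<^esub> a" "c \<cdot>\<^bsub>S_cat C X\<^esub> p = p' \<cdot>\<^bsub>S_cat C X\<^esub> b"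
    note S = degreewise_splitD[OF E[unfolded E_cw_iff, THEN conjunct1]]
    have A: "a \<in> arrs Mor" "src a = src i" "tgt a = src i'"
      and B: "b \<in> arrs Mor" "src b = tgt i" "tgt b = tgt i'"
      and C: "c \<in> arrs Mor" "src c = tgt p" "tgt c = tgt p'"
      and I: "i' \<in> arrs Mor" and P: "p' \<in> arrs Mor"
      using a b c i' p' by (simp_all add: homs_iff)
    note iso' = iso[unfolded S_cat_def, THEN full_subcat_isom]
    note Ca = mor_isom_components[OF iso'(1)] and Cb = mor_isom_components[OF iso'(2)]
      and Cc = mor_isom_components[OF iso'(3)]
    have eqs: "comp1 b \<cdot> comp1 i = comp1 i' \<cdot> comp1 a" "comp2 b \<cdot> comp2 i = comp2 i' \<cdot> comp2 a"
      "comp1 c \<cdot> comp1 p = comp1 p' \<cdot> comp1 b" "comp2 c \<cdot> comp2 p = comp2 p' \<cdot> comp2 b"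
      using eq by (simp_all add: mor_cat_simps)
    note N = mor_arrD[OF S(1)] mor_arrD[OF S(2)] mor_arrD[OF I] mor_arrD[OF P]
      mor_arrD[OF A(1)] mor_arrD[OF B(1)] mor_arrD[OF C(1)]
    have "split_exact C (comp1 i') (comp1 p')"
      by (rule split_exact_iso[OF S(4) Ca(1) Cb(1) Cc(1)])
        (use N A(2,3) B(2,3) C(2,3) ip' eqs in \<open>simp_all del: cmp_assoc_arr\<close>)
    moreover have "split_exact C (comp2 i') (comp2 p')"
      by (rule split_exact_iso[OF S(5) Ca(2) Cb(2) Cc(2)])
        (use N A(2,3) B(2,3) C(2,3) ip' eqs in \<open>simp_all del: cmp_assoc_arr\<close>)
    ultimately show "(i', p') \<in> E_cw C X"
      using I P ip' i' p' by (simp add: E_cw_iff degreewise_split_def)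
  next
    fix i p assume "split_exact (S_cat C X) i p"
    then obtain j r where b: "is_biproduct Mor (src i) (tgt p) (tgt i) i j r p"
      and X: "src i \<in> S_objs C X" "tgt p \<in> S_objs C X" "tgt i \<in> S_objs C X"
      unfolding split_exact_def S_cat_def full_subcat_biproduct[OF SX] by (elim exE conjE)
    have "degreewise_split C i p"
      by (rule mor_split_degreewise) (use b in \<open>auto simp: split_exact_def\<close>)
    then show "(i, p) \<in> E_cw C X" using X by (simp add: E_cw_iff)
  next
    fix i p assume E: "(i, p) \<in> E_cw C X"
    note S = degreewise_splitD[OF E[unfolded E_cw_iff, THEN conjunct1]]
    show "short_exact (S_cat C X) i p"
      using degreewise_split_short_exact[of i p] E S(3)
      by (simp add: E_cw_iff short_exact_def full_subcat_kernel full_subcat_cokernel)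
  next
    fix i p j q assume E: "(i, p) \<in> E_cw C X" "(j, q) \<in> E_cw C X" and pq: "tgt p = src q"
    note S = degreewise_splitD[OF E(1)[unfolded E_cw_iff, THEN conjunct1]]
    note T = degreewise_splitD[OF E(2)[unfolded E_cw_iff, THEN conjunct1]]
    note P = mor_arrD[OF S(2)] and Q = mor_arrD[OF T(2)]
    have "split_epi C (comp1 q \<cdot> comp1 p)" "split_epi C (comp2 q \<cdot> comp2 p)"
      using split_epi_cmp[OF split_exactD(2)[OF S(4)] split_exactD(2)[OF T(4)]]
        split_epi_cmp[OF split_exactD(2)[OF S(5)] split_exactD(2)[OF T(5)]] P Q pq by simp_all
    then have se: "split_epi C (comp1 (q \<bullet> p))" "split_epi C (comp2 (q \<bullet> p))"
      by (simp_all add: mor_cat_simps)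
    have qp: "q \<bullet> p \<in> arrs Mor" "src (q \<bullet> p) \<in> S_objs C X"
      "tgt (q \<bullet> p) \<in> S_objs C X"
      using E S T pq by (simp_all add: E_cw_iff)
    obtain k where "(k, q \<bullet> p) \<in> E_cw C X"
      by (rule E_cwI_deflation[OF qp(1) se qp(2,3)])
    then show "\<exists>k. (k, q \<cdot>\<^bsub>S_cat C X\<^esub> p) \<in> E_cw C X" by auto
  next
    fix i p j q assume E: "(i, p) \<in> E_cw C X" "(j, q) \<in> E_cw C X" and ij: "tgt i = src j"
    show "\<exists>c. (j \<cdot>\<^bsub>S_cat C X\<^esub> i, c) \<in> E_cw C X"
      by (rule E_cw_mono_cmp[OF E ij[symmetric]]) auto
  next
    fix i p g assume E: "(i, p) \<in> E_cw C X" and g: "g \<in> arrs (S_cat C X)" "tgt g = tgt p"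
    have X: "src i \<in> S_objs C X" "tgt i \<in> S_objs C X" "tgt p \<in> S_objs C X"
      and d: "degreewise_split C i p" using E by (simp_all add: E_cw_iff)
    obtain p' g' k where pb: "is_pullback Mor p g p' g'" and k: "degreewise_split C k p'" "src k = src i"
      by (rule degreewise_split_pullback[OF d, of g]) (use g in simp_all)
    note D = is_pullbackD[OF pb]
    have tk: "src p' = tgt k" using degreewise_splitD(3)[OF k(1)] .
    have tp: "tgt p' \<in> S_objs C X" using D(8) g by simp
    have "tgt k \<in> S_objs C X" by (rule S_objs_extension[OF k(1)]) (use X k tp in simp_all)
    then have "(k, p') \<in> E_cw C X" "is_pullback (S_cat C X) p g p' g'"
      using k X tp tk g full_subcat_pullback[OF pb] degreewise_splitD(3)[OF d] by (simp_all add: E_cw_iff)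
    then show "\<exists>p' g' k. is_pullback (S_cat C X) p g p' g' \<and> (k, p') \<in> E_cw C X" by blast
  next
    fix i p g assume E: "(i, p) \<in> E_cw C X" and g: "g \<in> arrs (S_cat C X)" "src g = src i"
    have X: "src i \<in> S_objs C X" "tgt i \<in> S_objs C X" "tgt p \<in> S_objs C X"
      and d: "degreewise_split C i p" using E by (simp_all add: E_cw_iff)
    obtain i' g' c where po: "is_pushout Mor i g i' g'" and c: "degreewise_split C i' c" "tgt c = tgt p"
      by (rule degreewise_split_pushout[OF d, of g]) (use g in simp_all)
    note D = is_pushoutD[OF po]
    have si: "src i' \<in> S_objs C X" using D(8) g by simp
    have "tgt i' \<in> S_objs C X" by (rule S_objs_extension[OF c(1)]) (use X c si in simp_all)
    then have "(i', c) \<in> E_cw C X" "is_pushout (S_cat C X) i g i' g'"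
      using c X si g full_subcat_pushout[OF po] by (simp_all add: E_cw_iff)
    then show "\<exists>i' g' c. is_pushout (S_cat C X) i g i' g' \<and> (i', c) \<in> E_cw C X" by blast
  next
    fix k f g i assume k: "is_kernel (S_cat C X) k f" and g: "g \<in> arrs (S_cat C X)" "tgt g = src f"
      and E: "(i, f \<cdot>\<^bsub>S_cat C X\<^esub> g) \<in> E_cw C X"
    have f: "f \<in> arrs (S_cat C X)" using is_kernelD(2)[OF k] .
    have fg: "f \<in> arrs Mor" "g \<in> arrs Mor" using f g by simp_all
    have E': "(i, f \<bullet> g) \<in> E_cw C X" using E by simp
    note S = degreewise_splitD[OF E'[unfolded E_cw_iff, THEN conjunct1]]
    have "split_epi C (comp1 f \<cdot> comp1 g)" "split_epi C (comp2 f \<cdot> comp2 g)"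
      using split_exactD(2)[OF S(4)] split_exactD(2)[OF S(5)] by (simp_all add: mor_cat_simps)
    then have "split_epi C (comp1 f)" "split_epi C (comp2 f)"
      using split_epi_cancel[of "comp1 f" "comp1 g"] split_epi_cancel[of "comp2 f" "comp2 g"] mor_arrD[OF fg(1)] mor_arrD[OF fg(2)] g(2) by simp_all
    then obtain k' where "(k', f) \<in> E_cw C X"
      by (rule E_cwI_deflation[OF fg(1)]) (use f in simp_all)
    then show "\<exists>k'. (k', f) \<in> E_cw C X" by blast
  next
    fix q f g p assume q: "is_cokernel (S_cat C X) q f" and g: "g \<in> arrs (S_cat C X)" "src g = tgt f"
      and E: "(g \<cdot>\<^bsub>S_cat C X\<^esub> f, p) \<in> E_cw C X"
    have f: "f \<in> arrs (S_cat C X)" using is_cokernelD(2)[OF q] .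
    have E': "(g \<bullet> f, p) \<in> E_cw C X" using E by simp
    show "\<exists>q'. (f, q') \<in> E_cw C X"
      by (rule E_cw_mono_cancel[OF _ _ g(2) _ _ E']) (use f g in auto)
  }
qed

end


section \<open>Constructions with finitely generated modules\<close>

lemma rmod_smult_zero:
  assumes M: "right_module R M" and a: "a \<in> carrier R"
  shows "a \<odot>\<^bsub>M\<^esub> \<zero>\<^bsub>M\<^esub> = \<zero>\<^bsub>M\<^esub>"
proof -
  interpret M: right_module R M by (rule M)
  have "restrict (\<lambda>x. a \<odot>\<^bsub>M\<^esub> x) (carrier M) \<in> hom (add_monoid M) (add_monoid M)"
    using a by (auto simp: hom_def M.smult_closed M.smult_r_distr)
  from group_hom.hom_one[OF group_hom.intro[OF M.M.a_group M.M.a_group group_hom_axioms.intro[OF this]]]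
  show ?thesis by simp
qed

lemma rmod_homD:
  assumes "h \<in> rmod_hom R M N" "x \<in> carrier M"
  shows "h x \<in> carrier N"
    and "y \<in> carrier M \<Longrightarrow> h (x \<oplus>\<^bsub>M\<^esub> y) = h x \<oplus>\<^bsub>N\<^esub> h y"
    and "a \<in> carrier R \<Longrightarrow> h (a \<odot>\<^bsub>M\<^esub> x) = a \<odot>\<^bsub>N\<^esub> h x"
  using assms by (auto simp: rmod_hom_def)

lemma rmod_homI:
  assumes "\<And>x. x \<in> carrier M \<Longrightarrow> h x \<in> carrier N"
    "\<And>x y. \<lbrakk>x \<in> carrier M; y \<in> carrier M\<rbrakk> \<Longrightarrow> h (x \<oplus>\<^bsub>M\<^esub> y) = h x \<oplus>\<^bsub>N\<^esub> h y"
    "\<And>a x. \<lbrakk>a \<in> carrier R; x \<in> carrier M\<rbrakk> \<Longrightarrow> h (a \<odot>\<^bsub>M\<^esub> x) = a \<odot>\<^bsub>N\<^esub> h x"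
    and M: "right_module R M"
  shows "restrict h (carrier M) \<in> rmod_hom R M N"
proof -
  interpret right_module R M by (rule M)
  show ?thesis using assms(1-3) by (auto simp: rmod_hom_def smult_closed)
qed

lemma rmod_hom_zero:
  assumes "right_module R M" "right_module R N" "h \<in> rmod_hom R M N"
  shows "h \<zero>\<^bsub>M\<^esub> = \<zero>\<^bsub>N\<^esub>"
proof -
  interpret M: right_module R M by (rule assms)
  interpret N: right_module R N by (rule assms)
  have "h \<zero>\<^bsub>M\<^esub> \<oplus>\<^bsub>N\<^esub> h \<zero>\<^bsub>M\<^esub> = h \<zero>\<^bsub>M\<^esub>"
    using rmod_homD(2)[OF assms(3), of "\<zero>\<^bsub>M\<^esub>" "\<zero>\<^bsub>M\<^esub>"] by simp
  then show ?thesis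
    using rmod_homD(1)[OF assms(3), of "\<zero>\<^bsub>M\<^esub>"] N.M.add.l_cancel_one' by (metis M.M.zero_closed)
qed

lemma rmod_hom_minus:
  assumes M: "right_module R M" and N: "right_module R N" and h: "h \<in> rmod_hom R M N"
    and xy: "x \<in> carrier M" "y \<in> carrier M"
  shows "h (x \<ominus>\<^bsub>M\<^esub> y) = h x \<ominus>\<^bsub>N\<^esub> h y"
proof -
  interpret M: right_module R M by (rule M)
  interpret N: right_module R N by (rule N)
  note hD = rmod_homD[OF h]
  have "h (\<ominus>\<^bsub>M\<^esub> y) \<oplus>\<^bsub>N\<^esub> h y = h (\<ominus>\<^bsub>M\<^esub> y \<oplus>\<^bsub>M\<^esub> y)" using hD(2) xy by simp
  also have "\<dots> = \<zero>\<^bsub>N\<^esub>" using rmod_hom_zero[OF M N h] xy by (simp add: M.M.l_neg)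
  finally have "\<ominus>\<^bsub>N\<^esub> h y = h (\<ominus>\<^bsub>M\<^esub> y)"
    using hD(1) xy by (intro N.M.minus_equality) simp_all
  then show ?thesis using hD(2)[of x "\<ominus>\<^bsub>M\<^esub> y"] xy by (simp add: a_minus_def)
qed

lemma rmod_minus_eq_zero:
  assumes "right_module R M" "x \<in> carrier M" "y \<in> carrier M"
  shows "x \<ominus>\<^bsub>M\<^esub> y = \<zero>\<^bsub>M\<^esub> \<longleftrightarrow> x = y"
proof -
  interpret M: right_module R M by (rule assms)
  show ?thesis using assms M.M.minus_equality[of x "\<ominus>\<^bsub>M\<^esub> y"]
    by (auto simp: a_minus_def M.M.r_neg)
qed

lemma rmod_hom_inj:
  assumes M: "right_module R M" and N: "right_module R N" and h: "h \<in> rmod_hom R M N"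
    and z: "\<And>x. \<lbrakk>x \<in> carrier M; h x = \<zero>\<^bsub>N\<^esub>\<rbrakk> \<Longrightarrow> x = \<zero>\<^bsub>M\<^esub>"
  shows "inj_on h (carrier M)"
proof (rule inj_onI)
  fix x y assume xy: "x \<in> carrier M" "y \<in> carrier M" "h x = h y"
  interpret M: right_module R M by (rule M)
  have "h (x \<ominus>\<^bsub>M\<^esub> y) = \<zero>\<^bsub>N\<^esub>"
    using rmod_hom_minus[OF M N h xy(1,2)] rmod_minus_eq_zero[OF N] rmod_homD(1)[OF h] xy by simp
  then show "x = y" using z[of "x \<ominus>\<^bsub>M\<^esub> y"] rmod_minus_eq_zero[OF M] xy by simp
qed

text \<open>
  Finite generation of images and products is proved by pulling a submodule that contains the
  proposed generators back to a module whose generators are known.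
\<close>

lemma preimage_submodule:
  assumes M: "right_module R M" and N: "right_module R N" and h: "h \<in> rmod_hom R M N"
    and T: "submodule T R N"
  shows "submodule {x \<in> carrier M. h x \<in> T} R M"
proof -
  interpret M: right_module R M by (rule M)
  interpret N: right_module R N by (rule N)
  interpret T: submodule T R N by (rule T)
  show ?thesis
  proof (intro submodule.intro submodule_axioms.intro M.M.add.subgroupI)
    show "{x \<in> carrier M. h x \<in> T} \<noteq> {}"
      using rmod_hom_zero[OF M N h] T.one_closed by auto
  next
    fix x assume x: "x \<in> {x \<in> carrier M. h x \<in> T}"
    have "h (\<zero>\<^bsub>M\<^esub> \<ominus>\<^bsub>M\<^esub> x) = \<zero>\<^bsub>N\<^esub> \<ominus>\<^bsub>N\<^esub> h x"
      using rmod_hom_minus[OF M N h] rmod_hom_zero[OF M N h] x by simp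
    then have "h (\<ominus>\<^bsub>M\<^esub> x) = \<ominus>\<^bsub>N\<^esub> h x"
      using x rmod_homD(1)[OF h] by (simp add: a_minus_def)
    moreover have "\<ominus>\<^bsub>N\<^esub> h x \<in> T" using T.m_inv_closed x by (simp add: a_inv_def)
    ultimately show "\<ominus>\<^bsub>M\<^esub> x \<in> {x \<in> carrier M. h x \<in> T}" using x by simp
  next
    fix x y assume "x \<in> {x \<in> carrier M. h x \<in> T}" "y \<in> {x \<in> carrier M. h x \<in> T}"
    then show "x \<oplus>\<^bsub>M\<^esub> y \<in> {x \<in> carrier M. h x \<in> T}"
      using T.m_closed[of "h x" "h y"] rmod_homD(2)[OF h] by simp
  next
    fix a x assume "a \<in> carrier R" "x \<in> {x \<in> carrier M. h x \<in> T}"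
    then show "a \<odot>\<^bsub>M\<^esub> x \<in> {x \<in> carrier M. h x \<in> T}"
      using T.smult_closed[of a "h x"] rmod_homD(3)[OF h] M.smult_closed by simp
  qed auto
qed

lemma fin_gen_image:
  assumes M: "right_module R M" "fin_gen R M" and N: "right_module R N"
    and h: "h \<in> rmod_hom R M N" and surj: "h ` carrier M = carrier N"
  shows "fin_gen R N"
proof -
  obtain S where S: "finite S" "S \<subseteq> carrier M"
    and gen: "\<forall>T. submodule T R M \<and> S \<subseteq> T \<longrightarrow> T = carrier M"
    using M(2) unfolding fin_gen_def by (elim exE conjE)
  have "T = carrier N" if T: "submodule T R N" "h ` S \<subseteq> T" for T
  proof -
    have e: "{x \<in> carrier M. h x \<in> T} = carrier M"
      using gen preimage_submodule[OF M(1) N h T(1)] S T(2) by blast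
    have "carrier N \<subseteq> T" unfolding surj[symmetric] using equalityD2[OF e] by blast
    moreover interpret N: right_module R N by (rule N)
    interpret T: submodule T R N by (rule T)
    have "T \<subseteq> carrier N" using T.subset by simp
    ultimately show ?thesis by blast
  qed
  then show ?thesis
    unfolding fin_gen_def using S surj by (intro exI[of _ "h ` S"]) auto
qed

text \<open>
  Structure is transported along a map whose fibres form a congruence. Taking representatives of
  classes for \<open>g\<close>, this yields quotient modules on the type of the original elements.
\<close>

lemma image_module:
  fixes M :: "('a, 'b) module" and g :: "'b \<Rightarrow> 'c"
  assumes M: "right_module R M" "fin_gen R M"
    and add: "\<And>x x' y y'. \<lbrakk>x \<in> carrier M; x' \<in> carrier M; y \<in> carrier M; y' \<in> carrier M;
      g x = g x'; g y = g y'\<rbrakk> \<Longrightarrow> g (x \<oplus>\<^bsub>M\<^esub> y) = g (x' \<oplus>\<^bsub>M\<^esub> y')"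
    and smult: "\<And>a x x'. \<lbrakk>a \<in> carrier R; x \<in> carrier M; x' \<in> carrier M; g x = g x'\<rbrakk>
      \<Longrightarrow> g (a \<odot>\<^bsub>M\<^esub> x) = g (a \<odot>\<^bsub>M\<^esub> x')"
  obtains N :: "('a, 'c) module" where "right_module R N" "fin_gen R N"
    "carrier N = g ` carrier M" "restrict g (carrier M) \<in> rmod_hom R M N"
proof -
  interpret right_module R M by (rule M)
  define k where "k = inv_into (carrier M) g"
  have k: "k (g x) \<in> carrier M" "g (k (g x)) = g x" if "x \<in> carrier M" for x
    using inv_into_into[of "g x" g "carrier M"] f_inv_into_f[of "g x" g "carrier M"] that
    by (simp_all add: k_def)
  define N :: "('a, 'c) module" where "N = \<lparr>carrier = g ` carrier M, mult = undefined,
    one = undefined, zero = g \<zero>\<^bsub>M\<^esub>, add = (\<lambda>x y. g (k x \<oplus>\<^bsub>M\<^esub> k y)),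
    smult = (\<lambda>a x. g (a \<odot>\<^bsub>M\<^esub> k x))\<rparr>"
  have carr: "carrier N = g ` carrier M" and zero: "\<zero>\<^bsub>N\<^esub> = g \<zero>\<^bsub>M\<^esub>"
    by (simp_all add: N_def)
  have N_add: "g x \<oplus>\<^bsub>N\<^esub> g y = g (x \<oplus>\<^bsub>M\<^esub> y)" if "x \<in> carrier M" "y \<in> carrier M" for x y
    using add[of "k (g x)" x "k (g y)" y] k that by (simp add: N_def)
  have N_smult: "a \<odot>\<^bsub>N\<^esub> g x = g (a \<odot>\<^bsub>M\<^esub> x)" if "a \<in> carrier R" "x \<in> carrier M" for a x
    using smult[of a "k (g x)" x] k that by (simp add: N_def)
  have "abelian_group N"
  proof (rule abelian_groupI)
    fix x assume "x \<in> carrier N"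
    then obtain u where u: "x = g u" "u \<in> carrier M" by (auto simp: carr)
    then have "g (\<ominus>\<^bsub>M\<^esub> u) \<oplus>\<^bsub>N\<^esub> x = \<zero>\<^bsub>N\<^esub>" by (simp add: N_add zero M.l_neg)
    then show "\<exists>y \<in> carrier N. y \<oplus>\<^bsub>N\<^esub> x = \<zero>\<^bsub>N\<^esub>"
      using u by (intro bexI[of _ "g (\<ominus>\<^bsub>M\<^esub> u)"]) (auto simp: carr)
  qed (auto simp: carr zero N_add M.a_ac)
  then have N: "right_module R N"
    by (intro right_module.intro right_module_axioms.intro)
      (auto simp: carr N_add N_smult smult_closed smult_l_distr smult_r_distr smult_assoc smult_one
        R.ring_axioms)
  have h: "restrict g (carrier M) \<in> rmod_hom R M N"
    by (rule rmod_homI[OF _ _ _ M(1)]) (auto simp: carr N_add N_smult)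
  have "fin_gen R N" by (rule fin_gen_image[OF M N h]) (auto simp: carr)
  with N h carr show ?thesis by (intro that)
qed

text \<open>
  The submodule \<open>x R\<close> is generated by one element, so it serves as a test object in the category of
  finitely generated modules.
\<close>

lemma cyclic_submodule:
  fixes M :: "('a, 'm) module"
  assumes M: "right_module R M" and x: "x \<in> carrier M"
  obtains T :: "('a, 'm) module" where "right_module R T" "fin_gen R T" "x \<in> carrier T"
    "carrier T = (\<lambda>a. a \<odot>\<^bsub>M\<^esub> x) ` carrier R" "(\<lambda>y \<in> carrier T. y) \<in> rmod_hom R T M"
proof -
  interpret right_module R M by (rule M)
  define T :: "('a, 'm) module" where "T = M\<lparr>carrier := (\<lambda>a. a \<odot>\<^bsub>M\<^esub> x) ` carrier R\<rparr>"
  have carr: "carrier T = (\<lambda>a. a \<odot>\<^bsub>M\<^esub> x) ` carrier R" and ops: "\<zero>\<^bsub>T\<^esub> = \<zero>\<^bsub>M\<^esub>"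
    "\<And>y z. y \<oplus>\<^bsub>T\<^esub> z = y \<oplus>\<^bsub>M\<^esub> z" "\<And>a y. a \<odot>\<^bsub>T\<^esub> y = a \<odot>\<^bsub>M\<^esub> y"
    by (simp_all add: T_def)
  have sub: "y \<in> carrier M" if "y \<in> carrier T" for y
    using that x by (auto simp: carr smult_closed)
  have z: "\<zero>\<^bsub>R\<^esub> \<odot>\<^bsub>M\<^esub> x = \<zero>\<^bsub>M\<^esub>"
  proof -
    have "\<zero>\<^bsub>R\<^esub> \<odot>\<^bsub>M\<^esub> x \<oplus>\<^bsub>M\<^esub> \<zero>\<^bsub>R\<^esub> \<odot>\<^bsub>M\<^esub> x = \<zero>\<^bsub>R\<^esub> \<odot>\<^bsub>M\<^esub> x"
      using smult_l_distr[of "\<zero>\<^bsub>R\<^esub>" "\<zero>\<^bsub>R\<^esub>" x] x by simp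
    then show ?thesis
      using smult_closed[of "\<zero>\<^bsub>R\<^esub>" x] x M.add.l_cancel_one' by (metis R.zero_closed)
  qed
  have add: "y \<oplus>\<^bsub>M\<^esub> y' \<in> carrier T" if "y \<in> carrier T" "y' \<in> carrier T" for y y'
    using that x by (auto simp: carr smult_l_distr[symmetric])
  have smult: "b \<odot>\<^bsub>M\<^esub> y \<in> carrier T" if "y \<in> carrier T" "b \<in> carrier R" for y b
    using that x by (auto simp: carr smult_assoc[symmetric])
  have "abelian_group T"
  proof (rule abelian_groupI)
    show "\<zero>\<^bsub>T\<^esub> \<in> carrier T" unfolding ops(1) carr z[symmetric] by (rule imageI) simp
  next
    fix y assume "y \<in> carrier T"
    then obtain a where a: "y = a \<odot>\<^bsub>M\<^esub> x" "a \<in> carrier R" by (auto simp: carr)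
    have "(\<ominus>\<^bsub>R\<^esub> a) \<odot>\<^bsub>M\<^esub> x \<oplus>\<^bsub>M\<^esub> a \<odot>\<^bsub>M\<^esub> x = \<zero>\<^bsub>M\<^esub>"
      using smult_l_distr[of "\<ominus>\<^bsub>R\<^esub> a" a x] a x z by (simp add: R.l_neg)
    then show "\<exists>y' \<in> carrier T. y' \<oplus>\<^bsub>T\<^esub> y = \<zero>\<^bsub>T\<^esub>"
      unfolding ops a(1) by (intro bexI[of _ "(\<ominus>\<^bsub>R\<^esub> a) \<odot>\<^bsub>M\<^esub> x"]) (use a in \<open>auto simp: carr\<close>)
  qed (auto simp: ops add sub M.a_ac)
  then have T: "right_module R T"
    by (intro right_module.intro right_module_axioms.intro)
      (auto simp: ops smult sub smult_l_distr smult_r_distr smult_assoc smult_one R.ring_axioms)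
  have xT: "x \<in> carrier T" using smult_one[OF x] unfolding carr by (metis R.one_closed imageI)
  have "fin_gen R T"
    unfolding fin_gen_def
  proof (intro exI[of _ "{x}"] conjI allI impI)
    fix N assume N: "submodule N R T \<and> {x} \<subseteq> N"
    interpret T: right_module R T by (rule T)
    interpret N: submodule N R T using N by simp
    have "N \<subseteq> carrier T" using N.subset by simp
    moreover have "carrier T \<subseteq> N" using N N.smult_closed unfolding carr ops by auto
    ultimately show "N = carrier T" by blast
  qed (use xT in auto)
  moreover have "(\<lambda>y \<in> carrier T. y) \<in> rmod_hom R T M"
    by (rule rmod_homI[OF _ _ _ T]) (auto simp: ops sub)
  ultimately show ?thesis using that T xT carr by blast
qed

lemma product_module:
  fixes M :: "('a, 'm) module" and N :: "('a, 'n) module"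
  assumes M: "right_module R M" "fin_gen R M" and N: "right_module R N" "fin_gen R N"
  obtains P :: "('a, 'm \<times> 'n) module" where "right_module R P" "fin_gen R P"
    "carrier P = carrier M \<times> carrier N" "\<zero>\<^bsub>P\<^esub> = (\<zero>\<^bsub>M\<^esub>, \<zero>\<^bsub>N\<^esub>)"
    "\<And>x y. x \<oplus>\<^bsub>P\<^esub> y = (fst x \<oplus>\<^bsub>M\<^esub> fst y, snd x \<oplus>\<^bsub>N\<^esub> snd y)"
    "\<And>a x. a \<odot>\<^bsub>P\<^esub> x = (a \<odot>\<^bsub>M\<^esub> fst x, a \<odot>\<^bsub>N\<^esub> snd x)"
proof -
  interpret M: right_module R M by (rule M)
  interpret N: right_module R N by (rule N)
  define P :: "('a, 'm \<times> 'n) module" where "P = \<lparr>carrier = carrier M \<times> carrier N, mult = undefined,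
    one = undefined, zero = (\<zero>\<^bsub>M\<^esub>, \<zero>\<^bsub>N\<^esub>),
    add = (\<lambda>x y. (fst x \<oplus>\<^bsub>M\<^esub> fst y, snd x \<oplus>\<^bsub>N\<^esub> snd y)),
    smult = (\<lambda>a x. (a \<odot>\<^bsub>M\<^esub> fst x, a \<odot>\<^bsub>N\<^esub> snd x))\<rparr>"
  have ops: "carrier P = carrier M \<times> carrier N" "\<zero>\<^bsub>P\<^esub> = (\<zero>\<^bsub>M\<^esub>, \<zero>\<^bsub>N\<^esub>)"
    "\<And>x y. x \<oplus>\<^bsub>P\<^esub> y = (fst x \<oplus>\<^bsub>M\<^esub> fst y, snd x \<oplus>\<^bsub>N\<^esub> snd y)"
    "\<And>a x. a \<odot>\<^bsub>P\<^esub> x = (a \<odot>\<^bsub>M\<^esub> fst x, a \<odot>\<^bsub>N\<^esub> snd x)"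
    by (simp_all add: P_def)
  have "abelian_group P"
  proof (rule abelian_groupI)
    fix x assume "x \<in> carrier P"
    then show "\<exists>y \<in> carrier P. y \<oplus>\<^bsub>P\<^esub> x = \<zero>\<^bsub>P\<^esub>"
      by (intro bexI[of _ "(\<ominus>\<^bsub>M\<^esub> fst x, \<ominus>\<^bsub>N\<^esub> snd x)"]) (auto simp: ops M.M.l_neg N.M.l_neg)
  qed (auto simp: ops M.M.a_ac N.M.a_ac)
  then have P: "right_module R P"
    by (intro right_module.intro right_module_axioms.intro)
      (auto simp: ops M.smult_closed N.smult_closed M.smult_l_distr N.smult_l_distr
        M.smult_r_distr N.smult_r_distr M.smult_assoc N.smult_assoc M.smult_one N.smult_one
        M.R.ring_axioms)
  interpret P: right_module R P by (rule P)
  note aM = rmod_smult_zero[OF M(1)] and aN = rmod_smult_zero[OF N(1)]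
  have i: "restrict (\<lambda>x. (x, \<zero>\<^bsub>N\<^esub>)) (carrier M) \<in> rmod_hom R M P"
    by (rule rmod_homI[OF _ _ _ M(1)]) (auto simp: ops aN)
  have j: "restrict (\<lambda>y. (\<zero>\<^bsub>M\<^esub>, y)) (carrier N) \<in> rmod_hom R N P"
    by (rule rmod_homI[OF _ _ _ N(1)]) (auto simp: ops aM)
  obtain S where S: "finite S" "S \<subseteq> carrier M"
    and genS: "\<forall>T. submodule T R M \<and> S \<subseteq> T \<longrightarrow> T = carrier M"
    using M(2) unfolding fin_gen_def by (elim exE conjE)
  obtain S' where S': "finite S'" "S' \<subseteq> carrier N"
    and genS': "\<forall>T. submodule T R N \<and> S' \<subseteq> T \<longrightarrow> T = carrier N"
    using N(2) unfolding fin_gen_def by (elim exE conjE)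
  have "fin_gen R P"
    unfolding fin_gen_def
  proof (intro exI[of _ "(\<lambda>x. (x, \<zero>\<^bsub>N\<^esub>)) ` S \<union> (\<lambda>y. (\<zero>\<^bsub>M\<^esub>, y)) ` S'"] conjI allI impI)
    fix T assume T: "submodule T R P \<and> (\<lambda>x. (x, \<zero>\<^bsub>N\<^esub>)) ` S \<union> (\<lambda>y. (\<zero>\<^bsub>M\<^esub>, y)) ` S' \<subseteq> T"
    interpret T: submodule T R P using T by simp
    have e: "{x \<in> carrier M. restrict (\<lambda>x. (x, \<zero>\<^bsub>N\<^esub>)) (carrier M) x \<in> T} = carrier M"
      by (rule genS[rule_format], intro conjI preimage_submodule[OF M(1) P i])
        (use T S in auto)
    have 1: "(x, \<zero>\<^bsub>N\<^esub>) \<in> T" if "x \<in> carrier M" for x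
      using subsetD[OF equalityD2[OF e] that] that by simp
    have e': "{y \<in> carrier N. restrict (\<lambda>y. (\<zero>\<^bsub>M\<^esub>, y)) (carrier N) y \<in> T} = carrier N"
      by (rule genS'[rule_format], intro conjI preimage_submodule[OF N(1) P j])
        (use T S' in auto)
    have 2: "(\<zero>\<^bsub>M\<^esub>, y) \<in> T" if "y \<in> carrier N" for y
      using subsetD[OF equalityD2[OF e'] that] that by simp
    have "(x, y) \<in> T" if "x \<in> carrier M" "y \<in> carrier N" for x y
      using T.m_closed[OF 1[OF that(1)] 2[OF that(2)]] that by (simp add: ops)
    then have "carrier P \<subseteq> T" by (auto simp: ops(1))
    moreover have "T \<subseteq> carrier P" using T.subset by simp
    ultimately show "T = carrier P" by blast
  qed (use S S' in \<open>auto simp: ops\<close>)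
  with P show ?thesis using that ops by blast
qed


section \<open>The additive category of finitely generated modules\<close>

lemma mod_cat_simps [simp]:
  "objs (mod_cat R) = {M. right_module R M \<and> fin_gen R M}"
  "ident (mod_cat R) M = Arrow M M (\<lambda>x \<in> carrier M. x)"
  "g \<cdot>\<^bsub>mod_cat R\<^esub> f = Arrow (src f) (tgt g) (compose (carrier (src f)) (fn g) (fn f))"
  "f \<uplus>\<^bsub>mod_cat R\<^esub> g = Arrow (src f) (tgt f) (\<lambda>x \<in> carrier (src f). fn f x \<oplus>\<^bsub>tgt f\<^esub> fn g x)"
  "zero_arr (mod_cat R) M N = Arrow M N (\<lambda>x \<in> carrier M. \<zero>\<^bsub>N\<^esub>)"
  by (simp_all add: mod_cat_def)

lemma mod_arr_iff:
  "f \<in> arrs (mod_cat R) \<longleftrightarrow> right_module R (src f) \<and> fin_gen R (src f) \<and>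
    right_module R (tgt f) \<and> fin_gen R (tgt f) \<and> fn f \<in> rmod_hom R (src f) (tgt f)"
  by (simp add: mod_cat_def)

lemma mod_arrD:
  assumes "f \<in> arrs (mod_cat R)"
  shows "right_module R (src f)" "fin_gen R (src f)" "right_module R (tgt f)" "fin_gen R (tgt f)"
    "fn f \<in> rmod_hom R (src f) (tgt f)"
  using assms by (simp_all add: mod_arr_iff)

lemma mod_arr_closed: "\<lbrakk>f \<in> arrs (mod_cat R); x \<in> carrier (src f)\<rbrakk> \<Longrightarrow> fn f x \<in> carrier (tgt f)"
  using rmod_homD(1)[OF mod_arrD(5)] .

lemma rmod_hom_eqI:
  "\<lbrakk>h \<in> rmod_hom R M N; h' \<in> rmod_hom R M N; \<And>x. x \<in> carrier M \<Longrightarrow> h x = h' x\<rbrakk> \<Longrightarrow> h = h'"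
  unfolding rmod_hom_def by (auto intro: PiE_ext)

lemma mod_arr_eqI:
  assumes "f \<in> arrs (mod_cat R)" "g \<in> arrs (mod_cat R)" "src f = src g" "tgt f = tgt g"
    and "\<And>x. x \<in> carrier (src g) \<Longrightarrow> fn f x = fn g x"
  shows "f = g"
proof (rule arrow.expand, intro conjI assms)
  show "fn f = fn g"
    by (rule rmod_hom_eqI[OF _ mod_arrD(5)[OF assms(2)] assms(5)])
      (use mod_arrD(5)[OF assms(1)] assms(3,4) in simp_all)
qed

lemma rmod_hom_compose:
  assumes "right_module R L" "f \<in> rmod_hom R L M" "g \<in> rmod_hom R M N"
  shows "compose (carrier L) g f \<in> rmod_hom R L N"
proof -
  have "restrict (\<lambda>x. g (f x)) (carrier L) \<in> rmod_hom R L N"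
    by (rule rmod_homI[OF _ _ _ assms(1)])
      (simp_all add: rmod_homD[OF assms(2)] rmod_homD[OF assms(3)])
  then show ?thesis by (simp add: compose_def)
qed

lemma rmod_hom_zero_map:
  assumes M: "right_module R M" and N: "right_module R N"
  shows "(\<lambda>x \<in> carrier M. \<zero>\<^bsub>N\<^esub>) \<in> rmod_hom R M N"
proof -
  interpret N: right_module R N by (rule N)
  show ?thesis
    by (rule rmod_homI[OF _ _ _ M]) (simp_all add: rmod_smult_zero[OF N])
qed

lemma rmod_hom_plus:
  assumes M: "right_module R M" and N: "right_module R N"
    and f: "f \<in> rmod_hom R M N" and g: "g \<in> rmod_hom R M N"
  shows "(\<lambda>x \<in> carrier M. f x \<oplus>\<^bsub>N\<^esub> g x) \<in> rmod_hom R M N"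
proof -
  interpret M: right_module R M by (rule M)
  interpret N: right_module R N by (rule N)
  show ?thesis
    by (rule rmod_homI[OF _ _ _ M])
      (simp_all add: rmod_homD[OF f] rmod_homD[OF g] N.M.a_ac N.smult_r_distr)
qed

lemma rmod_smult_neg:
  assumes M: "right_module R M" and a: "a \<in> carrier R" "x \<in> carrier M"
  shows "a \<odot>\<^bsub>M\<^esub> (\<ominus>\<^bsub>M\<^esub> x) = \<ominus>\<^bsub>M\<^esub> (a \<odot>\<^bsub>M\<^esub> x)"
proof -
  interpret M: right_module R M by (rule M)
  have "a \<odot>\<^bsub>M\<^esub> (\<ominus>\<^bsub>M\<^esub> x) \<oplus>\<^bsub>M\<^esub> a \<odot>\<^bsub>M\<^esub> x = \<zero>\<^bsub>M\<^esub>"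
    using a by (simp add: M.smult_r_distr[symmetric] M.M.l_neg rmod_smult_zero[OF M])
  then show ?thesis
    using a by (intro M.M.minus_equality[symmetric]) (simp_all add: M.smult_closed)
qed

lemma rmod_hom_neg:
  assumes M: "right_module R M" and N: "right_module R N" and f: "f \<in> rmod_hom R M N"
  shows "(\<lambda>x \<in> carrier M. \<ominus>\<^bsub>N\<^esub> f x) \<in> rmod_hom R M N"
proof -
  interpret M: right_module R M by (rule M)
  interpret N: right_module R N by (rule N)
  show ?thesis
    by (rule rmod_homI[OF _ _ _ M])
      (simp_all add: rmod_homD[OF f] N.M.minus_add rmod_smult_neg[OF N])
qed

lemma mod_category: "category (mod_cat R)"
proof (intro category.intro)
  fix f g A B D
  assume "f \<in> homs (mod_cat R) A B" "g \<in> homs (mod_cat R) B D"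
  then show "g \<cdot>\<^bsub>mod_cat R\<^esub> f \<in> homs (mod_cat R) A D"
    by (auto simp: homs_iff mod_arr_iff intro: rmod_hom_compose)
next
  fix f g h A B D E
  assume "f \<in> homs (mod_cat R) A B" "g \<in> homs (mod_cat R) B D" "h \<in> homs (mod_cat R) D E"
  then show "h \<cdot>\<^bsub>mod_cat R\<^esub> g \<cdot>\<^bsub>mod_cat R\<^esub> f = h \<cdot>\<^bsub>mod_cat R\<^esub> (g \<cdot>\<^bsub>mod_cat R\<^esub> f)"
    using mod_arr_closed[of f R] by (auto simp: homs_iff compose_def fun_eq_iff)
next
  fix A assume "A \<in> objs (mod_cat R)"
  then show "ident (mod_cat R) A \<in> homs (mod_cat R) A A"
    by (auto simp: homs_iff mod_arr_iff intro!: rmod_homI)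
next
  fix f A B assume "f \<in> homs (mod_cat R) A B"
  then have f: "f \<in> arrs (mod_cat R)" "src f = A" "tgt f = B" by (simp_all add: homs_iff)
  have e: "fn f \<in> extensional (carrier A)" using mod_arrD(5)[OF f(1)] f(2) by (auto simp: rmod_hom_def PiE_def)
  have "fn f x = undefined" if "x \<notin> carrier A" for x using extensional_arb[OF e that] .
  then have "compose (carrier A) (fn f) (\<lambda>x \<in> carrier A. x) = fn f"
    by (auto simp: compose_def fun_eq_iff)
  then show "f \<cdot>\<^bsub>mod_cat R\<^esub> ident (mod_cat R) A = f"
    using f by (cases f) simp
  have "compose (carrier A) (\<lambda>x \<in> carrier B. x) (fn f) = fn f"
    using extensional_arb[OF e] mod_arr_closed[OF f(1)] f(2,3) by (auto simp: compose_def fun_eq_iff)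
  then show "ident (mod_cat R) B \<cdot>\<^bsub>mod_cat R\<^esub> f = f"
    using f by (cases f) simp
qed (simp_all add: mod_arr_iff)

lemma mod_hom_group:
  assumes A: "A \<in> objs (mod_cat R)" and B: "B \<in> objs (mod_cat R)"
  shows "comm_group \<lparr>carrier = homs (mod_cat R) A B, mult = plus_arr (mod_cat R),
    one = zero_arr (mod_cat R) A B\<rparr>"
proof (rule comm_groupI, unfold partial_object.simps monoid.simps)
  interpret A: right_module R A using A by simp
  interpret B: right_module R B using B by simp
  note AB = A.right_module_axioms B.right_module_axioms
  show "zero_arr (mod_cat R) A B \<in> homs (mod_cat R) A B"
    using A B by (simp add: homs_iff mod_arr_iff rmod_hom_zero_map)
  fix f assume "f \<in> homs (mod_cat R) A B"
  then have f: "f \<in> arrs (mod_cat R)" "src f = A" "tgt f = B" by (simp_all add: homs_iff)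
  note F = mod_arrD(5)[OF f(1), unfolded f(2,3)]
  note Fc = rmod_homD(1)[OF F]
  have e: "fn f x = undefined" if "x \<notin> carrier A" for x
    using F that by (auto simp: rmod_hom_def)
  show "zero_arr (mod_cat R) A B \<uplus>\<^bsub>mod_cat R\<^esub> f = f"
    using f Fc e by (cases f) (auto simp: fun_eq_iff)
  show "\<exists>n \<in> homs (mod_cat R) A B. n \<uplus>\<^bsub>mod_cat R\<^esub> f = zero_arr (mod_cat R) A B"
    using f A B Fc
    by (intro bexI[of _ "Arrow A B (\<lambda>x \<in> carrier A. \<ominus>\<^bsub>B\<^esub> fn f x)"])
      (auto simp: fun_eq_iff B.M.l_neg homs_iff mod_arr_iff rmod_hom_neg[OF AB F])
  fix g assume "g \<in> homs (mod_cat R) A B"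
  then have g: "g \<in> arrs (mod_cat R)" "src g = A" "tgt g = B" by (simp_all add: homs_iff)
  note G = mod_arrD(5)[OF g(1), unfolded g(2,3)]
  note Gc = rmod_homD(1)[OF G]
  show "f \<uplus>\<^bsub>mod_cat R\<^esub> g \<in> homs (mod_cat R) A B"
    using f A B by (simp add: homs_iff mod_arr_iff rmod_hom_plus[OF AB F G])
  show "f \<uplus>\<^bsub>mod_cat R\<^esub> g = g \<uplus>\<^bsub>mod_cat R\<^esub> f"
    using f g Fc Gc by (auto simp: fun_eq_iff B.M.a_comm)
  fix h assume "h \<in> homs (mod_cat R) A B"
  then have h: "h \<in> arrs (mod_cat R)" "src h = A" "tgt h = B" by (simp_all add: homs_iff)
  note Hc = rmod_homD(1)[OF mod_arrD(5)[OF h(1), unfolded h(2,3)]]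
  show "f \<uplus>\<^bsub>mod_cat R\<^esub> g \<uplus>\<^bsub>mod_cat R\<^esub> h = f \<uplus>\<^bsub>mod_cat R\<^esub> (g \<uplus>\<^bsub>mod_cat R\<^esub> h)"
    using f g h Fc Gc Hc by (auto simp: fun_eq_iff B.M.a_assoc)
qed

text \<open>
  The product lives on pairs of elements and is moved back to the type \<open>'m\<close> by
  \<open>fg_universe_copy\<close>; \<open>h\<close> and \<open>k\<close> are the transport maps.
\<close>

lemma mod_biproduct:
  fixes A D :: "('a, 'm) module"
  assumes U: "fg_universe R TYPE('m)" and A: "A \<in> objs (mod_cat R)" and D: "D \<in> objs (mod_cat R)"
  shows "\<exists>B i j r p. is_biproduct (mod_cat R) A D B i j r p"
proof -
  interpret A: right_module R A using A by simp
  interpret D: right_module R D using D by simp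
  have A': "right_module R A" "fin_gen R A" and D': "right_module R D" "fin_gen R D"
    using A D by simp_all
  obtain P :: "('a, 'm \<times> 'm) module" where P: "right_module R P" "fin_gen R P"
    and ops: "carrier P = carrier A \<times> carrier D" "\<zero>\<^bsub>P\<^esub> = (\<zero>\<^bsub>A\<^esub>, \<zero>\<^bsub>D\<^esub>)"
    "\<And>x y. x \<oplus>\<^bsub>P\<^esub> y = (fst x \<oplus>\<^bsub>A\<^esub> fst y, snd x \<oplus>\<^bsub>D\<^esub> snd y)"
    "\<And>a x. a \<odot>\<^bsub>P\<^esub> x = (a \<odot>\<^bsub>A\<^esub> fst x, a \<odot>\<^bsub>D\<^esub> snd x)"
    using product_module[OF A' D'] by blast
  obtain B :: "('a, 'm) module" and h where B: "right_module R B" "fin_gen R B"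
    and h: "h \<in> rmod_hom R P B" and bij: "bij_betw h (carrier P) (carrier B)"
    using fg_universe_copy[OF U P] by blast
  interpret B: right_module R B by (rule B)
  define k where "k = inv_into (carrier P) h"
  have hk: "h (k b) = b" "k b \<in> carrier A \<times> carrier D" if "b \<in> carrier B" for b
    using bij that bij_betw_inv_into_right[OF bij that] bij_betw_apply[OF bij_betw_inv_into[OF bij] that]
    by (simp_all add: k_def ops)
  have kh: "k (h u) = u" if "u \<in> carrier A \<times> carrier D" for u
    using bij_betw_inv_into_left[OF bij, of u] that by (simp add: k_def ops)
  note hD = rmod_homD[OF h, unfolded ops]
  have h0: "h (\<zero>\<^bsub>A\<^esub>, \<zero>\<^bsub>D\<^esub>) = \<zero>\<^bsub>B\<^esub>" using rmod_hom_zero[OF P(1) B(1) h] by (simp add: ops)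
  have k_add: "k (b \<oplus>\<^bsub>B\<^esub> b') = (fst (k b) \<oplus>\<^bsub>A\<^esub> fst (k b'), snd (k b) \<oplus>\<^bsub>D\<^esub> snd (k b'))"
    if "b \<in> carrier B" "b' \<in> carrier B" for b b'
  proof -
    have "k (b \<oplus>\<^bsub>B\<^esub> b') = k (h (k b) \<oplus>\<^bsub>B\<^esub> h (k b'))" using hk that by simp
    also have "\<dots> = k (h (fst (k b) \<oplus>\<^bsub>A\<^esub> fst (k b'), snd (k b) \<oplus>\<^bsub>D\<^esub> snd (k b')))"
      using hD(2)[of "k b" "k b'"] hk(2)[OF that(1)] hk(2)[OF that(2)] by simp
    also have "\<dots> = (fst (k b) \<oplus>\<^bsub>A\<^esub> fst (k b'), snd (k b) \<oplus>\<^bsub>D\<^esub> snd (k b'))"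
      using hk(2)[OF that(1)] hk(2)[OF that(2)] by (intro kh) (auto simp: mem_Times_iff)
    finally show ?thesis .
  qed
  have k_smult: "k (a \<odot>\<^bsub>B\<^esub> b) = (a \<odot>\<^bsub>A\<^esub> fst (k b), a \<odot>\<^bsub>D\<^esub> snd (k b))"
    if "a \<in> carrier R" "b \<in> carrier B" for a b
  proof -
    have "k (a \<odot>\<^bsub>B\<^esub> b) = k (a \<odot>\<^bsub>B\<^esub> h (k b))" using hk that by simp
    also have "\<dots> = k (h (a \<odot>\<^bsub>A\<^esub> fst (k b), a \<odot>\<^bsub>D\<^esub> snd (k b)))"
      using hD(3)[of "k b" a] hk(2)[OF that(2)] that(1) by simp
    also have "\<dots> = (a \<odot>\<^bsub>A\<^esub> fst (k b), a \<odot>\<^bsub>D\<^esub> snd (k b))"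
      using hk(2)[OF that(2)] that(1)
      by (intro kh) (auto simp: mem_Times_iff A.smult_closed D.smult_closed)
    finally show ?thesis .
  qed
  have k_mem: "fst (k b) \<in> carrier A" "snd (k b) \<in> carrier D" if "b \<in> carrier B" for b
    using hk(2)[OF that] by (auto simp: mem_Times_iff)
  have h_mem: "h (x, y) \<in> carrier B" if "x \<in> carrier A" "y \<in> carrier D" for x y
    using hD(1)[of "(x, y)"] that by simp
  have i: "(\<lambda>x \<in> carrier A. h (x, \<zero>\<^bsub>D\<^esub>)) \<in> rmod_hom R A B"
  proof (rule rmod_homI[OF _ _ _ A'(1)])
    fix x y assume "x \<in> carrier A" "y \<in> carrier A"
    then show "h (x \<oplus>\<^bsub>A\<^esub> y, \<zero>\<^bsub>D\<^esub>) = h (x, \<zero>\<^bsub>D\<^esub>) \<oplus>\<^bsub>B\<^esub> h (y, \<zero>\<^bsub>D\<^esub>)"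
      using hD(2)[of "(x, \<zero>\<^bsub>D\<^esub>)" "(y, \<zero>\<^bsub>D\<^esub>)"] by simp
  next
    fix a x assume "a \<in> carrier R" "x \<in> carrier A"
    then show "h (a \<odot>\<^bsub>A\<^esub> x, \<zero>\<^bsub>D\<^esub>) = a \<odot>\<^bsub>B\<^esub> h (x, \<zero>\<^bsub>D\<^esub>)"
      using hD(3)[of "(x, \<zero>\<^bsub>D\<^esub>)" a] by (simp add: rmod_smult_zero[OF D'(1)])
  qed (simp add: h_mem)
  have j: "(\<lambda>y \<in> carrier D. h (\<zero>\<^bsub>A\<^esub>, y)) \<in> rmod_hom R D B"
  proof (rule rmod_homI[OF _ _ _ D'(1)])
    fix x y assume "x \<in> carrier D" "y \<in> carrier D"
    then show "h (\<zero>\<^bsub>A\<^esub>, x \<oplus>\<^bsub>D\<^esub> y) = h (\<zero>\<^bsub>A\<^esub>, x) \<oplus>\<^bsub>B\<^esub> h (\<zero>\<^bsub>A\<^esub>, y)"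
      using hD(2)[of "(\<zero>\<^bsub>A\<^esub>, x)" "(\<zero>\<^bsub>A\<^esub>, y)"] by simp
  next
    fix a x assume "a \<in> carrier R" "x \<in> carrier D"
    then show "h (\<zero>\<^bsub>A\<^esub>, a \<odot>\<^bsub>D\<^esub> x) = a \<odot>\<^bsub>B\<^esub> h (\<zero>\<^bsub>A\<^esub>, x)"
      using hD(3)[of "(\<zero>\<^bsub>A\<^esub>, x)" a] by (simp add: rmod_smult_zero[OF A'(1)])
  qed (simp add: h_mem)
  have r: "(\<lambda>b \<in> carrier B. fst (k b)) \<in> rmod_hom R B A"
    by (rule rmod_homI[OF _ _ _ B(1)]) (simp_all add: k_mem k_add k_smult)
  have p: "(\<lambda>b \<in> carrier B. snd (k b)) \<in> rmod_hom R B D"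
    by (rule rmod_homI[OF _ _ _ B(1)]) (simp_all add: k_mem k_add k_smult)
  have sum: "h (fst (k b), \<zero>\<^bsub>D\<^esub>) \<oplus>\<^bsub>B\<^esub> h (\<zero>\<^bsub>A\<^esub>, snd (k b)) = b" if "b \<in> carrier B" for b
    using hD(2)[of "(fst (k b), \<zero>\<^bsub>D\<^esub>)" "(\<zero>\<^bsub>A\<^esub>, snd (k b))"] k_mem[OF that] hk(1)[OF that] by simp
  have "is_biproduct (mod_cat R) A D B (Arrow A B (\<lambda>x \<in> carrier A. h (x, \<zero>\<^bsub>D\<^esub>)))
      (Arrow D B (\<lambda>y \<in> carrier D. h (\<zero>\<^bsub>A\<^esub>, y))) (Arrow B A (\<lambda>b \<in> carrier B. fst (k b)))
      (Arrow B D (\<lambda>b \<in> carrier B. snd (k b)))"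
    unfolding is_biproduct_def
    using A' D' B i j r p
    by (auto simp: homs_iff mod_arr_iff compose_def fun_eq_iff h_mem k_mem kh sum)
  then show ?thesis by (intro exI)
qed

lemma mod_zero_module:
  assumes "ring R"
  obtains Z :: "('a, 'm) module" where "right_module (R :: ('a, 'r) ring_scheme) Z" "fin_gen R Z"
    "carrier Z = {\<zero>\<^bsub>Z\<^esub>}"
proof -
  define Z :: "('a, 'm) module" where "Z = \<lparr>carrier = {undefined}, mult = undefined,
    one = undefined, zero = undefined, add = (\<lambda>x y. undefined), smult = (\<lambda>a x. undefined)\<rparr>"
  have Z: "carrier Z = {undefined}" "\<zero>\<^bsub>Z\<^esub> = undefined"
    "\<And>x y. x \<oplus>\<^bsub>Z\<^esub> y = undefined" "\<And>a x. a \<odot>\<^bsub>Z\<^esub> x = undefined"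
    by (simp_all add: Z_def)
  have "abelian_group Z" by (rule abelian_groupI) (auto simp: Z)
  then have M: "right_module R Z"
    using assms by (intro right_module.intro right_module_axioms.intro) (auto simp: Z)
  have "fin_gen R Z"
    unfolding fin_gen_def
  proof (intro exI[of _ "{}"] conjI allI impI)
    fix N assume N: "submodule N R Z \<and> {} \<subseteq> N"
    interpret Z: right_module R Z by (rule M)
    interpret N: submodule N R Z using N by simp
    show "N = carrier Z" using N.subset N.one_closed by (auto simp: Z)
  qed auto
  with M show ?thesis using that Z by simp
qed

lemma mod_additive:
  fixes R :: "('a, 'r) ring_scheme"
  assumes R: "ring R" and U: "fg_universe R TYPE('m)"
  shows "additive_category (mod_cat R :: (('a, 'm) module, 'm \<Rightarrow> 'm) precat)" (is "additive_category ?C")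
proof (intro additive_category.intro additive_category_axioms.intro mod_category mod_hom_group
    mod_biproduct[OF U])
  fix f g h and A B D :: "('a, 'm) module"
  assume f: "f \<in> homs ?C A B" and "g \<in> homs ?C B D" "h \<in> homs ?C B D"
  then show "(g \<uplus>\<^bsub>?C\<^esub> h) \<cdot>\<^bsub>?C\<^esub> f = (g \<cdot>\<^bsub>?C\<^esub> f) \<uplus>\<^bsub>?C\<^esub> (h \<cdot>\<^bsub>?C\<^esub> f)"
    using mod_arr_closed[of f R] by (auto simp: homs_iff compose_def fun_eq_iff)
next
  fix f g h and A B D :: "('a, 'm) module"
  assume "f \<in> homs ?C A B" "g \<in> homs ?C A B" "h \<in> homs ?C B D"
  then show "h \<cdot>\<^bsub>?C\<^esub> (f \<uplus>\<^bsub>?C\<^esub> g) = (h \<cdot>\<^bsub>?C\<^esub> f) \<uplus>\<^bsub>?C\<^esub> (h \<cdot>\<^bsub>?C\<^esub> g)"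
    using mod_arr_closed[of f R] mod_arr_closed[of g R] rmod_homD(2)[OF mod_arrD(5)[of h R]]
    by (auto simp: homs_iff compose_def fun_eq_iff)
next
  obtain Z :: "('a, 'm) module" where Z: "right_module R Z" "fin_gen R Z" "carrier Z = {\<zero>\<^bsub>Z\<^esub>}"
    by (rule mod_zero_module[OF R])
  have "is_zero_object ?C Z"
    unfolding is_zero_object_def
  proof (intro conjI ballI)
    fix A :: "('a, 'm) module" assume A: "A \<in> objs ?C"
    show "\<exists>!f. f \<in> homs ?C Z A"
    proof (rule ex1I[of _ "zero_arr ?C Z A"])
      fix f assume "f \<in> homs ?C Z A"
      then have f: "f \<in> arrs ?C" "src f = Z" "tgt f = A" by (simp_all add: homs_iff)
      have z: "zero_arr ?C Z A \<in> arrs ?C" using A Z(1,2) by (simp add: mod_arr_iff rmod_hom_zero_map)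
      show "f = zero_arr ?C Z A"
        by (rule mod_arr_eqI[OF f(1) z])
          (use f A Z rmod_hom_zero[OF Z(1) _ mod_arrD(5)[OF f(1), unfolded f(2,3)]] in auto)
    qed (use A Z(1,2) in \<open>simp add: homs_iff mod_arr_iff rmod_hom_zero_map\<close>)
    show "\<exists>!f. f \<in> homs ?C A Z"
    proof (rule ex1I[of _ "zero_arr ?C A Z"])
      fix f assume "f \<in> homs ?C A Z"
      then have f: "f \<in> arrs ?C" "src f = A" "tgt f = Z" by (simp_all add: homs_iff)
      have z: "zero_arr ?C A Z \<in> arrs ?C" using A Z(1,2) by (simp add: mod_arr_iff rmod_hom_zero_map)
      show "f = zero_arr ?C A Z"
        by (rule mod_arr_eqI[OF f(1) z]) (use f A Z mod_arr_closed[OF f(1)] in auto)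
    qed (use A Z(1,2) in \<open>simp add: homs_iff mod_arr_iff rmod_hom_zero_map\<close>)
  qed (use Z in simp)
  then show "\<exists>Z. is_zero_object ?C Z" by blast
qed


section \<open>Kernels and cokernels of module homomorphisms by elements\<close>

declare mod_cat_simps [simp del]

lemma mod_cmp_fn:
  "x \<in> carrier (src f) \<Longrightarrow> fn (g \<cdot>\<^bsub>mod_cat R\<^esub> f) x = fn g (fn f x)"
  by (simp add: mod_cat_simps compose_def)

lemma mod_zero_fn: "x \<in> carrier M \<Longrightarrow> fn (zero_arr (mod_cat R) M N) x = \<zero>\<^bsub>N\<^esub>"
  by (simp add: mod_cat_simps)

lemma mod_cmp_ends [simp]:
  "src (g \<cdot>\<^bsub>mod_cat R\<^esub> f) = src f" "tgt (g \<cdot>\<^bsub>mod_cat R\<^esub> f) = tgt g"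
  "src (zero_arr (mod_cat R) M N) = M" "tgt (zero_arr (mod_cat R) M N) = N"
  by (simp_all add: mod_cat_simps)

lemma mod_cmp_arr:
  "\<lbrakk>f \<in> arrs (mod_cat R); g \<in> arrs (mod_cat R); src g = tgt f\<rbrakk> \<Longrightarrow> g \<cdot>\<^bsub>mod_cat R\<^esub> f \<in> arrs (mod_cat R)"
  using category.cmp_arr(1)[OF mod_category] .

lemma mod_zero_arr:
  "\<lbrakk>right_module R M; fin_gen R M; right_module R N; fin_gen R N\<rbrakk>
    \<Longrightarrow> zero_arr (mod_cat R) M N \<in> arrs (mod_cat R)"
  by (simp add: mod_arr_iff mod_cat_simps rmod_hom_zero_map)

lemma mod_factor_surjective:
  assumes q: "q \<in> arrs (mod_cat R)" and g: "g \<in> arrs (mod_cat R)" and qg: "src g = src q"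
    and surj: "fn q ` carrier (src q) = carrier (tgt q)"
    and ker: "\<And>x. \<lbrakk>x \<in> carrier (src q); fn q x = \<zero>\<^bsub>tgt q\<^esub>\<rbrakk> \<Longrightarrow> fn g x = \<zero>\<^bsub>tgt g\<^esub>"
  obtains h where "h \<in> arrs (mod_cat R)" "src h = tgt q" "tgt h = tgt g" "h \<cdot>\<^bsub>mod_cat R\<^esub> q = g"
proof -
  note Q = mod_arrD[OF q] and G = mod_arrD[OF g, unfolded qg]
  interpret B: right_module R "src q" by (rule Q)
  note qD = rmod_homD[OF Q(5)] and gD = rmod_homD[OF G(5)]
  define s where "s y = inv_into (carrier (src q)) (fn q) y" for y
  have s: "s y \<in> carrier (src q)" "fn q (s y) = y" if "y \<in> carrier (tgt q)" for y
    using inv_into_into[of y "fn q"] f_inv_into_f[of y "fn q"] that surj by (simp_all add: s_def)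
  have cong: "fn g x = fn g x'" if "x \<in> carrier (src q)" "x' \<in> carrier (src q)" "fn q x = fn q x'" for x x'
  proof -
    have "fn q (x \<ominus>\<^bsub>src q\<^esub> x') = \<zero>\<^bsub>tgt q\<^esub>"
      using rmod_hom_minus[OF Q(1,3,5) that(1,2)] rmod_minus_eq_zero[OF Q(3)] qD(1) that by simp
    then have "fn g (x \<ominus>\<^bsub>src q\<^esub> x') = \<zero>\<^bsub>tgt g\<^esub>" using ker that by simp
    then show ?thesis
      using rmod_hom_minus[OF G(1,3,5) that(1,2)] rmod_minus_eq_zero[OF G(3)] gD(1) that by simp
  qed
  interpret Y: right_module R "tgt q" by (rule Q)
  have h: "restrict (\<lambda>y. fn g (s y)) (carrier (tgt q)) \<in> rmod_hom R (tgt q) (tgt g)"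
  proof (rule rmod_homI[OF _ _ _ Q(3)])
    fix x y assume xy: "x \<in> carrier (tgt q)" "y \<in> carrier (tgt q)"
    have "fn g (s (x \<oplus>\<^bsub>tgt q\<^esub> y)) = fn g (s x \<oplus>\<^bsub>src q\<^esub> s y)"
      by (rule cong) (use s xy qD(2) in simp_all)
    then show "fn g (s (x \<oplus>\<^bsub>tgt q\<^esub> y)) = fn g (s x) \<oplus>\<^bsub>tgt g\<^esub> fn g (s y)"
      using gD(2) s xy by simp
  next
    fix a x assume ax: "a \<in> carrier R" "x \<in> carrier (tgt q)"
    have "fn g (s (a \<odot>\<^bsub>tgt q\<^esub> x)) = fn g (a \<odot>\<^bsub>src q\<^esub> s x)"
      by (rule cong) (use s ax qD(3) B.smult_closed Y.smult_closed in simp_all)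
    then show "fn g (s (a \<odot>\<^bsub>tgt q\<^esub> x)) = a \<odot>\<^bsub>tgt g\<^esub> fn g (s x)"
      using gD(3) s ax by simp
  qed (use s gD(1) in simp)
  let ?h = "Arrow (tgt q) (tgt g) (restrict (\<lambda>y. fn g (s y)) (carrier (tgt q)))"
  have h': "?h \<in> arrs (mod_cat R)" using h Q G by (simp add: mod_arr_iff)
  have "?h \<cdot>\<^bsub>mod_cat R\<^esub> q = g"
  proof (rule mod_arr_eqI[OF mod_cmp_arr[OF q h'] g])
    fix x assume "x \<in> carrier (src g)"
    then have x: "x \<in> carrier (src q)" using qg by simp
    have "fn g (s (fn q x)) = fn g x" by (rule cong) (use s qD(1) x in simp_all)
    then show "fn (?h \<cdot>\<^bsub>mod_cat R\<^esub> q) x = fn g x" using x qD(1) by (simp add: mod_cmp_fn)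
  qed (use qg in simp_all)
  then show ?thesis using that h' by simp
qed

lemma mod_factor_injective:
  assumes k: "k \<in> arrs (mod_cat R)" and g: "g \<in> arrs (mod_cat R)" and kg: "tgt g = tgt k"
    and inj: "inj_on (fn k) (carrier (src k))"
    and im: "\<And>x. x \<in> carrier (src g) \<Longrightarrow> fn g x \<in> fn k ` carrier (src k)"
  obtains h where "h \<in> arrs (mod_cat R)" "src h = src g" "tgt h = src k" "k \<cdot>\<^bsub>mod_cat R\<^esub> h = g"
proof -
  note K = mod_arrD[OF k] and G = mod_arrD[OF g, unfolded kg]
  note kD = rmod_homD[OF K(5)] and gD = rmod_homD[OF G(5)]
  interpret A: right_module R "src k" by (rule K)
  interpret T: right_module R "src g" by (rule G)
  define s where "s x = inv_into (carrier (src k)) (fn k) (fn g x)" for x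
  have s: "s x \<in> carrier (src k)" "fn k (s x) = fn g x" if "x \<in> carrier (src g)" for x
    using inv_into_into[OF im[OF that]] f_inv_into_f[OF im[OF that]] by (simp_all add: s_def)
  have h: "restrict s (carrier (src g)) \<in> rmod_hom R (src g) (src k)"
  proof (rule rmod_homI[OF _ _ _ G(1)])
    fix x y assume xy: "x \<in> carrier (src g)" "y \<in> carrier (src g)"
    show "s (x \<oplus>\<^bsub>src g\<^esub> y) = s x \<oplus>\<^bsub>src k\<^esub> s y"
      by (rule inj_onD[OF inj]) (use s xy kD(2) gD(2) in simp_all)
  next
    fix a x assume ax: "a \<in> carrier R" "x \<in> carrier (src g)"
    show "s (a \<odot>\<^bsub>src g\<^esub> x) = a \<odot>\<^bsub>src k\<^esub> s x"
      by (rule inj_onD[OF inj]) (use s ax kD(3) gD(3) A.smult_closed T.smult_closed in simp_all)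
  qed (use s in simp)
  let ?h = "Arrow (src g) (src k) (restrict s (carrier (src g)))"
  have h': "?h \<in> arrs (mod_cat R)" using h K G by (simp add: mod_arr_iff)
  have "k \<cdot>\<^bsub>mod_cat R\<^esub> ?h = g"
    by (rule mod_arr_eqI[OF mod_cmp_arr[OF h' k] g]) (use s kg in \<open>simp_all add: mod_cmp_fn\<close>)
  then show ?thesis using that h' by simp
qed

lemma mod_cokernel_criterion:
  assumes q: "q \<in> arrs (mod_cat R)" and f: "f \<in> arrs (mod_cat R)" and qf: "src q = tgt f"
    and surj: "fn q ` carrier (src q) = carrier (tgt q)"
    and ker: "\<And>x. x \<in> carrier (src q) \<Longrightarrow> fn q x = \<zero>\<^bsub>tgt q\<^esub> \<longleftrightarrow> x \<in> fn f ` carrier (src f)"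
  shows "is_cokernel (mod_cat R) q f"
proof (rule is_cokernelI[OF q f qf])
  note Q = mod_arrD[OF q] and F = mod_arrD[OF f]
  show "q \<cdot>\<^bsub>mod_cat R\<^esub> f = zero_arr (mod_cat R) (src f) (tgt q)"
    by (rule mod_arr_eqI[OF mod_cmp_arr[OF f q qf]])
      (use Q F ker mod_arr_closed[OF f] qf in \<open>simp_all add: mod_cmp_fn mod_zero_fn mod_zero_arr\<close>)
next
  fix g assume g: "g \<in> arrs (mod_cat R)" "src g = tgt f"
    and z: "g \<cdot>\<^bsub>mod_cat R\<^esub> f = zero_arr (mod_cat R) (src f) (tgt g)"
  have k: "fn g (fn f x) = \<zero>\<^bsub>tgt g\<^esub>" if "x \<in> carrier (src f)" for x
    using mod_cmp_fn[OF that, of R g] mod_zero_fn[OF that, of R "tgt g"] z by simp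
  have "fn g x = \<zero>\<^bsub>tgt g\<^esub>" if "x \<in> carrier (src q)" "fn q x = \<zero>\<^bsub>tgt q\<^esub>" for x
    using ker that k by auto
  with mod_factor_surjective[OF q g(1) _ surj] g(2) qf
  show "\<exists>h. h \<in> arrs (mod_cat R) \<and> src h = tgt q \<and> tgt h = tgt g \<and> h \<cdot>\<^bsub>mod_cat R\<^esub> q = g"
    by metis
next
  fix g h assume g: "g \<in> arrs (mod_cat R)" and h: "h \<in> arrs (mod_cat R)"
    and e: "src g = tgt q" "src h = tgt q" "tgt g = tgt h" "g \<cdot>\<^bsub>mod_cat R\<^esub> q = h \<cdot>\<^bsub>mod_cat R\<^esub> q"
  show "g = h"
  proof (rule mod_arr_eqI[OF g h])
    fix y assume "y \<in> carrier (src h)"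
    then obtain x where x: "x \<in> carrier (src q)" "y = fn q x" using surj e(2) by auto
    show "fn g y = fn h y"
      using mod_cmp_fn[OF x(1), of R g] mod_cmp_fn[OF x(1), of R h] e(4) x(2) by simp
  qed (use e in simp_all)
qed

lemma mod_kernel_criterion:
  assumes k: "k \<in> arrs (mod_cat R)" and f: "f \<in> arrs (mod_cat R)" and kf: "tgt k = src f"
    and inj: "inj_on (fn k) (carrier (src k))"
    and ker: "\<And>x. x \<in> carrier (src f) \<Longrightarrow> fn f x = \<zero>\<^bsub>tgt f\<^esub> \<longleftrightarrow> x \<in> fn k ` carrier (src k)"
  shows "is_kernel (mod_cat R) k f"
proof (rule is_kernelI[OF k f kf])
  note K = mod_arrD[OF k] and F = mod_arrD[OF f]
  show "f \<cdot>\<^bsub>mod_cat R\<^esub> k = zero_arr (mod_cat R) (src k) (tgt f)"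
    by (rule mod_arr_eqI[OF mod_cmp_arr[OF k f kf[symmetric]]])
      (use K F ker mod_arr_closed[OF k] kf in \<open>simp_all add: mod_cmp_fn mod_zero_fn mod_zero_arr\<close>)
next
  fix g assume g: "g \<in> arrs (mod_cat R)" "tgt g = src f"
    and z: "f \<cdot>\<^bsub>mod_cat R\<^esub> g = zero_arr (mod_cat R) (src g) (tgt f)"
  have "fn f (fn g x) = \<zero>\<^bsub>tgt f\<^esub>" if "x \<in> carrier (src g)" for x
    using mod_cmp_fn[OF that, of R f] mod_zero_fn[OF that, of R "tgt f"] z by simp
  then have "fn g x \<in> fn k ` carrier (src k)" if "x \<in> carrier (src g)" for x
    using iffD1[OF ker, of "fn g x"] mod_arr_closed[OF g(1) that] g(2) that by simp
  with mod_factor_injective[OF k g(1) _ inj] g(2) kf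
  show "\<exists>h. h \<in> arrs (mod_cat R) \<and> src h = src g \<and> tgt h = src k \<and> k \<cdot>\<^bsub>mod_cat R\<^esub> h = g"
    by metis
next
  fix g h assume g: "g \<in> arrs (mod_cat R)" and h: "h \<in> arrs (mod_cat R)"
    and e: "tgt g = src k" "tgt h = src k" "src g = src h" "k \<cdot>\<^bsub>mod_cat R\<^esub> g = k \<cdot>\<^bsub>mod_cat R\<^esub> h"
  show "g = h"
  proof (rule mod_arr_eqI[OF g h])
    fix x assume x: "x \<in> carrier (src h)"
    have "fn k (fn g x) = fn k (fn h x)"
      using mod_cmp_fn[of x g R k] mod_cmp_fn[of x h R k] e x by simp
    then show "fn g x = fn h x"
      by (rule inj_onD[OF inj]) (use mod_arr_closed[OF g] mod_arr_closed[OF h] e x in simp_all)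
  qed (use e in simp_all)
qed

lemma (in abelian_group) minus_minus_cancel:
  "\<lbrakk>x \<in> carrier G; y \<in> carrier G; z \<in> carrier G\<rbrakk> \<Longrightarrow> (x \<ominus> y) \<ominus> (z \<ominus> y) = x \<ominus> z"
  by (simp add: a_minus_def minus_add a_ac l_neg r_neg1 r_neg2)

lemma (in abelian_group) add_minus_add:
  "\<lbrakk>x \<in> carrier G; x' \<in> carrier G; y \<in> carrier G; y' \<in> carrier G\<rbrakk>
    \<Longrightarrow> (x \<ominus> x') \<oplus> (y \<ominus> y') = (x \<oplus> y) \<ominus> (x' \<oplus> y')"
  by (simp add: a_minus_def minus_add a_ac)

text \<open>
  The quotient of \<open>tgt f\<close> by the image of \<open>f\<close>, each class being represented by a chosen element.
\<close>

lemma mod_cokernel_exists: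
  fixes f :: "(('a, 'm) module, 'm \<Rightarrow> 'm) arrow"
  assumes f: "f \<in> arrs (mod_cat R)"
  obtains q where "q \<in> arrs (mod_cat R)" "src q = tgt f"
    "fn q ` carrier (src q) = carrier (tgt q)"
    "\<And>x. x \<in> carrier (src q) \<Longrightarrow> fn q x = \<zero>\<^bsub>tgt q\<^esub> \<longleftrightarrow> x \<in> fn f ` carrier (src f)"
proof -
  note F = mod_arrD[OF f]
  let ?A = "src f" and ?B = "tgt f" and ?I = "fn f ` carrier (src f)"
  interpret A: right_module R ?A by (rule F)
  interpret B: right_module R ?B by (rule F)
  note fD = rmod_homD[OF F(5)]
  have I0: "\<zero>\<^bsub>?B\<^esub> \<in> ?I" using rmod_hom_zero[OF F(1,3,5)] A.M.zero_closed by (metis imageI)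
  have I_add: "x \<oplus>\<^bsub>?B\<^esub> y \<in> ?I" if xy: "x \<in> ?I" "y \<in> ?I" for x y
  proof -
    obtain a where a: "x = fn f a" "a \<in> carrier ?A" by (rule imageE[OF xy(1)])
    obtain b where b: "y = fn f b" "b \<in> carrier ?A" by (rule imageE[OF xy(2)])
    have "fn f (a \<oplus>\<^bsub>?A\<^esub> b) \<in> ?I" using a(2) b(2) by (intro imageI A.M.add.m_closed)
    then show ?thesis unfolding fD(2)[OF a(2) b(2)] a(1) b(1) .
  qed
  have I_minus: "x \<ominus>\<^bsub>?B\<^esub> y \<in> ?I" if xy: "x \<in> ?I" "y \<in> ?I" for x y
  proof -
    obtain a where a: "x = fn f a" "a \<in> carrier ?A" by (rule imageE[OF xy(1)])
    obtain b where b: "y = fn f b" "b \<in> carrier ?A" by (rule imageE[OF xy(2)])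
    have "fn f (a \<ominus>\<^bsub>?A\<^esub> b) \<in> ?I" using a(2) b(2) by (intro imageI A.M.minus_closed)
    then show ?thesis unfolding rmod_hom_minus[OF F(1,3,5) a(2) b(2)] a(1) b(1) .
  qed
  have I_smult: "a \<odot>\<^bsub>?B\<^esub> x \<in> ?I" if "a \<in> carrier R" "x \<in> ?I" for a x
    using that fD(3) by (auto intro!: rev_image_eqI[OF A.smult_closed])
  define E where "E x y \<longleftrightarrow> x \<ominus>\<^bsub>?B\<^esub> y \<in> ?I" for x y
  have E_refl: "E x x" if "x \<in> carrier ?B" for x
    using I0 rmod_minus_eq_zero[OF F(3) that that] by (simp add: E_def)
  have E_trans: "E x z" if "E x y" "E z y" "x \<in> carrier ?B" "y \<in> carrier ?B" "z \<in> carrier ?B" for x y z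
  proof -
    have "(x \<ominus>\<^bsub>?B\<^esub> y) \<ominus>\<^bsub>?B\<^esub> (z \<ominus>\<^bsub>?B\<^esub> y) = x \<ominus>\<^bsub>?B\<^esub> z"
      by (rule B.M.minus_minus_cancel) (use that in simp_all)
    then show ?thesis using I_minus[of "x \<ominus>\<^bsub>?B\<^esub> y" "z \<ominus>\<^bsub>?B\<^esub> y"] that by (simp add: E_def)
  qed
  have E_sym: "E y x" if "E x y" "x \<in> carrier ?B" "y \<in> carrier ?B" for x y
    using E_trans[OF E_refl that(1)] that(2,3) by simp
  define g where "g x = (SOME y. y \<in> carrier ?B \<and> E x y)" for x
  have g: "g x \<in> carrier ?B" "E x (g x)" if "x \<in> carrier ?B" for x
    using someI[of "\<lambda>y. y \<in> carrier ?B \<and> E x y" x] E_refl[OF that] that by (simp_all add: g_def)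
  have g_eq: "g x = g y \<longleftrightarrow> E x y" if xy: "x \<in> carrier ?B" "y \<in> carrier ?B" for x y
  proof
    assume "g x = g y"
    then show "E x y" using E_trans[of x "g x" y] g[OF xy(1)] g[OF xy(2)] xy by simp
  next
    assume e: "E x y"
    have "E x z \<longleftrightarrow> E y z" if z: "z \<in> carrier ?B" for z
      using E_trans[OF e E_sym, of z] E_trans[OF E_sym[OF e] E_sym, of z] xy z by blast
    then show "g x = g y" unfolding g_def by (metis (no_types, lifting))
  qed
  obtain Q :: "('a, 'm) module" where Q: "right_module R Q" "fin_gen R Q"
    "carrier Q = g ` carrier ?B" "restrict g (carrier ?B) \<in> rmod_hom R ?B Q"
  proof (rule image_module[OF F(3,4), of g])
    fix x x' y y' assume xy: "x \<in> carrier ?B" "x' \<in> carrier ?B" "y \<in> carrier ?B" "y' \<in> carrier ?B"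
      "g x = g x'" "g y = g y'"
    have "(x \<ominus>\<^bsub>?B\<^esub> x') \<oplus>\<^bsub>?B\<^esub> (y \<ominus>\<^bsub>?B\<^esub> y') = (x \<oplus>\<^bsub>?B\<^esub> y) \<ominus>\<^bsub>?B\<^esub> (x' \<oplus>\<^bsub>?B\<^esub> y')"
      by (rule B.M.add_minus_add) (use xy in simp_all)
    then show "g (x \<oplus>\<^bsub>?B\<^esub> y) = g (x' \<oplus>\<^bsub>?B\<^esub> y')"
      using I_add[of "x \<ominus>\<^bsub>?B\<^esub> x'" "y \<ominus>\<^bsub>?B\<^esub> y'"] xy by (simp add: g_eq E_def)
  next
    fix a x x' assume ax: "a \<in> carrier R" "x \<in> carrier ?B" "x' \<in> carrier ?B" "g x = g x'"
    have "a \<odot>\<^bsub>?B\<^esub> (x \<ominus>\<^bsub>?B\<^esub> x') = a \<odot>\<^bsub>?B\<^esub> x \<ominus>\<^bsub>?B\<^esub> a \<odot>\<^bsub>?B\<^esub> x'"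
      using ax by (simp add: a_minus_def B.smult_r_distr rmod_smult_neg[OF F(3)])
    then show "g (a \<odot>\<^bsub>?B\<^esub> x) = g (a \<odot>\<^bsub>?B\<^esub> x')"
      using I_smult[of a "x \<ominus>\<^bsub>?B\<^esub> x'"] ax by (simp add: g_eq E_def B.smult_closed)
  qed
  let ?q = "Arrow ?B Q (restrict g (carrier ?B))"
  have q: "?q \<in> arrs (mod_cat R)" using F Q by (simp add: mod_arr_iff)
  have "\<zero>\<^bsub>Q\<^esub> = g \<zero>\<^bsub>?B\<^esub>" using rmod_hom_zero[OF F(3) Q(1,4)] by simp
  moreover have "x \<ominus>\<^bsub>?B\<^esub> \<zero>\<^bsub>?B\<^esub> = x" if "x \<in> carrier ?B" for x
    using that by (simp add: a_minus_def)
  ultimately have "fn ?q x = \<zero>\<^bsub>Q\<^esub> \<longleftrightarrow> x \<in> ?I" if "x \<in> carrier ?B" for x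
    using that by (simp add: g_eq E_def)
  then show ?thesis using that[OF q] Q(3) by simp
qed

text \<open>
  If \<open>f\<close> kills \<open>x\<close>, then it does not distinguish the inclusion of \<open>x R\<close> from the zero map.
\<close>

lemma mod_mono_injective:
  assumes "is_mono (mod_cat R) f"
  shows "inj_on (fn f) (carrier (src f))"
proof -
  have f: "f \<in> arrs (mod_cat R)" using assms by (simp add: is_mono_def)
  note F = mod_arrD[OF f]
  show ?thesis
  proof (rule rmod_hom_inj[OF F(1,3,5)])
    fix x assume x: "x \<in> carrier (src f)" "fn f x = \<zero>\<^bsub>tgt f\<^esub>"
    obtain T where T: "right_module R T" "fin_gen R T" "x \<in> carrier T"
      "carrier T = (\<lambda>a. a \<odot>\<^bsub>src f\<^esub> x) ` carrier R" "(\<lambda>y \<in> carrier T. y) \<in> rmod_hom R T (src f)"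
      using cyclic_submodule[OF F(1) x(1)] .
    let ?e = "Arrow T (src f) (\<lambda>y \<in> carrier T. y)" and ?z = "zero_arr (mod_cat R) T (src f)"
    have e: "?e \<in> arrs (mod_cat R)" using T F by (simp add: mod_arr_iff)
    have z: "?z \<in> arrs (mod_cat R)" using T F by (intro mod_zero_arr)
    have fy: "fn f y = \<zero>\<^bsub>tgt f\<^esub>" if "y \<in> carrier T" for y
      using that x rmod_homD(3)[OF F(5) x(1)] rmod_smult_zero[OF F(3)] by (auto simp: T(4))
    have "f \<cdot>\<^bsub>mod_cat R\<^esub> ?e = f \<cdot>\<^bsub>mod_cat R\<^esub> ?z"
      by (rule mod_arr_eqI[OF mod_cmp_arr[OF e f] mod_cmp_arr[OF z f]])
        (use fy rmod_hom_zero[OF F(1,3,5)] in \<open>simp_all add: mod_cmp_fn mod_zero_fn\<close>)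
    then have "?e = ?z"
      by (rule category.mono_cancel[OF mod_category assms]) (use e z in simp_all)
    then have "fn ?e x = fn ?z x" by simp
    then show "x = \<zero>\<^bsub>src f\<^esub>" using T(3) by (simp add: mod_zero_fn)
  qed
qed

text \<open>
  If \<open>f\<close> kills \<open>x\<close>, then the inclusion of \<open>x R\<close> factors through \<open>k\<close>.
\<close>

lemma mod_kernel_elements:
  assumes "is_kernel (mod_cat R) k f" "x \<in> carrier (src f)"
  shows "fn f x = \<zero>\<^bsub>tgt f\<^esub> \<longleftrightarrow> x \<in> fn k ` carrier (src k)"
proof
  note D = is_kernelD[OF assms(1)]
  note F = mod_arrD[OF D(2)] and K = mod_arrD[OF D(1)]
  assume z: "fn f x = \<zero>\<^bsub>tgt f\<^esub>"
  obtain T where T: "right_module R T" "fin_gen R T" "x \<in> carrier T"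
    "carrier T = (\<lambda>a. a \<odot>\<^bsub>src f\<^esub> x) ` carrier R" "(\<lambda>y \<in> carrier T. y) \<in> rmod_hom R T (src f)"
    using cyclic_submodule[OF F(1) assms(2)] .
  let ?e = "Arrow T (src f) (\<lambda>y \<in> carrier T. y)"
  have e: "?e \<in> arrs (mod_cat R)" using T F by (simp add: mod_arr_iff)
  have fy: "fn f y = \<zero>\<^bsub>tgt f\<^esub>" if "y \<in> carrier T" for y
    using that z assms(2) rmod_homD(3)[OF F(5) assms(2)] rmod_smult_zero[OF F(3)] by (auto simp: T(4))
  have "f \<cdot>\<^bsub>mod_cat R\<^esub> ?e = zero_arr (mod_cat R) (src ?e) (tgt f)"
    by (rule mod_arr_eqI[OF mod_cmp_arr[OF e D(2)] mod_zero_arr])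
      (use T F fy in \<open>simp_all add: mod_cmp_fn mod_zero_fn\<close>)
  then obtain h where h: "h \<in> arrs (mod_cat R)" "src h = src ?e" "tgt h = src k" "k \<cdot>\<^bsub>mod_cat R\<^esub> h = ?e"
    using kernel_factor[OF assms(1) e] by auto
  have "x = fn k (fn h x)" using mod_cmp_fn[of x h R k] h T(3) by simp
  moreover have "fn h x \<in> carrier (src k)" using mod_arr_closed[OF h(1), of x] h T(3) by simp
  ultimately show "x \<in> fn k ` carrier (src k)" by (rule image_eqI)
next
  note D = is_kernelD[OF assms(1)]
  assume "x \<in> fn k ` carrier (src k)"
  then obtain y where y: "y \<in> carrier (src k)" "x = fn k y" by auto
  show "fn f x = \<zero>\<^bsub>tgt f\<^esub>"
    using mod_cmp_fn[OF y(1), of R f] mod_zero_fn[OF y(1), of R "tgt f"] D(4) y(2) by simp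
qed


section \<open>The exact sequence of cokernels and the theorem\<close>

text \<open>
  The property holds for the quotient by the image, and any other cokernel is isomorphic to it.
\<close>

lemma mod_cokernel_elements:
  fixes q f :: "(('a, 'm) module, 'm \<Rightarrow> 'm) arrow"
  assumes C: "additive_category (mod_cat R :: (('a, 'm) module, 'm \<Rightarrow> 'm) precat)"
    and q: "is_cokernel (mod_cat R) q f"
  shows "fn q ` carrier (tgt f) = carrier (tgt q)"
    and "x \<in> carrier (tgt f) \<Longrightarrow> fn q x = \<zero>\<^bsub>tgt q\<^esub> \<longleftrightarrow> x \<in> fn f ` carrier (src f)"
proof -
  interpret C: additive_category "mod_cat R :: (('a, 'm) module, 'm \<Rightarrow> 'm) precat" by (rule C)
  note Q = is_cokernelD[OF q]
  obtain c where c: "c \<in> arrs (mod_cat R)" "src c = tgt f" "fn c ` carrier (src c) = carrier (tgt c)"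
    "\<And>x. x \<in> carrier (src c) \<Longrightarrow> fn c x = \<zero>\<^bsub>tgt c\<^esub> \<longleftrightarrow> x \<in> fn f ` carrier (src f)"
    by (rule mod_cokernel_exists[OF Q(2)]) blast
  have ck: "is_cokernel (mod_cat R) c f" by (rule mod_cokernel_criterion[OF c(1) Q(2) c(2-4)])
  obtain u where u: "u \<in> arrs (mod_cat R)" "src u = tgt q" "tgt u = tgt c" "u \<cdot>\<^bsub>mod_cat R\<^esub> q = c"
    by (rule cokernel_factor[OF q c(1,2) is_cokernelD(4)[OF ck]])
  obtain v where v: "v \<in> arrs (mod_cat R)" "src v = tgt c" "tgt v = tgt q" "v \<cdot>\<^bsub>mod_cat R\<^esub> c = q"
    by (rule cokernel_factor[OF ck Q(1,3,4)])
  have vu: "v \<cdot>\<^bsub>mod_cat R\<^esub> u = ident (mod_cat R) (tgt q)"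
    by (rule C.epi_cancel[OF C.cokernel_epi[OF q]]) (use u v Q C.ends_obj[OF Q(1)] in simp_all)
  have vc: "fn v (fn c x) = fn q x" if "x \<in> carrier (tgt f)" for x
    using mod_cmp_fn[of x c R v] v(4) c(2) that by simp
  have uq: "fn u (fn q x) = fn c x" if "x \<in> carrier (tgt f)" for x
    using mod_cmp_fn[of x q R u] u(4) Q(3) that by simp
  show "fn q ` carrier (tgt f) = carrier (tgt q)"
  proof
    show "fn q ` carrier (tgt f) \<subseteq> carrier (tgt q)"
      using mod_arr_closed[OF Q(1)] Q(3) by auto
    show "carrier (tgt q) \<subseteq> fn q ` carrier (tgt f)"
    proof
      fix y assume y: "y \<in> carrier (tgt q)"
      have "fn u y \<in> carrier (tgt c)" using mod_arr_closed[OF u(1), of y] u y by simp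
      then have "fn u y \<in> fn c ` carrier (tgt f)" using c(2,3) by simp
      then obtain x where x: "fn u y = fn c x" "x \<in> carrier (tgt f)" by (rule imageE)
      have "y = fn v (fn u y)"
        using mod_cmp_fn[of y u R v] vu u(2) y by (simp add: mod_cat_simps)
      also have "\<dots> = fn q x" using x vc by simp
      finally show "y \<in> fn q ` carrier (tgt f)" using x(2) by (rule image_eqI)
    qed
  qed
  show "fn q x = \<zero>\<^bsub>tgt q\<^esub> \<longleftrightarrow> x \<in> fn f ` carrier (src f)" if x: "x \<in> carrier (tgt f)"
  proof -
    have u0: "fn u \<zero>\<^bsub>tgt q\<^esub> = \<zero>\<^bsub>tgt c\<^esub>" using rmod_hom_zero[OF mod_arrD(1,3,5)[OF u(1)]] u(2,3) by simp
    have v0: "fn v \<zero>\<^bsub>tgt c\<^esub> = \<zero>\<^bsub>tgt q\<^esub>" using rmod_hom_zero[OF mod_arrD(1,3,5)[OF v(1)]] v(2,3) by simp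
    have "fn q x = \<zero>\<^bsub>tgt q\<^esub> \<longleftrightarrow> fn c x = \<zero>\<^bsub>tgt c\<^esub>"
      using uq[OF x] vc[OF x] u0 v0 by auto
    then show ?thesis using c(2,4) x by simp
  qed
qed

text \<open>
  The maps \<open>a\<close> and \<open>b\<close> are induced on cokernels. Injectivity of \<open>a\<close> uses that of \<open>g\<close>: if
  \<open>i2 x = h z1\<close>, then \<open>g (p1 z1) = 0\<close>, so \<open>z1\<close> comes from \<open>X1\<close> and \<open>x\<close> lies in the image of \<open>f\<close>. For
  exactness in the middle, a representative \<open>z2\<close> of an element killed by \<open>b\<close> is corrected by an
  element of the image of \<open>h\<close> until it comes from \<open>X2\<close>.
\<close>

lemma mod_cokernel_sequence:
  fixes q q' q'' :: "(('a, 'm) module, 'm \<Rightarrow> 'm) arrow"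
  assumes C: "additive_category (mod_cat R :: (('a, 'm) module, 'm \<Rightarrow> 'm) precat)"
    and i: "i \<in> arrs (mor_cat (mod_cat R))" and p: "p \<in> arrs (mor_cat (mod_cat R))" and pi: "src p = tgt i"
    and e1: "short_exact (mod_cat R) (comp1 i) (comp1 p)"
    and e2: "short_exact (mod_cat R) (comp2 i) (comp2 p)"
    and mono: "is_mono (mod_cat R) (tgt p)"
    and q: "is_cokernel (mod_cat R) q (src i)" and q': "is_cokernel (mod_cat R) q' (tgt i)"
    and q'': "is_cokernel (mod_cat R) q'' (tgt p)"
  shows "\<exists>a b. short_exact (mod_cat R) a b \<and> src a = tgt q \<and> tgt a = tgt q' \<and> tgt b = tgt q''"
proof -
  interpret C: additive_category "mod_cat R :: (('a, 'm) module, 'm \<Rightarrow> 'm) precat" by (rule C)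
  note I = mor_arrD[OF i] and P = mor_arrD[OF p, unfolded pi]
  note Q = is_cokernelD[OF q] and Q' = is_cokernelD[OF q'] and Q'' = is_cokernelD[OF q'']
  have K1: "is_kernel (mod_cat R) (comp1 i) (comp1 p)" and K2: "is_kernel (mod_cat R) (comp2 i) (comp2 p)"
    and L1: "is_cokernel (mod_cat R) (comp1 p) (comp1 i)" and L2: "is_cokernel (mod_cat R) (comp2 p) (comp2 i)"
    using e1 e2 by (simp_all add: short_exact_def)
  have "(q' \<cdot>\<^bsub>mod_cat R\<^esub> comp2 i) \<cdot>\<^bsub>mod_cat R\<^esub> src i
      = zero_arr (mod_cat R) (src (src i)) (tgt (q' \<cdot>\<^bsub>mod_cat R\<^esub> comp2 i))"
    using C.cmp_prolong[OF Q'(4), of "comp1 i"] Q' I(1-8) by (simp add: I(9)[symmetric])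
  then obtain a where a: "a \<in> arrs (mod_cat R)" "src a = tgt q" "tgt a = tgt q'"
    "a \<cdot>\<^bsub>mod_cat R\<^esub> q = q' \<cdot>\<^bsub>mod_cat R\<^esub> comp2 i"
    using cokernel_factor[OF q, of "q' \<cdot>\<^bsub>mod_cat R\<^esub> comp2 i"] Q' I by auto
  have "(q'' \<cdot>\<^bsub>mod_cat R\<^esub> comp2 p) \<cdot>\<^bsub>mod_cat R\<^esub> tgt i
      = zero_arr (mod_cat R) (src (tgt i)) (tgt (q'' \<cdot>\<^bsub>mod_cat R\<^esub> comp2 p))"
    using C.cmp_prolong[OF Q''(4), of "comp1 p"] Q'' P(1-8) by (simp add: P(9)[symmetric])
  then obtain b where b: "b \<in> arrs (mod_cat R)" "src b = tgt q'" "tgt b = tgt q''"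
    "b \<cdot>\<^bsub>mod_cat R\<^esub> q' = q'' \<cdot>\<^bsub>mod_cat R\<^esub> comp2 p"
    using cokernel_factor[OF q', of "q'' \<cdot>\<^bsub>mod_cat R\<^esub> comp2 p"] Q'' P by auto
  let ?f = "fn (src i)" and ?h = "fn (tgt i)" and ?g = "fn (tgt p)"
  let ?i1 = "fn (comp1 i)" and ?i2 = "fn (comp2 i)" and ?p1 = "fn (comp1 p)" and ?p2 = "fn (comp2 p)"
  let ?X1 = "src (src i)" and ?X2 = "tgt (src i)" and ?Z1 = "src (tgt i)" and ?Z2 = "tgt (tgt i)"
    and ?Y1 = "src (tgt p)" and ?Y2 = "tgt (tgt p)"
  have closed: "x \<in> carrier ?X1 \<Longrightarrow> ?f x \<in> carrier ?X2" "x \<in> carrier ?Z1 \<Longrightarrow> ?h x \<in> carrier ?Z2"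
    "x \<in> carrier ?X1 \<Longrightarrow> ?i1 x \<in> carrier ?Z1" "x \<in> carrier ?X2 \<Longrightarrow> ?i2 x \<in> carrier ?Z2"
    "x \<in> carrier ?Z1 \<Longrightarrow> ?p1 x \<in> carrier ?Y1" "x \<in> carrier ?Z2 \<Longrightarrow> ?p2 x \<in> carrier ?Y2"
    "x \<in> carrier ?X2 \<Longrightarrow> fn q x \<in> carrier (tgt q)" "x \<in> carrier ?Z2 \<Longrightarrow> fn q' x \<in> carrier (tgt q')"
    for x
    using mod_arr_closed[OF I(1), of x] mod_arr_closed[OF I(2), of x] mod_arr_closed[OF I(3), of x]
      mod_arr_closed[OF I(6), of x] mod_arr_closed[OF P(3), of x] mod_arr_closed[OF P(6), of x]
      mod_arr_closed[OF Q(1), of x] mod_arr_closed[OF Q'(1), of x] I P Q Q' by simp_all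
  have hi: "?h (?i1 x) = ?i2 (?f x)" if "x \<in> carrier ?X1" for x
    using mod_cmp_fn[of x "comp1 i" R "tgt i"] mod_cmp_fn[of x "src i" R "comp2 i"] I that by simp
  have gp: "?g (?p1 x) = ?p2 (?h x)" if "x \<in> carrier ?Z1" for x
    using mod_cmp_fn[of x "comp1 p" R "tgt p"] mod_cmp_fn[of x "tgt i" R "comp2 p"] P that by simp
  have aq: "fn a (fn q x) = fn q' (?i2 x)" if "x \<in> carrier ?X2" for x
    using mod_cmp_fn[of x q R a] mod_cmp_fn[of x "comp2 i" R q'] a(4) Q I that by simp
  have bq: "fn b (fn q' x) = fn q'' (?p2 x)" if "x \<in> carrier ?Z2" for x
    using mod_cmp_fn[of x q' R b] mod_cmp_fn[of x "comp2 p" R q''] b(4) Q' P that by simp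
  note kq = mod_cokernel_elements[OF C q] and kq' = mod_cokernel_elements[OF C q']
    and kq'' = mod_cokernel_elements[OF C q'']
  have kp1: "?p1 x = \<zero>\<^bsub>?Y1\<^esub> \<longleftrightarrow> x \<in> ?i1 ` carrier ?X1" if "x \<in> carrier ?Z1" for x
    using mod_kernel_elements[OF K1, of x] that I P by simp
  have kp2: "?p2 x = \<zero>\<^bsub>?Y2\<^esub> \<longleftrightarrow> x \<in> ?i2 ` carrier ?X2" if "x \<in> carrier ?Z2" for x
    using mod_kernel_elements[OF K2, of x] that I P by simp
  have sp1: "?p1 ` carrier ?Z1 = carrier ?Y1" using mod_cokernel_elements(1)[OF C L1] I P by simp
  have sp2: "?p2 ` carrier ?Z2 = carrier ?Y2" using mod_cokernel_elements(1)[OF C L2] I P by simp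
  have inj_g: "inj_on ?g (carrier ?Y1)" by (rule mod_mono_injective[OF mono])
  have inj_i2: "inj_on ?i2 (carrier ?X2)"
    using mod_mono_injective[OF C.kernel_mono[OF K2]] I by simp
  note A = mod_arrD[OF a(1), unfolded a(2,3)] and B = mod_arrD[OF b(1), unfolded b(2,3)]
  note Z2 = mod_arrD(3)[OF I(2)] and Y1 = mod_arrD(1)[OF P(2)] and Y2 = mod_arrD(3)[OF P(2)]
  interpret Y1: right_module R ?Y1 by (rule Y1)
  interpret Z2: right_module R ?Z2 by (rule Z2)
  have g0: "?g \<zero>\<^bsub>?Y1\<^esub> = \<zero>\<^bsub>?Y2\<^esub>" by (rule rmod_hom_zero[OF mod_arrD(1,3,5)[OF P(2)]])
  have inj_a: "inj_on (fn a) (carrier (tgt q))"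
  proof (rule rmod_hom_inj[OF A(1,3,5)])
    fix y assume y: "y \<in> carrier (tgt q)" and z: "fn a y = \<zero>\<^bsub>tgt q'\<^esub>"
    have "y \<in> fn q ` carrier ?X2" using y kq(1) by simp
    then obtain x where x: "y = fn q x" "x \<in> carrier ?X2" by (rule imageE)
    have "fn q' (?i2 x) = \<zero>\<^bsub>tgt q'\<^esub>" using aq x z by simp
    then have "?i2 x \<in> ?h ` carrier ?Z1" using kq'(2) closed x by simp
    then obtain z1 where z1: "?i2 x = ?h z1" "z1 \<in> carrier ?Z1" by (rule imageE)
    have "?p2 (?i2 x) = \<zero>\<^bsub>?Y2\<^esub>" using kp2 closed x by simp
    then have "?g (?p1 z1) = ?g \<zero>\<^bsub>?Y1\<^esub>" using gp[OF z1(2)] z1 g0 by simp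
    then have "?p1 z1 = \<zero>\<^bsub>?Y1\<^esub>"
      by (rule inj_onD[OF inj_g]) (use closed z1 in simp_all)
    then have "z1 \<in> ?i1 ` carrier ?X1" using kp1 z1 by simp
    then obtain x1 where x1: "z1 = ?i1 x1" "x1 \<in> carrier ?X1" by (rule imageE)
    have "?i2 x = ?i2 (?f x1)" using z1 x1 hi by simp
    then have "x = ?f x1" by (rule inj_onD[OF inj_i2]) (use closed x x1 in simp_all)
    then show "y = \<zero>\<^bsub>tgt q\<^esub>" using kq(2)[of x] x x1 by simp
  qed
  have ker_b: "fn b y = \<zero>\<^bsub>tgt q''\<^esub> \<longleftrightarrow> y \<in> fn a ` carrier (tgt q)" if y: "y \<in> carrier (tgt q')" for y
  proof
    assume z: "fn b y = \<zero>\<^bsub>tgt q''\<^esub>"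
    have "y \<in> fn q' ` carrier ?Z2" using y kq'(1) by simp
    then obtain z2 where z2: "y = fn q' z2" "z2 \<in> carrier ?Z2" by (rule imageE)
    have "fn q'' (?p2 z2) = \<zero>\<^bsub>tgt q''\<^esub>" using bq z2 z by simp
    then have "?p2 z2 \<in> ?g ` carrier ?Y1" using kq''(2) closed z2 by simp
    then obtain y1 where y1: "?p2 z2 = ?g y1" "y1 \<in> carrier ?Y1" by (rule imageE)
    have "y1 \<in> ?p1 ` carrier ?Z1" using y1 sp1 by simp
    then obtain z1 where z1: "y1 = ?p1 z1" "z1 \<in> carrier ?Z1" by (rule imageE)
    \<comment> \<open>The correction: \<open>?d\<close> represents the same element and is killed by \<open>p2\<close>.\<close>
    let ?d = "z2 \<ominus>\<^bsub>?Z2\<^esub> ?h z1"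
    have d: "?d \<in> carrier ?Z2" using closed z1 z2 by simp
    have pe: "?p2 z2 = ?p2 (?h z1)" using y1 z1 gp by simp
    have "?p2 ?d = ?p2 z2 \<ominus>\<^bsub>?Y2\<^esub> ?p2 (?h z1)"
      using rmod_hom_minus[of R ?Z2 ?Y2 ?p2] Z2 Y2 mod_arrD(5)[OF P(6)] P closed z1 z2 by simp
    also have "\<dots> = \<zero>\<^bsub>?Y2\<^esub>"
      using rmod_minus_eq_zero[OF Y2] closed z1 z2 pe by simp
    finally have "?d \<in> ?i2 ` carrier ?X2" using kp2 d by simp
    then obtain x where x: "?d = ?i2 x" "x \<in> carrier ?X2" by (rule imageE)
    have "fn q' ?d = fn q' z2 \<ominus>\<^bsub>tgt q'\<^esub> fn q' (?h z1)"
      using rmod_hom_minus[of R ?Z2 "tgt q'" "fn q'"] mod_arrD[OF Q'(1)] Q' closed z1 z2 by simp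
    also have "fn q' (?h z1) = \<zero>\<^bsub>tgt q'\<^esub>" using kq'(2)[of "?h z1"] closed z1 by simp
    also have "fn q' z2 \<ominus>\<^bsub>tgt q'\<^esub> \<zero>\<^bsub>tgt q'\<^esub> = y"
    proof -
      interpret T: right_module R "tgt q'" by (rule A(3))
      show ?thesis using z2 y by (simp add: a_minus_def)
    qed
    finally have "y = fn a (fn q x)" using x aq by simp
    then show "y \<in> fn a ` carrier (tgt q)" by (rule image_eqI) (use closed x in simp)
  next
    assume "y \<in> fn a ` carrier (tgt q)"
    then obtain u where u: "y = fn a u" "u \<in> carrier (tgt q)" by (rule imageE)
    have "u \<in> fn q ` carrier ?X2" using u kq(1) by simp
    then obtain x where x: "u = fn q x" "x \<in> carrier ?X2" by (rule imageE)
    have "fn b y = fn q'' (?p2 (?i2 x))" using u x aq bq closed by simp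
    also have "?p2 (?i2 x) = \<zero>\<^bsub>?Y2\<^esub>" using kp2 closed x by simp
    also have "fn q'' \<zero>\<^bsub>?Y2\<^esub> = \<zero>\<^bsub>tgt q''\<^esub>"
      using rmod_hom_zero[OF mod_arrD(1,3,5)[OF Q''(1)]] Q'' by simp
    finally show "fn b y = \<zero>\<^bsub>tgt q''\<^esub>" .
  qed
  have surj_b: "fn b ` carrier (tgt q') = carrier (tgt q'')"
  proof
    show "fn b ` carrier (tgt q') \<subseteq> carrier (tgt q'')" using mod_arr_closed[OF b(1)] b by auto
    have "y \<in> fn b ` carrier (tgt q')" if y: "y \<in> carrier (tgt q'')" for y
    proof -
      have "y \<in> fn q'' ` carrier ?Y2" using y kq''(1) by simp
      then obtain y2 where y2: "y = fn q'' y2" "y2 \<in> carrier ?Y2" by (rule imageE)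
      have "y2 \<in> ?p2 ` carrier ?Z2" using y2 sp2 by simp
      then obtain z2 where z2: "y2 = ?p2 z2" "z2 \<in> carrier ?Z2" by (rule imageE)
      show ?thesis by (rule image_eqI[of _ _ "fn q' z2"]) (use y2 z2 bq closed in simp_all)
    qed
    then show "carrier (tgt q'') \<subseteq> fn b ` carrier (tgt q')" by blast
  qed
  have ab: "tgt a = src b" using a b by simp
  have "is_kernel (mod_cat R) a b"
    by (rule mod_kernel_criterion[OF a(1) b(1) ab]) (use inj_a ker_b a b in simp_all)
  moreover have "is_cokernel (mod_cat R) b a"
    by (rule mod_cokernel_criterion[OF b(1) a(1) ab[symmetric]]) (use surj_b ker_b a b in simp_all)
  ultimately show ?thesis using a b by (auto simp: short_exact_def)
qed

lemma mod_cokernel_exact: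
  fixes R :: "('a, 'r) ring_scheme"
  assumes R: "ring R" and U: "fg_universe R TYPE('m)"
  shows "cokernel_exact_category (mod_cat R :: (('a, 'm) module, 'm \<Rightarrow> 'm) precat)"
proof -
  let ?C = "mod_cat R :: (('a, 'm) module, 'm \<Rightarrow> 'm) precat"
  have A: "additive_category ?C" by (rule mod_additive[OF R U])
  show ?thesis
  proof (intro cokernel_exact_category.intro cokernel_category.intro cokernel_category_axioms.intro
      cokernel_exact_category_axioms.intro A)
    fix f assume f: "f \<in> arrs ?C"
    obtain q where "q \<in> arrs ?C" "src q = tgt f" "fn q ` carrier (src q) = carrier (tgt q)"
      "\<And>x. x \<in> carrier (src q) \<Longrightarrow> fn q x = \<zero>\<^bsub>tgt q\<^esub> \<longleftrightarrow> x \<in> fn f ` carrier (src f)"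
      by (rule mod_cokernel_exists[OF f]) blast
    then show "\<exists>q. is_cokernel ?C q f" using mod_cokernel_criterion[OF _ f] by blast
  qed (rule mod_cokernel_sequence[OF A])
qed

theorem corollary3p4:
  fixes K :: "('k, 'l) ring_scheme"
    and \<Lambda> :: "('a, 'r) ring_scheme"
    and \<phi> :: "'k \<Rightarrow> 'a"
    and X :: "('a, 'm) module set"
  assumes "artin_algebra K \<Lambda> \<phi>"
    and "fg_universe \<Lambda> TYPE('m)"
    and "resolving (mod_cat \<Lambda>) X"
    and "contravariantly_finite (mod_cat \<Lambda>) X"
  shows "quillen_exact_category (S_cat (mod_cat \<Lambda>) X) (E_cw (mod_cat \<Lambda>) X)"
proof -
  have "ring \<Lambda>" using assms(1) by (simp add: artin_algebra_def)
  then have "cokernel_exact_category (mod_cat \<Lambda> :: (('a, 'm) module, 'm \<Rightarrow> 'm) precat)"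
    using assms(2) by (rule mod_cokernel_exact)
  then have "resolving_subcategory (mod_cat \<Lambda>) X"
    using assms(3) by (rule resolving_subcategory.intro)
  then show ?thesis by (rule resolving_subcategory.E_cw_exact)
qed

end
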